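(* Let $(B,\mathcal S)$ be a quasitriangular Hopf algebra over a field $\Bbbk$, and let $(\mathcal C,\circ,I,\bullet,J)=({}_B\mathfrak M_B,\otimes_B,B,\otimes_\Bbbk,\Bbbk)$ be the $\bullet$-braided duoidal category of $B$-bimodules with its reversion. Then the category $\mathrm{Hopf}_{\mathrm{coc}}(\mathcal C,\circ,\bullet)$ of cocommutative Hopf monoids in it is isomorphic to the coslice category $(B,\mathcal S)/\mathrm{QTrHopf}$ of quasitriangular Hopf algebras under $(B,\mathcal S)$.
   Context: Duoidal structure on ${}_B\mathfrak M_B$: $\circ=\otimes_B$, $I=B$; $\bullet=\otimes_\Bbbk$ with diagonal $B$-bimodule structure $b(x\bullet y)b'=b_1xb_1'\bullet b_2yb_2'$, $J=\Bbbk$ a $B$-bimodule via $\varepsilon_B$; interchange law $\zeta_{A,E,C,D}((a\bullet e)\circ(c\bullet d))=(a\circ c)\bullet(e\circ d)$; $\Delta_I=\Delta_B$, $m_J(k\circ k')=kk'$, $\varepsilon_I=u_J=\varepsilon_B$. Braiding for $\bullet$: $\sigma_{X,Y}(x\otimes y)=\mathcal S^{-1}(y\otimes x)\mathcal S$. Bimonoid: an object $H$ that is a monoid for $\circ$ and a comonoid for $\bullet$ with $\Delta_Hm_H=(m_H\bullet m_H)\zeta_{H,H,H,H}(\Delta_H\circ\Delta_H)$, $\varepsilon_Hm_H=m_J(\varepsilon_H\circ\varepsilon_H)$, $\Delta_Hu_H=(u_H\bullet u_H)\Delta_I$, $\varepsilon_Hu_H=\varepsilon_I$; morphisms are morphisms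 of monoids and comonoids; cocommutative means $\sigma_{H,H}\Delta_H=\Delta_H$. Reversion and Hopf monoids: for a $B$-bimodule $X$, $X^-$ is the vector space $X$ (elements written $x^-$) with $bx^-b'=(S_B(b')xS_B(b))^-$ (the remaining structure of the reversion is given by $\phi^\circ(x^-\circ y^-)=(y\circ x)^-$, $\phi^\circ_0(b)=S_B(b)^-$, $\phi^\bullet(x^-\bullet y^-)=(y\bullet x)^-$, $\phi^\bullet_0(k)=k^-$ and obvious rearrangement maps $\gamma,\delta,\widetilde\gamma,\widetilde\delta$, and is not otherwise needed). Put $\psi_{X,Y}:X^-\bullet Y\to J\circ(I\bullet(X\circ Y))$, $x^-\bullet y\mapsto1_\Bbbk\circ(1_B\bullet(x\circ y))$ and $\varphi_{X,Y}:X\bullet Y^-\to((X\circ Y)\bullet I)\circ J$, $x\bullet y^-\mapsto((x\circ y)\bullet1_B)\circ1_\Bbbk$. A Hopf monoid is a bimonoid $H$ admitting a $B$-bimodule map $\Sigma_H:H\to H^-$ with, for all $h\in H$, $((m_H\bullet I)\circ J)\varphi_{H,H}(h_1\bullet\Sigma_H(h_2))=\varepsilon_H(h)\,(1_H\bullet1_B)\circ1_\Bbbk$ and $(J\circ(I\bullet m_H))\psi_{H,H}(\Sigma_H(h_1)\bullet h_2)=\varepsilon_H(h)\,1_\Bbbk\circ(1_B\bullet1_H)$, where $1_H=u_H(1_B)$. $\mathrm{Hopf}_{\mathrm{coc}}(\mathcal C,\circ,\bullet)$ is the full subcategory of bimonoids given by the cocommutative Hopf monoids. A quasitriangular Hopf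 algebra $(H,\mathcal R)$ is a Hopf algebra with an invertible $\mathcal R\in H\otimes H$ such that $\Delta^{\mathrm{op}}(\cdot)=\mathcal R\Delta(\cdot)\mathcal R^{-1}$, $(\mathrm{Id}\otimes\Delta)(\mathcal R)=\mathcal R_{13}\mathcal R_{12}$, $(\Delta\otimes\mathrm{Id})(\mathcal R)=\mathcal R_{13}\mathcal R_{23}$; a morphism $f:(A,\mathcal R)\to(H,\mathcal S)$ in $\mathrm{QTrHopf}$ is a bialgebra map with $(f\otimes f)(\mathcal R)=\mathcal S$. *)

theory Defs
  imports Complex_Main "HOL-Library.FuncSet" "HOL-Library.Poly_Mapping"
begin

section \<open>Categories\<close>

record ('o, 'm) category =
  obj :: "'o set"
  hom :: "'o \<Rightarrow> 'o \<Rightarrow> 'm set"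
  ident :: "'o \<Rightarrow> 'm"
  comp :: "'o \<Rightarrow> 'o \<Rightarrow> 'o \<Rightarrow> 'm \<Rightarrow> 'm \<Rightarrow> 'm"

text \<open>
  For \<open>f \<in> hom C X Y\<close> and \<open>g \<in> hom C Y Z\<close> the composite ``\<open>g\<close> after \<open>f\<close>'' is
  \<open>comp C X Y Z g f\<close>. Hom-sets need not be disjoint: a morphism is always considered
  together with its source and target.
\<close>

definition is_category :: "('o, 'm) category \<Rightarrow> bool" where
  "is_category C \<longleftrightarrow>
    (\<forall>X\<in>obj C. ident C X \<in> hom C X X) \<and>
    (\<forall>X\<in>obj C. \<forall>Y\<in>obj C. \<forall>Z\<in>obj C. \<forall>f\<in>hom C X Y. \<forall>g\<in>hom C Y Z.
       comp C X Y Z g f \<in> hom C X Z) \<and>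
    (\<forall>X\<in>obj C. \<forall>Y\<in>obj C. \<forall>f\<in>hom C X Y.
       comp C X X Y f (ident C X) = f \<and> comp C X Y Y (ident C Y) f = f) \<and>
    (\<forall>W\<in>obj C. \<forall>X\<in>obj C. \<forall>Y\<in>obj C. \<forall>Z\<in>obj C.
       \<forall>f\<in>hom C W X. \<forall>g\<in>hom C X Y. \<forall>h\<in>hom C Y Z.
       comp C W X Z (comp C X Y Z h g) f = comp C W Y Z h (comp C W X Y g f))"

definition is_functor ::
  "('o, 'm) category \<Rightarrow> ('p, 'n) category \<Rightarrow> ('o \<Rightarrow> 'p) \<Rightarrow> ('o \<Rightarrow> 'o \<Rightarrow> 'm \<Rightarrow> 'n) \<Rightarrow> bool" where
  "is_functor C D F\<^sub>o F\<^sub>m \<longleftrightarrow>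
    (\<forall>X\<in>obj C. F\<^sub>o X \<in> obj D) \<and>
    (\<forall>X\<in>obj C. \<forall>Y\<in>obj C. \<forall>f\<in>hom C X Y. F\<^sub>m X Y f \<in> hom D (F\<^sub>o X) (F\<^sub>o Y)) \<and>
    (\<forall>X\<in>obj C. F\<^sub>m X X (ident C X) = ident D (F\<^sub>o X)) \<and>
    (\<forall>X\<in>obj C. \<forall>Y\<in>obj C. \<forall>Z\<in>obj C. \<forall>f\<in>hom C X Y. \<forall>g\<in>hom C Y Z.
       F\<^sub>m X Z (comp C X Y Z g f) = comp D (F\<^sub>o X) (F\<^sub>o Y) (F\<^sub>o Z) (F\<^sub>m Y Z g) (F\<^sub>m X Y f))"

definition isomorphic_categories :: "('o, 'm) category \<Rightarrow> ('p, 'n) category \<Rightarrow> bool" where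
  "isomorphic_categories C D \<longleftrightarrow>
    is_category C \<and> is_category D \<and>
    (\<exists>F\<^sub>o F\<^sub>m G\<^sub>o G\<^sub>m.
       is_functor C D F\<^sub>o F\<^sub>m \<and> is_functor D C G\<^sub>o G\<^sub>m \<and>
       (\<forall>X\<in>obj C. G\<^sub>o (F\<^sub>o X) = X) \<and>
       (\<forall>X\<in>obj C. \<forall>Y\<in>obj C. \<forall>f\<in>hom C X Y. G\<^sub>m (F\<^sub>o X) (F\<^sub>o Y) (F\<^sub>m X Y f) = f) \<and>
       (\<forall>U\<in>obj D. F\<^sub>o (G\<^sub>o U) = U) \<and>
       (\<forall>U\<in>obj D. \<forall>V\<in>obj D. \<forall>g\<in>hom D U V. F\<^sub>m (G\<^sub>o U) (G\<^sub>o V) (G\<^sub>m U V g) = g))"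

definition full_subcategory :: "('o, 'm) category \<Rightarrow> ('o \<Rightarrow> bool) \<Rightarrow> ('o, 'm) category" where
  "full_subcategory C P = C\<lparr>obj := {X \<in> obj C. P X}\<rparr>"

definition coslice :: "('o, 'm) category \<Rightarrow> 'o \<Rightarrow> ('o \<times> 'm, 'm) category" where
  "coslice C A =
    \<lparr>obj = {(X, f). X \<in> obj C \<and> f \<in> hom C A X},
     hom = (\<lambda>(X, f) (Y, g). {h \<in> hom C X Y. comp C A X Y h f = g}),
     ident = (\<lambda>(X, f). ident C X),
     comp = (\<lambda>(X, f) (Y, g) (Z, h). comp C X Y Z)\<rparr>"

section \<open>Vector spaces\<close>

text \<open>
  The scalars are a type \<open>'k\<close> of class \<open>field\<close>; vector spaces have explicit carriers. All
  operations and maps are required to be \<open>undefined\<close> outside their intended domain, so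
  that equality in HOL is equality of mathematical structures and of morphisms.
\<close>

record ('k, 'v) vspace =
  carr :: "'v set"
  add :: "'v \<Rightarrow> 'v \<Rightarrow> 'v"
  zero :: "'v"
  scal :: "'k \<Rightarrow> 'v \<Rightarrow> 'v"

definition is_vspace :: "('k::field, 'v, 'r) vspace_scheme \<Rightarrow> bool" where
  "is_vspace V \<longleftrightarrow>
    add V \<in> carr V \<rightarrow>\<^sub>E carr V \<rightarrow>\<^sub>E carr V \<and>
    zero V \<in> carr V \<and>
    scal V \<in> UNIV \<rightarrow> carr V \<rightarrow>\<^sub>E carr V \<and>
    (\<forall>x\<in>carr V. \<forall>y\<in>carr V. \<forall>z\<in>carr V. add V (add V x y) z = add V x (add V y z)) \<and>
    (\<forall>x\<in>carr V. \<forall>y\<in>carr V. add V x y = add V y x) \<and>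
    (\<forall>x\<in>carr V. add V (zero V) x = x) \<and>
    (\<forall>x\<in>carr V. \<exists>y\<in>carr V. add V x y = zero V) \<and>
    (\<forall>c. \<forall>x\<in>carr V. \<forall>y\<in>carr V. scal V c (add V x y) = add V (scal V c x) (scal V c y)) \<and>
    (\<forall>c d. \<forall>x\<in>carr V. scal V (c + d) x = add V (scal V c x) (scal V d x)) \<and>
    (\<forall>c d. \<forall>x\<in>carr V. scal V (c * d) x = scal V c (scal V d x)) \<and>
    (\<forall>x\<in>carr V. scal V 1 x = x)"

definition linear_maps ::
  "('k::field, 'v, 'r) vspace_scheme \<Rightarrow> ('k, 'w, 's) vspace_scheme \<Rightarrow> ('v \<Rightarrow> 'w) set" where
  "linear_maps V W = {f \<in> carr V \<rightarrow>\<^sub>E carr W.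
    (\<forall>x\<in>carr V. \<forall>y\<in>carr V. f (add V x y) = add W (f x) (f y)) \<and>
    (\<forall>c. \<forall>x\<in>carr V. f (scal V c x) = scal W c (f x))}"

definition bilinear_maps ::
  "('k::field, 'v, 'r) vspace_scheme \<Rightarrow> ('k, 'w, 's) vspace_scheme \<Rightarrow> ('k, 'z, 't) vspace_scheme
    \<Rightarrow> ('v \<Rightarrow> 'w \<Rightarrow> 'z) set" where
  "bilinear_maps V W Z = {\<beta> \<in> carr V \<rightarrow>\<^sub>E carr W \<rightarrow>\<^sub>E carr Z.
    (\<forall>x\<in>carr V. \<beta> x \<in> linear_maps W Z) \<and>
    (\<forall>y\<in>carr W. (\<lambda>x\<in>carr V. \<beta> x y) \<in> linear_maps V Z)}"

definition id_map :: "('k, 'v, 'r) vspace_scheme \<Rightarrow> 'v \<Rightarrow> 'v" where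
  "id_map V = (\<lambda>x\<in>carr V. x)"

definition ground :: "('k::field, 'k) vspace" where
  "ground = \<lparr>carr = UNIV, add = (+), zero = 0, scal = (*)\<rparr>"

section \<open>Tensor products\<close>

text \<open>
  A tensor product of \<open>V\<close> and \<open>W\<close> is the quotient of the free vector space on
  \<open>carr V \<times> carr W\<close> by a subspace \<open>N\<close>; its elements are the cosets of \<open>N\<close>. Here \<open>N\<close> is
  spanned by the bilinearity relations and, for \<open>\<otimes>\<^sub>B\<close>, in addition by the balancing relations.
\<close>

type_synonym ('k, 'v, 'w) tens = "(('v \<times> 'w) \<Rightarrow>\<^sub>0 'k) set"

abbreviation gen :: "'v \<Rightarrow> 'w \<Rightarrow> (('v \<times> 'w) \<Rightarrow>\<^sub>0 'k::field)" where
  "gen x y \<equiv> Poly_Mapping.single (x, y) 1"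

definition fscale :: "'k::field \<Rightarrow> ('i \<Rightarrow>\<^sub>0 'k) \<Rightarrow> ('i \<Rightarrow>\<^sub>0 'k)" where
  "fscale c p = Poly_Mapping.map (\<lambda>a. c * a) p"

lemma lookup_fscale: "Poly_Mapping.lookup (fscale c p) i = c * Poly_Mapping.lookup p i"
  by (simp add: fscale_def map.rep_eq when_def)

lemma vector_space_fscale: "vector_space (fscale :: 'k::field \<Rightarrow> ('i \<Rightarrow>\<^sub>0 'k) \<Rightarrow> ('i \<Rightarrow>\<^sub>0 'k))"
  by unfold_locales
    (auto simp: lookup_fscale poly_mapping_eq_iff fun_eq_iff lookup_add distrib_left distrib_right)

definition coset :: "('i \<Rightarrow>\<^sub>0 'k::field) set \<Rightarrow> ('i \<Rightarrow>\<^sub>0 'k) \<Rightarrow> ('i \<Rightarrow>\<^sub>0 'k) set" where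
  "coset N p = {p + n | n. n \<in> N}"

definition quotient_space ::
  "'v set \<Rightarrow> 'w set \<Rightarrow> ('k::field, 'v, 'w) tens \<Rightarrow> ('k, ('k, 'v, 'w) tens) vspace" where
  "quotient_space A C N =
    (let Q = {coset N p | p. Poly_Mapping.keys p \<subseteq> A \<times> C} in
     \<lparr>carr = Q,
      add = (\<lambda>P\<in>Q. \<lambda>P'\<in>Q. \<Union>p\<in>P. \<Union>p'\<in>P'. coset N (p + p')),
      zero = N,
      scal = (\<lambda>c. \<lambda>P\<in>Q. \<Union>p\<in>P. coset N (fscale c p))\<rparr>)"

text \<open>The linear map determined by its values \<open>\<phi> x y\<close> on pure tensors; meaningful only if
  \<open>\<phi>\<close> respects the relations spanning \<open>N\<close>, as it does wherever this is used below.\<close>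

definition induced ::
  "'v set \<Rightarrow> 'w set \<Rightarrow> ('k::field, 'v, 'w) tens \<Rightarrow> ('k, 'z, 't) vspace_scheme
    \<Rightarrow> ('v \<Rightarrow> 'w \<Rightarrow> 'z) \<Rightarrow> ('k, 'v, 'w) tens \<Rightarrow> 'z" where
  "induced A C N Z \<phi> =
    (THE f. f \<in> linear_maps (quotient_space A C N) Z \<and>
            (\<forall>x\<in>A. \<forall>y\<in>C. f (coset N (gen x y)) = \<phi> x y))"

definition bilinearity_relations ::
  "('k::field, 'v, 'r) vspace_scheme \<Rightarrow> ('k, 'w, 's) vspace_scheme \<Rightarrow> ('k, 'v, 'w) tens" where
  "bilinearity_relations V W =
    {gen (add V x x') y - gen x y - gen x' y | x x' y. x \<in> carr V \<and> x' \<in> carr V \<and> y \<in> carr W} \<union>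
    {gen x (add W y y') - gen x y - gen x y' | x y y'. x \<in> carr V \<and> y \<in> carr W \<and> y' \<in> carr W} \<union>
    {gen (scal V c x) y - fscale c (gen x y) | c x y. x \<in> carr V \<and> y \<in> carr W} \<union>
    {gen x (scal W c y) - fscale c (gen x y) | c x y. x \<in> carr V \<and> y \<in> carr W}"

subsection \<open>The tensor product over the ground field\<close>

definition tnull ::
  "('k::field, 'v, 'r) vspace_scheme \<Rightarrow> ('k, 'w, 's) vspace_scheme \<Rightarrow> ('k, 'v, 'w) tens" where
  "tnull V W = module.span fscale (bilinearity_relations V W)"

definition tensor ::
  "('k::field, 'v, 'r) vspace_scheme \<Rightarrow> ('k, 'w, 's) vspace_scheme
    \<Rightarrow> ('k, ('k, 'v, 'w) tens) vspace" where
  "tensor V W = quotient_space (carr V) (carr W) (tnull V W)"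

definition tpure ::
  "('k::field, 'v, 'r) vspace_scheme \<Rightarrow> ('k, 'w, 's) vspace_scheme
    \<Rightarrow> 'v \<Rightarrow> 'w \<Rightarrow> ('k, 'v, 'w) tens" where
  "tpure V W x y = coset (tnull V W) (gen x y)"

definition tlift ::
  "('k::field, 'v, 'r) vspace_scheme \<Rightarrow> ('k, 'w, 's) vspace_scheme \<Rightarrow> ('k, 'z, 't) vspace_scheme
    \<Rightarrow> ('v \<Rightarrow> 'w \<Rightarrow> 'z) \<Rightarrow> ('k, 'v, 'w) tens \<Rightarrow> 'z" where
  "tlift V W Z \<phi> = induced (carr V) (carr W) (tnull V W) Z \<phi>"

definition tmap ::
  "('k::field, 'v, 'r) vspace_scheme \<Rightarrow> ('k, 'w, 's) vspace_scheme
    \<Rightarrow> ('k, 'v', 'r') vspace_scheme \<Rightarrow> ('k, 'w', 's') vspace_scheme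
    \<Rightarrow> ('v \<Rightarrow> 'v') \<Rightarrow> ('w \<Rightarrow> 'w') \<Rightarrow> ('k, 'v, 'w) tens \<Rightarrow> ('k, 'v', 'w') tens" where
  "tmap V W V' W' f g = tlift V W (tensor V' W') (\<lambda>x y. tpure V' W' (f x) (g y))"

definition tflip ::
  "('k::field, 'v, 'r) vspace_scheme \<Rightarrow> ('k, 'w, 's) vspace_scheme
    \<Rightarrow> ('k, 'v, 'w) tens \<Rightarrow> ('k, 'w, 'v) tens" where
  "tflip V W = tlift V W (tensor W V) (\<lambda>x y. tpure W V y x)"

definition tassoc ::
  "('k::field, 'u, 'q) vspace_scheme \<Rightarrow> ('k, 'v, 'r) vspace_scheme \<Rightarrow> ('k, 'w, 's) vspace_scheme
    \<Rightarrow> ('k, ('k, 'u, 'v) tens, 'w) tens \<Rightarrow> ('k, 'u, ('k, 'v, 'w) tens) tens" where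
  "tassoc U V W =
    tlift (tensor U V) W (tensor U (tensor V W))
      (\<lambda>t z. tlift U V (tensor U (tensor V W))
               (\<lambda>x y. tpure U (tensor V W) x (tpure V W y z)) t)"

definition tlunit ::
  "('k::field, 'v, 'r) vspace_scheme \<Rightarrow> ('k, 'k, 'v) tens \<Rightarrow> 'v" where
  "tlunit V = tlift ground V V (\<lambda>c x. scal V c x)"

definition trunit ::
  "('k::field, 'v, 'r) vspace_scheme \<Rightarrow> ('k, 'v, 'k) tens \<Rightarrow> 'v" where
  "trunit V = tlift V ground V (\<lambda>x c. scal V c x)"

section \<open>Quasitriangular Hopf algebras\<close>

record ('k, 'a) algebra = "('k, 'a) vspace" +
  mult :: "'a \<Rightarrow> 'a \<Rightarrow> 'a"
  one :: "'a"

record (overloaded) ('k::zero, 'a) bialgebra = "('k, 'a) algebra" +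
  comult :: "'a \<Rightarrow> ('k, 'a, 'a) tens"
  counit :: "'a \<Rightarrow> 'k"

definition is_algebra :: "('k::field, 'a, 'r) algebra_scheme \<Rightarrow> bool" where
  "is_algebra A \<longleftrightarrow>
    is_vspace A \<and> mult A \<in> bilinear_maps A A A \<and> one A \<in> carr A \<and>
    (\<forall>x\<in>carr A. \<forall>y\<in>carr A. \<forall>z\<in>carr A. mult A (mult A x y) z = mult A x (mult A y z)) \<and>
    (\<forall>x\<in>carr A. mult A (one A) x = x \<and> mult A x (one A) = x)"

definition tensor_algebra ::
  "('k::field, 'a, 'r) algebra_scheme \<Rightarrow> ('k, 'c, 's) algebra_scheme
    \<Rightarrow> ('k, ('k, 'a, 'c) tens) algebra" where
  "tensor_algebra A C =
    vspace.extend (tensor A C) (algebra.fields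
      (\<lambda>t\<in>carr (tensor A C). \<lambda>t'\<in>carr (tensor A C).
         tlift A C (tensor A C) (\<lambda>x y.
           tlift A C (tensor A C) (\<lambda>x' y'. tpure A C (mult A x x') (mult C y y')) t') t)
      (tpure A C (one A) (one C)))"

definition is_coalgebra ::
  "('k::field, 'v, 'r) vspace_scheme \<Rightarrow> ('v \<Rightarrow> ('k, 'v, 'v) tens) \<Rightarrow> ('v \<Rightarrow> 'k) \<Rightarrow> bool" where
  "is_coalgebra V \<Delta> \<epsilon> \<longleftrightarrow>
    is_vspace V \<and> \<Delta> \<in> linear_maps V (tensor V V) \<and> \<epsilon> \<in> linear_maps V ground \<and>
    (\<forall>x\<in>carr V.
       tassoc V V V (tmap V V (tensor V V) V \<Delta> (id_map V) (\<Delta> x)) =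
         tmap V V V (tensor V V) (id_map V) \<Delta> (\<Delta> x)) \<and>
    (\<forall>x\<in>carr V. tlunit V (tmap V V ground V \<epsilon> (id_map V) (\<Delta> x)) = x) \<and>
    (\<forall>x\<in>carr V. trunit V (tmap V V V ground (id_map V) \<epsilon> (\<Delta> x)) = x)"

definition is_bialgebra :: "('k::field, 'a, 'r) bialgebra_scheme \<Rightarrow> bool" where
  "is_bialgebra A \<longleftrightarrow>
    is_algebra A \<and> is_coalgebra A (comult A) (counit A) \<and>
    (\<forall>x\<in>carr A. \<forall>y\<in>carr A.
       comult A (mult A x y) = mult (tensor_algebra A A) (comult A x) (comult A y)) \<and>
    comult A (one A) = one (tensor_algebra A A) \<and>
    (\<forall>x\<in>carr A. \<forall>y\<in>carr A. counit A (mult A x y) = counit A x * counit A y) \<and>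
    counit A (one A) = 1"

definition is_antipode :: "('k::field, 'a, 'r) bialgebra_scheme \<Rightarrow> ('a \<Rightarrow> 'a) \<Rightarrow> bool" where
  "is_antipode A \<Sigma> \<longleftrightarrow>
    \<Sigma> \<in> linear_maps A A \<and>
    (\<forall>x\<in>carr A.
       tlift A A A (\<lambda>y z. mult A (\<Sigma> y) z) (comult A x) = scal A (counit A x) (one A) \<and>
       tlift A A A (\<lambda>y z. mult A y (\<Sigma> z)) (comult A x) = scal A (counit A x) (one A))"

definition is_hopf_algebra :: "('k::field, 'a, 'r) bialgebra_scheme \<Rightarrow> bool" where
  "is_hopf_algebra A \<longleftrightarrow> is_bialgebra A \<and> (\<exists>\<Sigma>. is_antipode A \<Sigma>)"

definition antipode :: "('k::field, 'a, 'r) bialgebra_scheme \<Rightarrow> 'a \<Rightarrow> 'a" where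
  "antipode A = (THE \<Sigma>. is_antipode A \<Sigma>)"

definition inverse_of :: "('k::field, 'a, 'r) algebra_scheme \<Rightarrow> 'a \<Rightarrow> 'a \<Rightarrow> bool" where
  "inverse_of A x y \<longleftrightarrow> y \<in> carr A \<and> mult A x y = one A \<and> mult A y x = one A"

definition alg_inverse :: "('k::field, 'a, 'r) algebra_scheme \<Rightarrow> 'a \<Rightarrow> 'a" where
  "alg_inverse A x = (THE y. inverse_of A x y)"

text \<open>The triple tensor power is bracketed as \<open>A \<otimes> (A \<otimes> A)\<close>.\<close>

abbreviation algebra2 ::
  "('k::field, 'a, 'r) algebra_scheme \<Rightarrow> ('k, ('k, 'a, 'a) tens) algebra" where
  "algebra2 A \<equiv> tensor_algebra A A"

abbreviation algebra3 ::
  "('k::field, 'a, 'r) algebra_scheme \<Rightarrow> ('k, ('k, 'a, ('k, 'a, 'a) tens) tens) algebra" where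
  "algebra3 A \<equiv> tensor_algebra A (algebra2 A)"

definition leg12 ::
  "('k::field, 'a, 'r) algebra_scheme \<Rightarrow> ('k, 'a, 'a) tens \<Rightarrow> ('k, 'a, ('k, 'a, 'a) tens) tens" where
  "leg12 A R = tlift A A (algebra3 A) (\<lambda>r s. tpure A (algebra2 A) r (tpure A A s (one A))) R"

definition leg13 ::
  "('k::field, 'a, 'r) algebra_scheme \<Rightarrow> ('k, 'a, 'a) tens \<Rightarrow> ('k, 'a, ('k, 'a, 'a) tens) tens" where
  "leg13 A R = tlift A A (algebra3 A) (\<lambda>r s. tpure A (algebra2 A) r (tpure A A (one A) s)) R"

definition leg23 ::
  "('k::field, 'a, 'r) algebra_scheme \<Rightarrow> ('k, 'a, 'a) tens \<Rightarrow> ('k, 'a, ('k, 'a, 'a) tens) tens" where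
  "leg23 A R = tpure A (algebra2 A) (one A) R"

definition is_quasitriangular ::
  "('k::field, 'a, 'r) bialgebra_scheme \<Rightarrow> ('k, 'a, 'a) tens \<Rightarrow> bool" where
  "is_quasitriangular A R \<longleftrightarrow>
    is_hopf_algebra A \<and>
    R \<in> carr (algebra2 A) \<and> (\<exists>R'. inverse_of (algebra2 A) R R') \<and>
    (\<forall>x\<in>carr A.
       tflip A A (comult A x) =
         mult (algebra2 A) (mult (algebra2 A) R (comult A x)) (alg_inverse (algebra2 A) R)) \<and>
    tmap A A A (algebra2 A) (id_map A) (comult A) R = mult (algebra3 A) (leg13 A R) (leg12 A R) \<and>
    tassoc A A A (tmap A A (algebra2 A) A (comult A) (id_map A) R) =
      mult (algebra3 A) (leg13 A R) (leg23 A R)"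

definition bialgebra_maps ::
  "('k::field, 'a, 'r) bialgebra_scheme \<Rightarrow> ('k, 'c, 's) bialgebra_scheme \<Rightarrow> ('a \<Rightarrow> 'c) set" where
  "bialgebra_maps A C = {f \<in> linear_maps A C.
    (\<forall>x\<in>carr A. \<forall>y\<in>carr A. f (mult A x y) = mult C (f x) (f y)) \<and>
    f (one A) = one C \<and>
    (\<forall>x\<in>carr A. tmap A A C C f f (comult A x) = comult C (f x)) \<and>
    (\<forall>x\<in>carr A. counit C (f x) = counit A x)}"

text \<open>The category of quasitriangular Hopf algebras whose carrier is a subset of the type \<open>'u\<close>.\<close>

definition qtr_hopf ::
  "(('k::field, 'u) bialgebra \<times> ('k, 'u, 'u) tens, 'u \<Rightarrow> 'u) category" where
  "qtr_hopf =
    \<lparr>obj = {(A, R). is_quasitriangular A R},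
     hom = (\<lambda>(A, R) (C, S). {f \<in> bialgebra_maps A C. tmap A A C C f f R = S}),
     ident = (\<lambda>(A, R). id_map A),
     comp = (\<lambda>(A, R) (C, S) (D, T). compose (carr A))\<rparr>"

section \<open>The duoidal category of bimodules\<close>

text \<open>
  From here on \<open>B\<close> is the Hopf algebra over which bimodules are taken. The constructions
  on bimodules are polymorphic in the types of the carriers, since the carrier of a tensor
  product has a different type than the carriers of its factors.
\<close>

record ('k, 'b, 'x) bimodule = "('k, 'x) vspace" +
  lact :: "'b \<Rightarrow> 'x \<Rightarrow> 'x"
  ract :: "'x \<Rightarrow> 'b \<Rightarrow> 'x"

definition is_bimodule ::
  "('k::field, 'b) bialgebra \<Rightarrow> ('k, 'b, 'x, 'r) bimodule_scheme \<Rightarrow> bool" where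
  "is_bimodule B X \<longleftrightarrow>
    is_vspace X \<and> lact X \<in> bilinear_maps B X X \<and> ract X \<in> bilinear_maps X B X \<and>
    (\<forall>x\<in>carr X. lact X (one B) x = x \<and> ract X x (one B) = x) \<and>
    (\<forall>b\<in>carr B. \<forall>b'\<in>carr B. \<forall>x\<in>carr X.
       lact X (mult B b b') x = lact X b (lact X b' x) \<and>
       ract X x (mult B b b') = ract X (ract X x b) b' \<and>
       ract X (lact X b x) b' = lact X b (ract X x b'))"

definition bimodule_maps ::
  "('k::field, 'b) bialgebra \<Rightarrow> ('k, 'b, 'x, 'r) bimodule_scheme \<Rightarrow> ('k, 'b, 'y, 's) bimodule_scheme
    \<Rightarrow> ('x \<Rightarrow> 'y) set" where
  "bimodule_maps B X Y = {f \<in> linear_maps X Y.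
    \<forall>b\<in>carr B. \<forall>x\<in>carr X. f (lact X b x) = lact Y b (f x) \<and> f (ract X x b) = ract Y (f x) b}"

subsection \<open>The monoidal structure \<open>\<circ> = \<otimes>\<^sub>B\<close> with unit \<open>I = B\<close>\<close>

definition unitI :: "('k::field, 'b) bialgebra \<Rightarrow> ('k, 'b, 'b) bimodule" where
  "unitI B = vspace.extend (vspace.truncate B) (bimodule.fields (mult B) (mult B))"

definition cnull ::
  "('k::field, 'b) bialgebra \<Rightarrow> ('k, 'b, 'x, 'r) bimodule_scheme \<Rightarrow> ('k, 'b, 'y, 's) bimodule_scheme
    \<Rightarrow> ('k, 'x, 'y) tens" where
  "cnull B X Y = module.span fscale (bilinearity_relations X Y \<union>
    {gen (ract X x b) y - gen x (lact Y b y) | x b y. x \<in> carr X \<and> b \<in> carr B \<and> y \<in> carr Y})"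

definition cpure ::
  "('k::field, 'b) bialgebra \<Rightarrow> ('k, 'b, 'x, 'r) bimodule_scheme \<Rightarrow> ('k, 'b, 'y, 's) bimodule_scheme
    \<Rightarrow> 'x \<Rightarrow> 'y \<Rightarrow> ('k, 'x, 'y) tens" where
  "cpure B X Y x y = coset (cnull B X Y) (gen x y)"

definition clift ::
  "('k::field, 'b) bialgebra \<Rightarrow> ('k, 'b, 'x, 'r) bimodule_scheme \<Rightarrow> ('k, 'b, 'y, 's) bimodule_scheme
    \<Rightarrow> ('k, 'z, 't) vspace_scheme \<Rightarrow> ('x \<Rightarrow> 'y \<Rightarrow> 'z) \<Rightarrow> ('k, 'x, 'y) tens \<Rightarrow> 'z" where
  "clift B X Y Z \<phi> = induced (carr X) (carr Y) (cnull B X Y) Z \<phi>"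

definition circ ::
  "('k::field, 'b) bialgebra \<Rightarrow> ('k, 'b, 'x, 'r) bimodule_scheme \<Rightarrow> ('k, 'b, 'y, 's) bimodule_scheme
    \<Rightarrow> ('k, 'b, ('k, 'x, 'y) tens) bimodule" where
  "circ B X Y =
    (let T = quotient_space (carr X) (carr Y) (cnull B X Y) in
     vspace.extend T (bimodule.fields
       (\<lambda>b\<in>carr B. \<lambda>t\<in>carr T. clift B X Y T (\<lambda>x y. cpure B X Y (lact X b x) y) t)
       (\<lambda>t\<in>carr T. \<lambda>b\<in>carr B. clift B X Y T (\<lambda>x y. cpure B X Y x (ract Y y b)) t)))"

definition cmap ::
  "('k::field, 'b) bialgebra \<Rightarrow> ('k, 'b, 'x, 'r) bimodule_scheme \<Rightarrow> ('k, 'b, 'y, 's) bimodule_scheme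
    \<Rightarrow> ('k, 'b, 'x', 'r') bimodule_scheme \<Rightarrow> ('k, 'b, 'y', 's') bimodule_scheme
    \<Rightarrow> ('x \<Rightarrow> 'x') \<Rightarrow> ('y \<Rightarrow> 'y') \<Rightarrow> ('k, 'x, 'y) tens \<Rightarrow> ('k, 'x', 'y') tens" where
  "cmap B X Y X' Y' f g = clift B X Y (circ B X' Y') (\<lambda>x y. cpure B X' Y' (f x) (g y))"

definition cassoc ::
  "('k::field, 'b) bialgebra \<Rightarrow> ('k, 'b, 'x, 'r) bimodule_scheme \<Rightarrow> ('k, 'b, 'y, 's) bimodule_scheme
    \<Rightarrow> ('k, 'b, 'z, 't) bimodule_scheme
    \<Rightarrow> ('k, ('k, 'x, 'y) tens, 'z) tens \<Rightarrow> ('k, 'x, ('k, 'y, 'z) tens) tens" where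
  "cassoc B X Y Z =
    clift B (circ B X Y) Z (circ B X (circ B Y Z))
      (\<lambda>t z. clift B X Y (circ B X (circ B Y Z))
               (\<lambda>x y. cpure B X (circ B Y Z) x (cpure B Y Z y z)) t)"

definition clunit ::
  "('k::field, 'b) bialgebra \<Rightarrow> ('k, 'b, 'x, 'r) bimodule_scheme \<Rightarrow> ('k, 'b, 'x) tens \<Rightarrow> 'x" where
  "clunit B X = clift B (unitI B) X X (\<lambda>b x. lact X b x)"

definition crunit ::
  "('k::field, 'b) bialgebra \<Rightarrow> ('k, 'b, 'x, 'r) bimodule_scheme \<Rightarrow> ('k, 'x, 'b) tens \<Rightarrow> 'x" where
  "crunit B X = clift B X (unitI B) X (\<lambda>x b. ract X x b)"

subsection \<open>The monoidal structure \<open>\<bullet> = \<otimes>\<^sub>k\<close> with unit \<open>J = k\<close>\<close>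

definition unitJ :: "('k::field, 'b) bialgebra \<Rightarrow> ('k, 'b, 'k) bimodule" where
  "unitJ B = vspace.extend ground (bimodule.fields
    (\<lambda>b\<in>carr B. \<lambda>c. counit B b * c) (\<lambda>c. \<lambda>b\<in>carr B. c * counit B b))"

text \<open>
  The componentwise actions of \<open>B \<otimes> B\<close>: \<open>(r \<otimes> s)(x \<otimes> y) = rx \<otimes> sy\<close> and
  \<open>(x \<otimes> y)(r \<otimes> s) = xr \<otimes> ys\<close>. They enter both the diagonal action, via \<open>\<Delta>\<^sub>B\<close>, and the braiding.
\<close>

definition lact2 ::
  "('k::field, 'b) bialgebra \<Rightarrow> ('k, 'b, 'x, 'r) bimodule_scheme \<Rightarrow> ('k, 'b, 'y, 's) bimodule_scheme
    \<Rightarrow> ('k, 'b, 'b) tens \<Rightarrow> ('k, 'x, 'y) tens \<Rightarrow> ('k, 'x, 'y) tens" where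
  "lact2 B X Y R t =
    tlift B B (tensor X Y) (\<lambda>r s. tmap X Y X Y (lact X r) (lact Y s) t) R"

definition ract2 ::
  "('k::field, 'b) bialgebra \<Rightarrow> ('k, 'b, 'x, 'r) bimodule_scheme \<Rightarrow> ('k, 'b, 'y, 's) bimodule_scheme
    \<Rightarrow> ('k, 'x, 'y) tens \<Rightarrow> ('k, 'b, 'b) tens \<Rightarrow> ('k, 'x, 'y) tens" where
  "ract2 B X Y t R =
    tlift B B (tensor X Y) (\<lambda>r s. tmap X Y X Y (\<lambda>x. ract X x r) (\<lambda>y. ract Y y s) t) R"

definition bullet ::
  "('k::field, 'b) bialgebra \<Rightarrow> ('k, 'b, 'x, 'r) bimodule_scheme \<Rightarrow> ('k, 'b, 'y, 's) bimodule_scheme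
    \<Rightarrow> ('k, 'b, ('k, 'x, 'y) tens) bimodule" where
  "bullet B X Y =
    vspace.extend (tensor X Y) (bimodule.fields
      (\<lambda>b\<in>carr B. \<lambda>t\<in>carr (tensor X Y). lact2 B X Y (comult B b) t)
      (\<lambda>t\<in>carr (tensor X Y). \<lambda>b\<in>carr B. ract2 B X Y t (comult B b)))"

text \<open>
  As \<open>\<bullet>\<close> has \<open>\<otimes>\<^sub>k\<close> as underlying functor, its action on morphisms, its associator and its
  unitors are \<^const>\<open>tmap\<close>, \<^const>\<open>tassoc\<close>, \<^const>\<open>tlunit\<close> and \<^const>\<open>trunit\<close>.
\<close>

subsection \<open>Interchange law, braiding and reversion\<close>

definition interchange ::
  "('k::field, 'b) bialgebra \<Rightarrow> ('k, 'b, 'x, 'r) bimodule_scheme \<Rightarrow> ('k, 'b, 'y, 's) bimodule_scheme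
    \<Rightarrow> ('k, 'b, 'z, 't) bimodule_scheme \<Rightarrow> ('k, 'b, 'w, 'q) bimodule_scheme
    \<Rightarrow> ('k, ('k, 'x, 'y) tens, ('k, 'z, 'w) tens) tens
    \<Rightarrow> ('k, ('k, 'x, 'z) tens, ('k, 'y, 'w) tens) tens" where
  "interchange B X Y Z W =
    (let T = bullet B (circ B X Z) (circ B Y W) in
     clift B (bullet B X Y) (bullet B Z W) T
       (\<lambda>t t'. tlift X Y T (\<lambda>x y. tlift Z W T
          (\<lambda>z w. tpure (circ B X Z) (circ B Y W) (cpure B X Z x z) (cpure B Y W y w)) t') t))"

definition multJ :: "('k::field, 'b) bialgebra \<Rightarrow> ('k, 'k, 'k) tens \<Rightarrow> 'k" where
  "multJ B = clift B (unitJ B) (unitJ B) (unitJ B) (\<lambda>c c'. c * c')"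

definition braiding ::
  "('k::field, 'b) bialgebra \<Rightarrow> ('k, 'b, 'b) tens
    \<Rightarrow> ('k, 'b, 'x, 'r) bimodule_scheme \<Rightarrow> ('k, 'b, 'y, 's) bimodule_scheme
    \<Rightarrow> ('k, 'x, 'y) tens \<Rightarrow> ('k, 'y, 'x) tens" where
  "braiding B S X Y =
    (\<lambda>t\<in>carr (bullet B X Y).
       ract2 B Y X (lact2 B Y X (alg_inverse (algebra2 B) S) (tflip X Y t)) S)"

text \<open>\<open>X\<^sup>-\<close> has the same underlying vector space as \<open>X\<close>; the element \<open>x\<^sup>-\<close> is \<open>x\<close> itself.\<close>

definition reversion ::
  "('k::field, 'b) bialgebra \<Rightarrow> ('k, 'b, 'x, 'r) bimodule_scheme \<Rightarrow> ('k, 'b, 'x) bimodule" where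
  "reversion B X =
    vspace.extend (vspace.truncate X) (bimodule.fields
      (\<lambda>b\<in>carr B. \<lambda>x\<in>carr X. ract X x (antipode B b))
      (\<lambda>x\<in>carr X. \<lambda>b\<in>carr B. lact X (antipode B b) x))"

definition rev_psi ::
  "('k::field, 'b) bialgebra \<Rightarrow> ('k, 'b, 'x, 'r) bimodule_scheme \<Rightarrow> ('k, 'b, 'y, 's) bimodule_scheme
    \<Rightarrow> ('k, 'x, 'y) tens \<Rightarrow> ('k, 'k, ('k, 'b, ('k, 'x, 'y) tens) tens) tens" where
  "rev_psi B X Y =
    tlift (reversion B X) Y (circ B (unitJ B) (bullet B (unitI B) (circ B X Y)))
      (\<lambda>x y. cpure B (unitJ B) (bullet B (unitI B) (circ B X Y)) 1
                (tpure (unitI B) (circ B X Y) (one B) (cpure B X Y x y)))"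

definition rev_phi ::
  "('k::field, 'b) bialgebra \<Rightarrow> ('k, 'b, 'x, 'r) bimodule_scheme \<Rightarrow> ('k, 'b, 'y, 's) bimodule_scheme
    \<Rightarrow> ('k, 'x, 'y) tens \<Rightarrow> ('k, ('k, ('k, 'x, 'y) tens, 'b) tens, 'k) tens" where
  "rev_phi B X Y =
    tlift X (reversion B Y) (circ B (bullet B (circ B X Y) (unitI B)) (unitJ B))
      (\<lambda>x y. cpure B (bullet B (circ B X Y) (unitI B)) (unitJ B)
                (tpure (circ B X Y) (unitI B) (cpure B X Y x y) (one B)) 1)"

section \<open>Bimonoids and Hopf monoids\<close>

record (overloaded) ('k::zero, 'b, 'x) bimonoid = "('k, 'b, 'x) bimodule" +
  mmult :: "('k, 'x, 'x) tens \<Rightarrow> 'x"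
  munit :: "'b \<Rightarrow> 'x"
  mcomult :: "'x \<Rightarrow> ('k, 'x, 'x) tens"
  mcounit :: "'x \<Rightarrow> 'k"

definition is_monoid :: "('k::field, 'b) bialgebra \<Rightarrow> ('k, 'b, 'x, 'r) bimonoid_scheme \<Rightarrow> bool" where
  "is_monoid B H \<longleftrightarrow>
    mmult H \<in> bimodule_maps B (circ B H H) H \<and> munit H \<in> bimodule_maps B (unitI B) H \<and>
    (\<forall>t\<in>carr (circ B (circ B H H) H).
       mmult H (cmap B (circ B H H) H H H (mmult H) (id_map H) t) =
         mmult H (cmap B H (circ B H H) H H (id_map H) (mmult H) (cassoc B H H H t))) \<and>
    (\<forall>t\<in>carr (circ B (unitI B) H).
       mmult H (cmap B (unitI B) H H H (munit H) (id_map H) t) = clunit B H t) \<and>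
    (\<forall>t\<in>carr (circ B H (unitI B)).
       mmult H (cmap B H (unitI B) H H (id_map H) (munit H) t) = crunit B H t)"

definition is_comonoid :: "('k::field, 'b) bialgebra \<Rightarrow> ('k, 'b, 'x, 'r) bimonoid_scheme \<Rightarrow> bool" where
  "is_comonoid B H \<longleftrightarrow>
    mcomult H \<in> bimodule_maps B H (bullet B H H) \<and> mcounit H \<in> bimodule_maps B H (unitJ B) \<and>
    is_coalgebra H (mcomult H) (mcounit H)"

definition is_bimonoid :: "('k::field, 'b) bialgebra \<Rightarrow> ('k, 'b, 'x, 'r) bimonoid_scheme \<Rightarrow> bool" where
  "is_bimonoid B H \<longleftrightarrow>
    is_bimodule B H \<and> is_monoid B H \<and> is_comonoid B H \<and>
    (\<forall>t\<in>carr (circ B H H).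
       mcomult H (mmult H t) =
         tmap (circ B H H) (circ B H H) H H (mmult H) (mmult H)
           (interchange B H H H H
             (cmap B H H (bullet B H H) (bullet B H H) (mcomult H) (mcomult H) t))) \<and>
    (\<forall>t\<in>carr (circ B H H).
       mcounit H (mmult H t) =
         multJ B (cmap B H H (unitJ B) (unitJ B) (mcounit H) (mcounit H) t)) \<and>
    (\<forall>b\<in>carr B.
       mcomult H (munit H b) =
         tmap (unitI B) (unitI B) H H (munit H) (munit H) (comult B b)) \<and>
    (\<forall>b\<in>carr B. mcounit H (munit H b) = counit B b)"

definition bimonoid_maps ::
  "('k::field, 'b) bialgebra \<Rightarrow> ('k, 'b, 'x, 'r) bimonoid_scheme \<Rightarrow> ('k, 'b, 'y, 's) bimonoid_scheme
    \<Rightarrow> ('x \<Rightarrow> 'y) set" where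
  "bimonoid_maps B H K = {f \<in> bimodule_maps B H K.
    (\<forall>t\<in>carr (circ B H H). f (mmult H t) = mmult K (cmap B H H K K f f t)) \<and>
    (\<forall>b\<in>carr B. f (munit H b) = munit K b) \<and>
    (\<forall>x\<in>carr H. tmap H H K K f f (mcomult H x) = mcomult K (f x)) \<and>
    (\<forall>x\<in>carr H. mcounit K (f x) = mcounit H x)}"

definition is_hopf_monoid ::
  "('k::field, 'b) bialgebra \<Rightarrow> ('k, 'b, 'x, 'r) bimonoid_scheme \<Rightarrow> bool" where
  "is_hopf_monoid B H \<longleftrightarrow>
    is_bimonoid B H \<and>
    (\<exists>\<Sigma>. \<Sigma> \<in> bimodule_maps B H (reversion B H) \<and>
      (\<forall>h\<in>carr H.
         cmap B (bullet B (circ B H H) (unitI B)) (unitJ B) (bullet B H (unitI B)) (unitJ B)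
           (tmap (circ B H H) (unitI B) H (unitI B) (mmult H) (id_map (unitI B)))
           (id_map (unitJ B))
           (rev_phi B H H (tmap H H H (reversion B H) (id_map H) \<Sigma> (mcomult H h)))
         = scal (circ B (bullet B H (unitI B)) (unitJ B)) (mcounit H h)
             (cpure B (bullet B H (unitI B)) (unitJ B)
               (tpure H (unitI B) (munit H (one B)) (one B)) 1)) \<and>
      (\<forall>h\<in>carr H.
         cmap B (unitJ B) (bullet B (unitI B) (circ B H H)) (unitJ B) (bullet B (unitI B) H)
           (id_map (unitJ B))
           (tmap (unitI B) (circ B H H) (unitI B) H (id_map (unitI B)) (mmult H))
           (rev_psi B H H (tmap H H (reversion B H) H \<Sigma> (id_map H) (mcomult H h)))
         = scal (circ B (unitJ B) (bullet B (unitI B) H)) (mcounit H h)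
             (cpure B (unitJ B) (bullet B (unitI B) H) 1
               (tpure (unitI B) H (one B) (munit H (one B))))))"

definition is_cocommutative ::
  "('k::field, 'b) bialgebra \<Rightarrow> ('k, 'b, 'b) tens \<Rightarrow> ('k, 'b, 'x, 'r) bimonoid_scheme \<Rightarrow> bool" where
  "is_cocommutative B S H \<longleftrightarrow> (\<forall>h\<in>carr H. braiding B S H H (mcomult H h) = mcomult H h)"

text \<open>The bimonoids whose carrier is a subset of the type \<open>'u\<close>.\<close>

definition bimonoids ::
  "('k::field, 'b) bialgebra \<Rightarrow> (('k, 'b, 'u) bimonoid, 'u \<Rightarrow> 'u) category" where
  "bimonoids B =
    \<lparr>obj = {H. is_bimonoid B H},
     hom = bimonoid_maps B,
     ident = id_map,
     comp = (\<lambda>H K L. compose (carr H))\<rparr>"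

definition hopf_coc ::
  "('k::field, 'b) bialgebra \<Rightarrow> ('k, 'b, 'b) tens
    \<Rightarrow> (('k, 'b, 'u) bimonoid, 'u \<Rightarrow> 'u) category" where
  "hopf_coc B S =
    full_subcategory (bimonoids B) (\<lambda>H. is_hopf_monoid B H \<and> is_cocommutative B S H)"

end

theory Submission
  imports Defs
begin

text \<open>
  A monoid for \<open>\<otimes>\<^sub>B\<close> is the same thing as an algebra \<open>A\<close> with an algebra map \<open>u : B \<rightarrow> A\<close>, and the
  comonoid and compatibility axioms turn this into a bialgebra under \<open>B\<close>. The map
  \<open>x \<mapsto> (x \<bullet> 1) \<circ> 1\<close> from \<open>A\<close> to \<open>(A \<bullet> I) \<circ> J\<close> is injective, with left inverse
  \<open>(x \<bullet> b) \<circ> c \<mapsto> c x u(S\<^sub>B b)\<close>, so the Hopf monoid axioms say exactly that \<open>\<Sigma>\<close> is an antipode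
  of \<open>A\<close>; conversely an antipode is automatically a bimodule map to the reversion, because it is
  anti-multiplicative and commutes with \<open>u\<close>. Since \<open>B \<otimes> B\<close> acts on \<open>A \<otimes> A\<close> through \<open>u \<otimes> u\<close>,
  cocommutativity says \<open>\<Delta>\<^sup>o\<^sup>p = R \<Delta> R\<^sup>-\<^sup>1\<close> for \<open>R = (u \<otimes> u)(\<S>)\<close>, and the hexagon identities for \<open>R\<close>
  are inherited from those for \<open>\<S>\<close>.
\<close>

section \<open>Vector spaces with explicit carriers\<close>

text \<open>The categories are isomorphic and not merely equivalent: the two object maps are inverse
  on the nose, the hom-sets coincide as sets of functions, and both functors leave morphisms
  untouched. This is possible because operations and maps are \<open>undefined\<close> off their
  domains, so each round trip returns the record it started from. The obstacle is that maps out of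
  tensor products are definite descriptions. Nothing can be evaluated before bilinearity, and for
  the product over B also balancedness, has been verified. Nearly every identity is therefore proved
  in the same way: both sides are shown to be linear in each tensor argument and are then compared
  on pure tensors. Balancedness of the left inverse named above is the point where S_B must reverse
  products: x u(r_1) u(S(b r_2)) = x u(r_1 S(r_2)) u(S b) = \<epsilon>(r) x u(S b). That fact, like
  the compatibility of antipodes with u, comes from the uniqueness of inverses in a convolution
  algebra.\<close>

interpretation fs: vector_space "fscale :: 'k::field \<Rightarrow> ('i \<Rightarrow>\<^sub>0 'k) \<Rightarrow> ('i \<Rightarrow>\<^sub>0 'k)"
  by (rule vector_space_fscale)

lemma
  assumes "is_vspace V"
  shows vs_add_closed [simp]: "x \<in> carr V \<Longrightarrow> y \<in> carr V \<Longrightarrow> add V x y \<in> carr V"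
    and vs_scal_closed [simp]: "x \<in> carr V \<Longrightarrow> scal V c x \<in> carr V"
    and vs_zero_closed [simp]: "zero V \<in> carr V"
    and vs_add_assoc: "x \<in> carr V \<Longrightarrow> y \<in> carr V \<Longrightarrow> z \<in> carr V \<Longrightarrow>
      add V (add V x y) z = add V x (add V y z)"
    and vs_add_commute: "x \<in> carr V \<Longrightarrow> y \<in> carr V \<Longrightarrow> add V x y = add V y x"
    and vs_zero_add [simp]: "x \<in> carr V \<Longrightarrow> add V (zero V) x = x"
    and vs_ex_neg: "x \<in> carr V \<Longrightarrow> \<exists>y\<in>carr V. add V x y = zero V"
    and vs_scal_add: "x \<in> carr V \<Longrightarrow> y \<in> carr V \<Longrightarrow>
      scal V c (add V x y) = add V (scal V c x) (scal V c y)"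
    and vs_add_scal: "x \<in> carr V \<Longrightarrow> scal V (c + d) x = add V (scal V c x) (scal V d x)"
    and vs_scal_scal: "x \<in> carr V \<Longrightarrow> scal V c (scal V d x) = scal V (c * d) x"
    and vs_scal_one [simp]: "x \<in> carr V \<Longrightarrow> scal V 1 x = x"
  using assms unfolding is_vspace_def PiE_iff Pi_iff by - ((elim conjE; (blast | metis UNIV_I))+)

lemma vs_add_zero [simp]: "is_vspace V \<Longrightarrow> x \<in> carr V \<Longrightarrow> add V x (zero V) = x"
  by (simp add: vs_add_commute[of V x])

lemma vs_add_left_commute:
  assumes "is_vspace V" "x \<in> carr V" "y \<in> carr V" "z \<in> carr V"
  shows "add V x (add V y z) = add V y (add V x z)"
  using assms by (metis vs_add_assoc vs_add_commute)

lemma vs_add_left_cancel: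
  assumes "is_vspace V" "x \<in> carr V" "y \<in> carr V" "z \<in> carr V" "add V x y = add V x z"
  shows "y = z"
proof -
  obtain w where w: "w \<in> carr V" "add V x w = zero V" using vs_ex_neg[OF assms(1,2)] by blast
  have "add V w (add V x v) = v" if "v \<in> carr V" for v
    using that w assms(1,2) by (simp flip: vs_add_assoc add: vs_add_commute[of V w x])
  then show ?thesis using assms(3-5) by metis
qed

lemma vs_scal_zero_left [simp]: "is_vspace V \<Longrightarrow> x \<in> carr V \<Longrightarrow> scal V 0 x = zero V"
  using vs_add_scal[of V x 0 0] vs_add_left_cancel[of V "scal V 0 x" "scal V 0 x" "zero V"] by simp

lemma vs_scal_zero_right [simp]: "is_vspace V \<Longrightarrow> scal V c (zero V) = zero V"
  using vs_scal_scal[of V "zero V" c 0] by simp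

text \<open>Linearity on the carrier alone, whereas \<open>linear_maps\<close> also demands
  extensionality. Lambda terms and composites that arise inside a calculation are linear in this
  sense without being restricted first; \<open>linear_maps_iff\<close> links the two
  notions.\<close>

definition lin ::
  "('k::field, 'v, 'r) vspace_scheme \<Rightarrow> ('k, 'w, 's) vspace_scheme \<Rightarrow> ('v \<Rightarrow> 'w) \<Rightarrow> bool" where
  "lin V W f \<longleftrightarrow> (\<forall>x\<in>carr V. f x \<in> carr W) \<and>
    (\<forall>x\<in>carr V. \<forall>y\<in>carr V. f (add V x y) = add W (f x) (f y)) \<and>
    (\<forall>c. \<forall>x\<in>carr V. f (scal V c x) = scal W c (f x))"

definition bilin ::
  "('k::field, 'v, 'r) vspace_scheme \<Rightarrow> ('k, 'w, 's) vspace_scheme \<Rightarrow> ('k, 'z, 't) vspace_scheme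
    \<Rightarrow> ('v \<Rightarrow> 'w \<Rightarrow> 'z) \<Rightarrow> bool" where
  "bilin V W Z \<phi> \<longleftrightarrow> (\<forall>x\<in>carr V. lin W Z (\<phi> x)) \<and> (\<forall>y\<in>carr W. lin V Z (\<lambda>x. \<phi> x y))"

lemma linear_maps_iff: "f \<in> linear_maps V W \<longleftrightarrow> lin V W f \<and> f \<in> extensional (carr V)"
  by (auto simp: linear_maps_def lin_def PiE_iff extensional_def)

lemma linear_maps_lin: "f \<in> linear_maps V W \<Longrightarrow> lin V W f"
  by (simp add: linear_maps_iff)

lemma lin_cong: "(\<And>x. x \<in> carr V \<Longrightarrow> f x = g x) \<Longrightarrow> is_vspace V \<Longrightarrow> lin V W f \<longleftrightarrow> lin V W g"
  by (auto simp: lin_def)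

lemma bilin_cong:
  assumes "\<And>x y. x \<in> carr V \<Longrightarrow> y \<in> carr W \<Longrightarrow> \<beta> x y = \<gamma> x y" "is_vspace V" "is_vspace W"
  shows "bilin V W Z \<beta> \<longleftrightarrow> bilin V W Z \<gamma>"
  using assms by (simp add: bilin_def lin_def)

lemma bilinear_maps_iff:
  assumes "is_vspace V"
  shows "\<beta> \<in> bilinear_maps V W Z \<longleftrightarrow> bilin V W Z \<beta> \<and> \<beta> \<in> extensional (carr V) \<and>
    (\<forall>x\<in>carr V. \<beta> x \<in> extensional (carr W))"
proof -
  have "lin V Z (\<lambda>x\<in>carr V. \<beta> x y) \<longleftrightarrow> lin V Z (\<lambda>x. \<beta> x y)" for y
    by (rule lin_cong) (use assms in auto)
  then show ?thesis
    by (auto simp: bilinear_maps_def bilin_def linear_maps_iff PiE_iff lin_def extensional_def)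
qed

lemma
  assumes "lin V W f"
  shows lin_closed: "x \<in> carr V \<Longrightarrow> f x \<in> carr W"
    and lin_add: "x \<in> carr V \<Longrightarrow> y \<in> carr V \<Longrightarrow> f (add V x y) = add W (f x) (f y)"
    and lin_scal: "x \<in> carr V \<Longrightarrow> f (scal V c x) = scal W c (f x)"
  using assms by (auto simp: lin_def)

lemma lin_zero: "lin V W f \<Longrightarrow> is_vspace V \<Longrightarrow> is_vspace W \<Longrightarrow> f (zero V) = zero W"
  using lin_scal[of V W f "zero V" 0] by (simp add: lin_closed)

lemma linI:
  assumes "\<And>x. x \<in> carr V \<Longrightarrow> f x \<in> carr W"
    and "\<And>x y. x \<in> carr V \<Longrightarrow> y \<in> carr V \<Longrightarrow> f (add V x y) = add W (f x) (f y)"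
    and "\<And>c x. x \<in> carr V \<Longrightarrow> f (scal V c x) = scal W c (f x)"
  shows "lin V W f"
  using assms by (simp add: lin_def)

lemma bilinI:
  assumes "\<And>x. x \<in> carr V \<Longrightarrow> lin W Z (\<lambda>y. \<phi> x y)" and "\<And>y. y \<in> carr W \<Longrightarrow> lin V Z (\<lambda>x. \<phi> x y)"
  shows "bilin V W Z \<phi>"
  using assms by (simp add: bilin_def)

lemma lin_ident: "lin V V (\<lambda>x. x)"
  by (simp add: lin_def)

lemma lin_id_map: "is_vspace V \<Longrightarrow> lin V V (id_map V)"
  by (simp add: lin_def id_map_def)

lemma id_map_apply [simp]: "x \<in> carr V \<Longrightarrow> id_map V x = x"
  by (simp add: id_map_def)

lemma lin_comp: "lin V W f \<Longrightarrow> lin U V g \<Longrightarrow> lin U W (\<lambda>x. f (g x))"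
  by (simp add: lin_def)

lemma bilin_left: "bilin V W Z \<beta> \<Longrightarrow> lin U V f \<Longrightarrow> y \<in> carr W \<Longrightarrow> lin U Z (\<lambda>x. \<beta> (f x) y)"
  by (simp add: bilin_def lin_def)

lemma bilin_right: "bilin V W Z \<beta> \<Longrightarrow> lin U W f \<Longrightarrow> x \<in> carr V \<Longrightarrow> lin U Z (\<lambda>y. \<beta> x (f y))"
  by (simp add: bilin_def lin_def)

lemma bilin_closed: "bilin V W Z \<beta> \<Longrightarrow> x \<in> carr V \<Longrightarrow> y \<in> carr W \<Longrightarrow> \<beta> x y \<in> carr Z"
  by (auto simp: bilin_def lin_def)

lemma lin_plus:
  assumes "is_vspace W" "lin V W f" "lin V W g"
  shows "lin V W (\<lambda>x. add W (f x) (g x))"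
  using assms by (intro linI)
    (simp_all add: lin_closed[OF assms(2)] lin_closed[OF assms(3)] lin_add[OF assms(2)]
      lin_add[OF assms(3)] lin_scal[OF assms(2)] lin_scal[OF assms(3)] vs_add_assoc
      vs_add_left_commute vs_scal_add)

lemma lin_scalar: "is_vspace W \<Longrightarrow> lin V W f \<Longrightarrow> lin V W (\<lambda>x. scal W c (f x))"
  by (rule linI) (simp_all add: lin_def vs_scal_add vs_scal_scal mult.commute)

lemma vspace_ground [simp]: "is_vspace ground"
proof -
  have "\<exists>y. x + y = 0" for x :: 'a by (rule exI[of _ "- x"]) simp
  then show ?thesis by (auto simp: is_vspace_def ground_def algebra_simps)
qed

lemma ground_simps [simp]:
  "carr ground = UNIV" "add ground = (+)" "zero ground = 0" "scal ground = (*)"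
  by (simp_all add: ground_def)

subsection \<open>Linear extension from a free vector space\<close>

text \<open>A finite sum in the carrier. Addition commutes only there, so the guard makes the folded
  function left-commutative on the whole type, as \<open>Finite_Set.fold\<close> requires.\<close>

definition vsum :: "('k::field, 'z, 't) vspace_scheme \<Rightarrow> ('i \<Rightarrow> 'z) \<Rightarrow> 'i set \<Rightarrow> 'z" where
  "vsum Z f I =
    Finite_Set.fold (\<lambda>i z. if f i \<in> carr Z \<and> z \<in> carr Z then add Z (f i) z else z) (zero Z) I"

lemma vsum_empty [simp]: "vsum Z f {} = zero Z"
  by (simp add: vsum_def)

lemma vsum_insert_closed:
  assumes "is_vspace Z" "finite I" "f ` I \<subseteq> carr Z"
  shows "vsum Z f I \<in> carr Z \<and>
    (\<forall>i. i \<notin> I \<longrightarrow> f i \<in> carr Z \<longrightarrow> vsum Z f (insert i I) = add Z (f i) (vsum Z f I))"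
proof -
  interpret comp_fun_commute "\<lambda>i z. if f i \<in> carr Z \<and> z \<in> carr Z then add Z (f i) z else z"
    by unfold_locales (use assms(1) in \<open>auto simp: fun_eq_iff vs_add_left_commute\<close>)
  have "vsum Z f I \<in> carr Z"
    using assms(2,3) by (induction I) (use assms(1) in \<open>auto simp: vsum_def\<close>)
  then show ?thesis
    using assms(2) by (auto simp: vsum_def)
qed

lemmas vsum_closed [simp] = vsum_insert_closed[THEN conjunct1]

lemma vsum_insert [simp]:
  "is_vspace Z \<Longrightarrow> finite I \<Longrightarrow> f ` I \<subseteq> carr Z \<Longrightarrow> i \<notin> I \<Longrightarrow> f i \<in> carr Z \<Longrightarrow>
    vsum Z f (insert i I) = add Z (f i) (vsum Z f I)"
  using vsum_insert_closed by blast

lemma vsum_mono_neutral: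
  assumes "is_vspace Z" "finite J" "I \<subseteq> J" "f ` I \<subseteq> carr Z" "\<And>i. i \<in> J - I \<Longrightarrow> f i = zero Z"
  shows "vsum Z f J = vsum Z f I"
proof -
  have "vsum Z f (I \<union> K) = vsum Z f I" if "finite K" "K \<subseteq> J - I" for K
    using that
  proof (induction K)
    case (insert k K)
    have "f ` (I \<union> K) \<subseteq> carr Z" using insert.prems assms by auto
    moreover have "finite (I \<union> K)" using insert finite_subset[OF assms(3,2)] by blast
    ultimately show ?case using insert assms by simp
  qed simp
  from this[of "J - I"] assms(2,3) show ?thesis by (simp add: Un_absorb1)
qed

lemma vsum_add:
  assumes "is_vspace Z" "finite I" "f ` I \<subseteq> carr Z" "g ` I \<subseteq> carr Z"
  shows "vsum Z (\<lambda>i. add Z (f i) (g i)) I = add Z (vsum Z f I) (vsum Z g I)"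
  using assms(2-4)
proof (induction I)
  case (insert i I)
  then have "(\<lambda>i. add Z (f i) (g i)) ` I \<subseteq> carr Z" using assms(1) by (simp add: image_subset_iff)
  with insert assms(1) show ?case
    by (simp add: vs_add_assoc vs_add_left_commute)
qed (simp add: assms(1))

lemma vsum_scal:
  assumes "is_vspace Z" "finite I" "f ` I \<subseteq> carr Z"
  shows "vsum Z (\<lambda>i. scal Z c (f i)) I = scal Z c (vsum Z f I)"
  using assms(2,3)
proof (induction I)
  case (insert i I)
  then have "(\<lambda>i. scal Z c (f i)) ` I \<subseteq> carr Z" using assms(1) by (simp add: image_subset_iff)
  with insert assms(1) show ?case
    by (simp add: vs_scal_add)
qed (simp add: assms(1))

text \<open>Linear extension of \<phi> from the basis to the free vector space; the sum runs over
  the support of p.\<close>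

definition lext ::
  "('k::field, 'z, 't) vspace_scheme \<Rightarrow> ('i \<Rightarrow> 'z) \<Rightarrow> ('i \<Rightarrow>\<^sub>0 'k) \<Rightarrow> 'z" where
  "lext Z \<phi> p = vsum Z (\<lambda>i. scal Z (Poly_Mapping.lookup p i) (\<phi> i)) (Poly_Mapping.keys p)"

lemma lext_superset:
  assumes "is_vspace Z" "\<And>i. \<phi> i \<in> carr Z" "finite J" "Poly_Mapping.keys p \<subseteq> J"
  shows "lext Z \<phi> p = vsum Z (\<lambda>i. scal Z (Poly_Mapping.lookup p i) (\<phi> i)) J"
  unfolding lext_def using assms
  by (intro vsum_mono_neutral[symmetric]) (auto simp: in_keys_iff)

lemma lext_add:
  assumes "is_vspace Z" "\<And>i. \<phi> i \<in> carr Z"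
  shows "lext Z \<phi> (p + q) = add Z (lext Z \<phi> p) (lext Z \<phi> q)"
proof -
  \<comment> \<open>The supports of p, q and p + q may differ, so all three sums are taken over the
    union of the first two; the extra terms have coefficient 0.\<close>
  let ?J = "Poly_Mapping.keys p \<union> Poly_Mapping.keys q"
  have "lext Z \<phi> r = vsum Z (\<lambda>i. scal Z (Poly_Mapping.lookup r i) (\<phi> i)) ?J"
    if "Poly_Mapping.keys r \<subseteq> ?J" for r
    using that assms by (intro lext_superset) auto
  moreover have "Poly_Mapping.keys (p + q) \<subseteq> ?J" by (rule keys_add)
  ultimately show ?thesis
    using assms by (simp add: lookup_add vs_add_scal vsum_add image_subset_iff)
qed

lemma lext_scal:
  assumes "is_vspace Z" "\<And>i. \<phi> i \<in> carr Z"
  shows "lext Z \<phi> (fscale c p) = scal Z c (lext Z \<phi> p)"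
proof -
  have "Poly_Mapping.keys (fscale c p) \<subseteq> Poly_Mapping.keys p"
    by (auto simp: in_keys_iff lookup_fscale)
  then have "lext Z \<phi> (fscale c p) = vsum Z (\<lambda>i. scal Z (Poly_Mapping.lookup (fscale c p) i) (\<phi> i))
      (Poly_Mapping.keys p)"
    using assms by (intro lext_superset) auto
  also have "\<dots> = scal Z c (lext Z \<phi> p)"
    using assms by (simp add: lookup_fscale lext_def image_subset_iff flip: vsum_scal vs_scal_scal)
  finally show ?thesis .
qed

lemma lext_single [simp]:
  "is_vspace Z \<Longrightarrow> \<phi> i \<in> carr Z \<Longrightarrow> lext Z \<phi> (Poly_Mapping.single i 1) = \<phi> i"
  by (simp add: lext_def)

lemma lext_closed [simp]: "is_vspace Z \<Longrightarrow> (\<And>i. \<phi> i \<in> carr Z) \<Longrightarrow> lext Z \<phi> p \<in> carr Z"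
  by (simp add: lext_def image_subset_iff)

text \<open>Every generator of the null subspaces is a difference, so a linear extension kills it as
  soon as it takes equal values on the two terms.\<close>

lemma lext_diff:
  assumes "is_vspace Z" "\<And>i. \<phi> i \<in> carr Z" "lext Z \<phi> p = lext Z \<phi> q"
  shows "lext Z \<phi> (p - q) = zero Z"
proof (rule vs_add_left_cancel[OF assms(1)])
  show "add Z (lext Z \<phi> q) (lext Z \<phi> (p - q)) = add Z (lext Z \<phi> q) (zero Z)"
    using assms by (simp flip: lext_add)
qed (use assms in auto)

section \<open>Quotients of free vector spaces\<close>

text \<open>The type of N allows elements supported on arbitrary pairs; the support condition places
  N inside the free vector space on A \<times> C, so that the quotient is one of that space.\<close>

definition supported_subspace :: "'v set \<Rightarrow> 'w set \<Rightarrow> ('k::field, 'v, 'w) tens \<Rightarrow> bool" where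
  "supported_subspace A C N \<longleftrightarrow> fs.subspace N \<and> (\<forall>n\<in>N. Poly_Mapping.keys n \<subseteq> A \<times> C)"

lemma keys_fscale: "Poly_Mapping.keys (fscale c p) \<subseteq> Poly_Mapping.keys p"
  by (auto simp: in_keys_iff lookup_fscale)

lemma supported_subspace_span:
  assumes "\<And>r. r \<in> R \<Longrightarrow> Poly_Mapping.keys r \<subseteq> A \<times> C"
  shows "supported_subspace A C (fs.span R)"
proof -
  have "fs.span R \<subseteq> {p. Poly_Mapping.keys p \<subseteq> A \<times> C}"
  proof (rule fs.span_minimal)
    show "fs.subspace {p. Poly_Mapping.keys p \<subseteq> A \<times> C}"
      using keys_fscale keys_add by (fastforce simp: fs.subspace_def)
  qed (use assms in blast)
  then show ?thesis by (auto simp: supported_subspace_def)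
qed

lemma coset_eq_iff:
  assumes "fs.subspace N"
  shows "coset N p = coset N q \<longleftrightarrow> p - q \<in> N"
proof
  assume "coset N p = coset N q"
  moreover have "p \<in> coset N p" using fs.subspace_0[OF assms] by (auto simp: coset_def)
  ultimately show "p - q \<in> N" by (auto simp: coset_def)
next
  assume pq: "p - q \<in> N"
  have "coset N a \<subseteq> coset N b" if "a - b \<in> N" for a b
  proof
    fix x assume "x \<in> coset N a"
    then obtain n where n: "n \<in> N" "x = a + n" by (auto simp: coset_def)
    then have "x = b + ((a - b) + n)" by simp
    then show "x \<in> coset N b" using fs.subspace_add[OF assms that n(1)] unfolding coset_def by blast
  qed
  moreover have "q - p \<in> N" using fs.subspace_neg[OF assms pq] by simp
  ultimately show "coset N p = coset N q" using pq by blast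
qed

lemma coset_zero: "coset N 0 = N"
  by (simp add: coset_def)

lemma carr_quotient:
  "carr (quotient_space A C N) = {coset N p | p. Poly_Mapping.keys p \<subseteq> A \<times> C}"
  by (simp add: quotient_space_def Let_def)

lemma carr_quotientE:
  assumes "P \<in> carr (quotient_space A C N)"
  obtains p where "P = coset N p" "Poly_Mapping.keys p \<subseteq> A \<times> C"
  using assms by (auto simp: carr_quotient)

lemma coset_closed: "Poly_Mapping.keys p \<subseteq> A \<times> C \<Longrightarrow> coset N p \<in> carr (quotient_space A C N)"
  by (auto simp: carr_quotient)

lemma quotient_zero: "zero (quotient_space A C N) = coset N 0"
  by (simp add: quotient_space_def coset_zero Let_def)

text \<open>Changing the representatives changes their sum by an element of N. The union in the
  definition of the sum thus ranges over copies of a single coset.\<close>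

lemma quotient_add:
  assumes "fs.subspace N" "Poly_Mapping.keys p \<subseteq> A \<times> C" "Poly_Mapping.keys q \<subseteq> A \<times> C"
  shows "add (quotient_space A C N) (coset N p) (coset N q) = coset N (p + q)"
proof -
  have "coset N (p' + q') = coset N (p + q)" if "p' \<in> coset N p" "q' \<in> coset N q" for p' q'
    using that fs.subspace_add[OF assms(1)]
    by (subst coset_eq_iff[OF assms(1)]) (auto simp: coset_def)
  moreover have "p \<in> coset N p" "q \<in> coset N q"
    using fs.subspace_0[OF assms(1)] by (auto simp: coset_def)
  ultimately have "(\<Union>p'\<in>coset N p. \<Union>q'\<in>coset N q. coset N (p' + q')) = coset N (p + q)"
    by blast
  then show ?thesis
    using assms(2,3) by (auto simp: quotient_space_def Let_def)
qed

lemma quotient_scal: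
  assumes "fs.subspace N" "Poly_Mapping.keys p \<subseteq> A \<times> C"
  shows "scal (quotient_space A C N) c (coset N p) = coset N (fscale c p)"
proof -
  have "coset N (fscale c p') = coset N (fscale c p)" if "p' \<in> coset N p" for p'
    using that fs.subspace_scale[OF assms(1)]
    by (subst coset_eq_iff[OF assms(1)]) (auto simp: coset_def fs.scale_right_distrib)
  moreover have "p \<in> coset N p"
    using fs.subspace_0[OF assms(1)] by (auto simp: coset_def)
  ultimately have "(\<Union>p'\<in>coset N p. coset N (fscale c p')) = coset N (fscale c p)"
    by blast
  then show ?thesis
    using assms(2) by (auto simp: quotient_space_def Let_def)
qed

lemma vspace_quotient:
  fixes N :: "('k::field, 'v, 'w) tens"
  assumes N: "supported_subspace A C N"
  shows "is_vspace (quotient_space A C N)"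
proof -
  let ?Q = "quotient_space A C N"
  have sub: "fs.subspace N" using N by (simp add: supported_subspace_def)
  have keys: "Poly_Mapping.keys (p + q) \<subseteq> A \<times> C"
    if "Poly_Mapping.keys p \<subseteq> A \<times> C" "Poly_Mapping.keys q \<subseteq> A \<times> C" for p q :: "_ \<Rightarrow>\<^sub>0 'k"
    using that keys_add[of p q] by blast
  have keyss: "Poly_Mapping.keys (fscale c p) \<subseteq> A \<times> C"
    if "Poly_Mapping.keys p \<subseteq> A \<times> C" for c and p :: "_ \<Rightarrow>\<^sub>0 'k"
    using that keys_fscale[of c p] by blast
  note simps = quotient_add[OF sub] quotient_scal[OF sub] quotient_zero coset_closed keys keyss
  have ext: "add ?Q \<in> extensional (carr ?Q)" "\<And>P. P \<in> carr ?Q \<Longrightarrow> add ?Q P \<in> extensional (carr ?Q)"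
    "\<And>c. scal ?Q c \<in> extensional (carr ?Q)"
    by (auto simp: quotient_space_def Let_def)
  have "add ?Q \<in> carr ?Q \<rightarrow>\<^sub>E carr ?Q \<rightarrow>\<^sub>E carr ?Q"
    using ext(1,2) by (auto simp: PiE_iff elim!: carr_quotientE) (simp add: simps)
  moreover have "scal ?Q \<in> UNIV \<rightarrow> carr ?Q \<rightarrow>\<^sub>E carr ?Q"
    by (intro Pi_I PiE_I)
      (elim carr_quotientE, simp add: simps, rule extensional_arb[OF ext(3)], assumption)
  moreover have "\<exists>y\<in>carr ?Q. add ?Q x y = zero ?Q" if "x \<in> carr ?Q" for x
    using that
  proof (rule carr_quotientE)
    fix p assume p: "x = coset N p" "Poly_Mapping.keys p \<subseteq> A \<times> C"
    then show ?thesis by (intro bexI[of _ "coset N (- p)"]) (simp_all add: simps)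
  qed
  ultimately show ?thesis
    unfolding is_vspace_def
    by (auto elim!: carr_quotientE simp: simps algebra_simps fs.scale_right_distrib
      fs.scale_left_distrib)
qed

text \<open>A representative is assembled from one basis element at a time. This is what makes
  agreement on pure tensors sufficient for linear maps.\<close>

lemma quotient_induct [consumes 2, case_names zero step]:
  assumes N: "supported_subspace A C N" and P: "P \<in> carr (quotient_space A C N)"
    and zero: "Pr (zero (quotient_space A C N))"
    and step: "\<And>c x y t. x \<in> A \<Longrightarrow> y \<in> C \<Longrightarrow> t \<in> carr (quotient_space A C N) \<Longrightarrow> Pr t \<Longrightarrow>
      Pr (add (quotient_space A C N) (scal (quotient_space A C N) c (coset N (gen x y))) t)"
  shows "Pr P"
proof -
  have sub: "fs.subspace N" using N by (simp add: supported_subspace_def)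
  have "Poly_Mapping.keys p \<subseteq> A \<times> C \<Longrightarrow> Pr (coset N p)" for p
  proof (induction p rule: update_induct)
    case const
    then show ?case using zero by (simp add: quotient_zero)
  next
    case (update p i c)
    \<comment> \<open>The induction only inserts keys outside the support of p, so updating at i is
      the same as adding a multiple of the basis element at i.\<close>
    have "Poly_Mapping.update i c p = fscale c (Poly_Mapping.single i 1) + p"
      using update.hyps
      by (intro poly_mapping_eqI)
        (auto simp: lookup_update lookup_add lookup_fscale lookup_single in_keys_iff)
    moreover have k: "Poly_Mapping.keys (Poly_Mapping.update i c p) =
        insert i (Poly_Mapping.keys p)"
      using update.hyps by (auto simp: keys_update)
    moreover obtain x y where i: "i = (x, y)" by (cases i)
    moreover have "x \<in> A" "y \<in> C" using update.prems i unfolding k by auto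
    moreover from this have "Poly_Mapping.keys (fscale c (gen x y)) \<subseteq> A \<times> C"
      using keys_fscale[of c "gen x y"] by fastforce
    ultimately show ?case
      using update step[of x y "coset N p" c]
      by (simp add: quotient_add[OF sub] quotient_scal[OF sub] coset_closed)
  qed
  then show ?thesis using P by (auto elim: carr_quotientE)
qed

lemma quotient_lin_eqI:
  assumes "supported_subspace A C N" "t \<in> carr (quotient_space A C N)" "is_vspace Z"
    and f: "lin (quotient_space A C N) Z f" and g: "lin (quotient_space A C N) Z g"
    and "\<And>x y. x \<in> A \<Longrightarrow> y \<in> C \<Longrightarrow> f (coset N (gen x y)) = g (coset N (gen x y))"
  shows "f t = g t"
  using assms(1,2)
proof (induction t rule: quotient_induct)
  case zero
  then show ?case using assms by (simp add: lin_zero vspace_quotient)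
next
  case (step c x y t)
  have "coset N (gen x y) \<in> carr (quotient_space A C N)"
    using step by (auto intro: coset_closed)
  then show ?case
    using step assms by (simp add: lin_add[OF f] lin_add[OF g] lin_scal[OF f] lin_scal[OF g]
      vspace_quotient)
qed

text \<open>The universal property shared by both tensor products. Linear extension needs a function
  that is total with values in Z, while \<phi> is controlled on A \<times> C only; the condition on
  R is therefore required of every \<psi> that agrees with \<phi> there.\<close>

lemma induced_universal:
  fixes \<phi> :: "'v \<Rightarrow> 'w \<Rightarrow> 'z" and R :: "('k::field, 'v, 'w) tens"
  assumes N: "supported_subspace A C (fs.span R)" and Z: "is_vspace Z"
    and \<phi>: "\<And>x y. x \<in> A \<Longrightarrow> y \<in> C \<Longrightarrow> \<phi> x y \<in> carr Z"
    and R: "\<And>\<psi>. (\<And>i. \<psi> i \<in> carr Z) \<Longrightarrow> (\<And>x y. x \<in> A \<Longrightarrow> y \<in> C \<Longrightarrow> \<psi> (x, y) = \<phi> x y) \<Longrightarrow>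
      \<forall>r\<in>R. lext Z \<psi> r = zero Z"
  shows "induced A C (fs.span R) Z \<phi> \<in> linear_maps (quotient_space A C (fs.span R)) Z \<and>
    (\<forall>x\<in>A. \<forall>y\<in>C. induced A C (fs.span R) Z \<phi> (coset (fs.span R) (gen x y)) = \<phi> x y)"
proof -
  let ?N = "fs.span R"
  let ?Q = "quotient_space A C ?N"
  have sub: "fs.subspace ?N" by simp
  \<comment> \<open>The default \<open>zero Z\<close> keeps all values inside the carrier of
    Z.\<close>
  define \<psi> where "\<psi> i = (if i \<in> A \<times> C then \<phi> (fst i) (snd i) else zero Z)" for i
  have \<psi>: "\<psi> i \<in> carr Z" for i using \<phi> Z by (auto simp: \<psi>_def)
  have \<psi>': "\<psi> (x, y) = \<phi> x y" if "x \<in> A" "y \<in> C" for x y using that by (simp add: \<psi>_def)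
  have "?N \<subseteq> {p. lext Z \<psi> p = zero Z}"
  proof (rule fs.span_minimal)
    show "R \<subseteq> {p. lext Z \<psi> p = zero Z}" using R[OF \<psi> \<psi>'] by blast
    show "fs.subspace {p. lext Z \<psi> p = zero Z}"
      using Z \<psi> by (auto simp: fs.subspace_def lext_add lext_scal) (simp add: lext_def)
  qed
  then have null: "lext Z \<psi> n = zero Z" if "n \<in> ?N" for n using that by blast
  have eq: "lext Z \<psi> p = lext Z \<psi> q" if "coset ?N p = coset ?N q" for p q
    using lext_add[OF Z \<psi>, where p = q and q = "p - q"] null[of "p - q"] that
    by (simp add: coset_eq_iff[OF sub] Z \<psi>)
  \<comment> \<open>Each coset is evaluated at an arbitrary representative; \<open>eq\<close> shows
    that the value does not depend on the choice.\<close>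
  define f where "f = (\<lambda>P\<in>carr ?Q. lext Z \<psi> (SOME p. P = coset ?N p))"
  have fc: "f (coset ?N p) = lext Z \<psi> p" if "Poly_Mapping.keys p \<subseteq> A \<times> C" for p
  proof -
    have "coset ?N p = coset ?N (SOME q. coset ?N p = coset ?N q)" by (rule someI) simp
    then show ?thesis using that by (auto simp: f_def coset_closed intro: eq[symmetric])
  qed
  have keys: "Poly_Mapping.keys (p + q) \<subseteq> A \<times> C" "Poly_Mapping.keys (fscale c p) \<subseteq> A \<times> C"
    if "Poly_Mapping.keys p \<subseteq> A \<times> C" "Poly_Mapping.keys q \<subseteq> A \<times> C" for c and p q :: "_ \<Rightarrow>\<^sub>0 'k"
    using that keys_add[of p q] keys_fscale[of c p] by blast+
  have lin: "lin ?Q Z f"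
    by (rule linI; elim carr_quotientE)
      (simp_all add: fc keys quotient_add[OF sub] quotient_scal[OF sub] lext_add lext_scal Z \<psi>)
  have fin: "f \<in> linear_maps ?Q Z" using lin by (simp add: linear_maps_iff f_def)
  have val: "\<forall>x\<in>A. \<forall>y\<in>C. f (coset ?N (gen x y)) = \<phi> x y"
    using Z by (simp add: fc \<psi>' \<phi>)
  \<comment> \<open>Uniqueness is what identifies the definite description \<open>induced\<close>
    with f. Linearity and the values on pure tensors settle the carrier, and extensionality settles
    the rest of the type.\<close>
  have uniq: "g = f"
    if g: "g \<in> linear_maps ?Q Z" "\<forall>x\<in>A. \<forall>y\<in>C. g (coset ?N (gen x y)) = \<phi> x y" for g
  proof (rule extensionalityI)
    show "g \<in> extensional (carr ?Q)" "f \<in> extensional (carr ?Q)"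
      using g fin by (simp_all add: linear_maps_iff)
    show "g t = f t" if "t \<in> carr ?Q" for t
      by (rule quotient_lin_eqI[OF N that Z linear_maps_lin[OF g(1)] lin]) (use g(2) val in auto)
  qed
  have "induced A C ?N Z \<phi> = f"
    unfolding induced_def by (rule the_equality) (use fin val uniq in blast)+
  then show ?thesis using fin val by simp
qed

section \<open>Tensor products\<close>

lemma keys_bilinearity_relations:
  assumes "is_vspace V" "is_vspace W" "r \<in> bilinearity_relations V W"
  shows "Poly_Mapping.keys r \<subseteq> carr V \<times> carr W"
  using assms
  by (auto simp: bilinearity_relations_def in_keys_iff lookup_minus lookup_fscale lookup_single
      when_def split: if_splits)

lemma supported_tnull:
  "is_vspace V \<Longrightarrow> is_vspace W \<Longrightarrow> supported_subspace (carr V) (carr W) (tnull V W)"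
  unfolding tnull_def by (rule supported_subspace_span) (rule keys_bilinearity_relations)

lemma lext_bilinearity_relations:
  assumes "is_vspace V" "is_vspace W" "is_vspace Z" "bilin V W Z \<phi>" "\<And>i. \<psi> i \<in> carr Z"
    and \<psi>: "\<And>x y. x \<in> carr V \<Longrightarrow> y \<in> carr W \<Longrightarrow> \<psi> (x, y) = \<phi> x y"
    and "r \<in> bilinearity_relations V W"
  shows "lext Z \<psi> r = zero Z"
proof -
  have c: "\<phi> x y \<in> carr Z" if "x \<in> carr V" "y \<in> carr W" for x y
    using that bilin_closed[OF assms(4)] by blast
  \<comment> \<open>Each relation is split as p - q with equal values of the extension. In the two
    additivity relations q is the sum of the two subtracted generators.\<close>
  have "\<exists>p q. r = p - q \<and> lext Z \<psi> p = lext Z \<psi> q"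
    using assms(7) unfolding bilinearity_relations_def
  proof (elim UnE CollectE exE conjE, goal_cases)
    case (1 x x' y)
    then show ?case using assms c
      by (intro exI[of _ "gen (add V x x') y"] exI[of _ "gen x y + gen x' y"])
        (simp add: lext_add \<psi> bilin_def lin_def)
  next
    case (2 x y y')
    then show ?case using assms c
      by (intro exI[of _ "gen x (add W y y')"] exI[of _ "gen x y + gen x y'"])
        (simp add: lext_add \<psi> bilin_def lin_def)
  next
    case (3 a x y)
    then show ?case using assms c
      by (intro exI[of _ "gen (scal V a x) y"] exI[of _ "fscale a (gen x y)"])
        (simp add: lext_scal \<psi> bilin_def lin_def)
  next
    case (4 a x y)
    then show ?case using assms c
      by (intro exI[of _ "gen x (scal W a y)"] exI[of _ "fscale a (gen x y)"])
        (simp add: lext_scal \<psi> bilin_def lin_def)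
  qed
  then show ?thesis using lext_diff[where Z = Z and \<phi> = \<psi>, OF assms(3,5)] by blast
qed

lemma vspace_tensor [simp]: "is_vspace V \<Longrightarrow> is_vspace W \<Longrightarrow> is_vspace (tensor V W)"
  unfolding tensor_def by (intro vspace_quotient supported_tnull)

lemma coset_gen_closed:
  "x \<in> A \<Longrightarrow> y \<in> C \<Longrightarrow> coset N (gen x y) \<in> carr (quotient_space A C N)"
  by (rule coset_closed) auto

lemma tpure_closed [simp]: "x \<in> carr V \<Longrightarrow> y \<in> carr W \<Longrightarrow> tpure V W x y \<in> carr (tensor V W)"
  by (simp add: tpure_def tensor_def coset_gen_closed)

text \<open>Formulated for any R above the bilinearity relations, so that it serves
  \<open>tensor\<close> and, with the balancing relations added, \<open>circ\<close>.\<close>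

lemma bilin_coset_gen:
  assumes V: "is_vspace V" and W: "is_vspace W" and R: "bilinearity_relations V W \<subseteq> R"
  shows "bilin V W (quotient_space (carr V) (carr W) (fs.span R)) (\<lambda>x y. coset (fs.span R) (gen x
      y))"
proof -
  let ?N = "fs.span R"
  have sub: "fs.subspace ?N" by simp
  have N: "r \<in> ?N" if "r \<in> bilinearity_relations V W" for r
    using that R by (auto intro: fs.span_base)
  have k: "Poly_Mapping.keys (gen x y) \<subseteq> carr V \<times> carr W" if "x \<in> carr V" "y \<in> carr W" for x y
    using that by simp
  have eqI: "coset ?N p = coset ?N q" if "p - q \<in> bilinearity_relations V W" for p q
    using that N by (simp add: coset_eq_iff)
  have "coset ?N (gen (add V x x') y) = coset ?N (gen x y + gen x' y)"
    if "x \<in> carr V" "x' \<in> carr V" "y \<in> carr W" for x x' y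
    by (rule eqI) (use that in \<open>unfold bilinearity_relations_def diff_diff_add[symmetric], blast\<close>)
  moreover have "coset ?N (gen x (add W y y')) = coset ?N (gen x y + gen x y')"
    if "x \<in> carr V" "y \<in> carr W" "y' \<in> carr W" for x y y'
    by (rule eqI) (use that in \<open>unfold bilinearity_relations_def diff_diff_add[symmetric], blast\<close>)
  moreover have "coset ?N (gen (scal V c x) y) = coset ?N (fscale c (gen x y))"
    if "x \<in> carr V" "y \<in> carr W" for c x y
    by (rule eqI) (use that in \<open>unfold bilinearity_relations_def, blast\<close>)
  moreover have "coset ?N (gen x (scal W c y)) = coset ?N (fscale c (gen x y))"
    if "x \<in> carr V" "y \<in> carr W" for c x y
    by (rule eqI) (use that in \<open>unfold bilinearity_relations_def, blast\<close>)
  ultimately show ?thesis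
    unfolding bilin_def lin_def
    by (simp add: coset_gen_closed quotient_add[OF sub k k] quotient_scal[OF sub k])
qed

lemma bilin_tpure: "is_vspace V \<Longrightarrow> is_vspace W \<Longrightarrow> bilin V W (tensor V W) (tpure V W)"
  unfolding tensor_def tpure_def tnull_def by (intro bilin_coset_gen order_refl)

lemma
  assumes "is_vspace V" "is_vspace W" "is_vspace Z" "bilin V W Z \<phi>"
  shows tlift_linear_maps: "tlift V W Z \<phi> \<in> linear_maps (tensor V W) Z"
    and tlift_tpure [simp]: "x \<in> carr V \<Longrightarrow> y \<in> carr W \<Longrightarrow> tlift V W Z \<phi> (tpure V W x y) = \<phi> x y"
proof -
  have "tlift V W Z \<phi> \<in> linear_maps (tensor V W) Z \<and>
      (\<forall>x\<in>carr V. \<forall>y\<in>carr W. tlift V W Z \<phi> (tpure V W x y) = \<phi> x y)"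
    unfolding tlift_def tensor_def tpure_def tnull_def
    by (rule induced_universal)
      (use assms supported_tnull[of V W] in \<open>auto simp: tnull_def bilin_closed
        intro: lext_bilinearity_relations\<close>)
  then show "tlift V W Z \<phi> \<in> linear_maps (tensor V W) Z"
    "x \<in> carr V \<Longrightarrow> y \<in> carr W \<Longrightarrow> tlift V W Z \<phi> (tpure V W x y) = \<phi> x y"
    by blast+
qed

lemma lin_tlift:
  "is_vspace V \<Longrightarrow> is_vspace W \<Longrightarrow> is_vspace Z \<Longrightarrow> bilin V W Z \<phi> \<Longrightarrow> lin (tensor V W) Z (tlift V W Z \<phi>)"
  by (intro linear_maps_lin tlift_linear_maps)

lemma tensor_eqI:
  assumes "is_vspace V" "is_vspace W" "is_vspace Z" "lin (tensor V W) Z f" "lin (tensor V W) Z g"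
    and "\<And>x y. x \<in> carr V \<Longrightarrow> y \<in> carr W \<Longrightarrow> f (tpure V W x y) = g (tpure V W x y)"
    and "t \<in> carr (tensor V W)"
  shows "f t = g t"
  using quotient_lin_eqI[OF supported_tnull[OF assms(1,2)] _ assms(3), of t f g] assms(4-)
  by (simp add: tensor_def tpure_def)

text \<open>For fixed parameters the two sides of additivity, and of homogeneity, are themselves
  linear in the tensor t, so they can be compared on generators. The comparison principle enters as
  the hypothesis \<open>eqI\<close>, which lets one proof cover both tensor products.\<close>

lemma lin_parameter:
  assumes U: "is_vspace U" and Z: "is_vspace Z"
    and eqI: "\<And>f g. lin T Z f \<Longrightarrow> lin T Z g \<Longrightarrow>
      (\<And>x y. x \<in> A \<Longrightarrow> y \<in> C \<Longrightarrow> f (p x y) = g (p x y)) \<Longrightarrow> f t = g t"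
    and L: "\<And>u. u \<in> carr U \<Longrightarrow> lin T Z (L u)" and t: "t \<in> carr T"
    and \<phi>: "\<And>x y. x \<in> A \<Longrightarrow> y \<in> C \<Longrightarrow> lin U Z (\<lambda>u. L u (p x y))"
  shows "lin U Z (\<lambda>u. L u t)"
proof (rule linI)
  show "L u t \<in> carr Z" if "u \<in> carr U" for u using lin_closed[OF L[OF that] t] .
  show "L (add U u v) t = add Z (L u t) (L v t)" if "u \<in> carr U" "v \<in> carr U" for u v
    by (rule eqI[of "L (add U u v)" "\<lambda>t. add Z (L u t) (L v t)"])
      (use that U Z L lin_plus[OF Z L L] lin_add[OF \<phi>] in simp_all)
  show "L (scal U c u) t = scal Z c (L u t)" if "u \<in> carr U" for c u
    by (rule eqI[of "L (scal U c u)" "\<lambda>t. scal Z c (L u t)"])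
      (use that U Z L lin_scalar[OF Z L] lin_scal[OF \<phi>] in simp_all)
qed

lemma lin_tlift_parameter:
  assumes "is_vspace U" "is_vspace V" "is_vspace W" "is_vspace Z"
    and "\<And>u. u \<in> carr U \<Longrightarrow> bilin V W Z (\<lambda>x y. \<phi> u x y)"
    and "\<And>x y. x \<in> carr V \<Longrightarrow> y \<in> carr W \<Longrightarrow> lin U Z (\<lambda>u. \<phi> u x y)"
    and "t \<in> carr (tensor V W)"
  shows "lin U Z (\<lambda>u. tlift V W Z (\<lambda>x y. \<phi> u x y) t)"
proof (rule lin_parameter[where T = "tensor V W" and A = "carr V" and C = "carr W"
  and p = "tpure V W"])
  show "lin U Z (\<lambda>u. tlift V W Z (\<lambda>x y. \<phi> u x y) (tpure V W x y))"
    if "x \<in> carr V" "y \<in> carr W" for x y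
    using assms that by (subst lin_cong[where g = "\<lambda>u. \<phi> u x y"]) auto
qed (use assms in \<open>auto intro: tensor_eqI lin_tlift\<close>)

lemma bilin_lin2: "bilin V' W' Z \<beta> \<Longrightarrow> lin V V' f \<Longrightarrow> lin W W' g \<Longrightarrow> bilin V W Z (\<lambda>x y. \<beta> (f x) (g y))"
  by (simp add: bilin_def lin_def)

lemma lin_tpure_left:
  "is_vspace V \<Longrightarrow> is_vspace W \<Longrightarrow> lin U V f \<Longrightarrow> y \<in> carr W \<Longrightarrow> lin U (tensor V W) (\<lambda>x. tpure V W (f x) y)"
  by (intro bilin_left[OF bilin_tpure])

lemma lin_tpure_right:
  "is_vspace V \<Longrightarrow> is_vspace W \<Longrightarrow> lin U W f \<Longrightarrow> y \<in> carr V \<Longrightarrow> lin U (tensor V W) (\<lambda>x. tpure V W y (f x))"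
  by (intro bilin_right[OF bilin_tpure])

lemma lin_tlift_comp:
  "is_vspace V \<Longrightarrow> is_vspace W \<Longrightarrow> is_vspace Z \<Longrightarrow> bilin V W Z (\<lambda>x y. \<phi> x y) \<Longrightarrow> lin U (tensor V W) f \<Longrightarrow>
    lin U Z (\<lambda>u. tlift V W Z (\<lambda>x y. \<phi> x y) (f u))"
  by (rule lin_comp[OF lin_tlift])

text \<open>The rules are in composed form: the argument of the outermost operation is again a
  function of the variable. Linearity of a lambda term then follows by recursion on its
  structure.\<close>

lemmas lin_intros = lin_ident lin_tpure_left lin_tpure_right lin_tlift_comp bilinI

lemma lin_tlift_eq:
  assumes "is_vspace V" "is_vspace W" "is_vspace Z" "is_vspace Z'" "bilin V W Z \<phi>" "lin Z Z' g"
    and "t \<in> carr (tensor V W)"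
  shows "g (tlift V W Z \<phi> t) = tlift V W Z' (\<lambda>x y. g (\<phi> x y)) t"
proof (rule tensor_eqI[OF assms(1,2,4) _ _ _ assms(7)])
  have b: "bilin V W Z' (\<lambda>x y. g (\<phi> x y))" using assms(5,6) by (simp add: bilin_def lin_def)
  show "lin (tensor V W) Z' (tlift V W Z' (\<lambda>x y. g (\<phi> x y)))" using assms b by (simp add: lin_tlift)
  show "lin (tensor V W) Z' (\<lambda>t. g (tlift V W Z \<phi> t))"
    using assms by (intro lin_comp[OF assms(6)] lin_tlift)
  show "g (tlift V W Z \<phi> (tpure V W x y)) = tlift V W Z' (\<lambda>x y. g (\<phi> x y)) (tpure V W x y)"
    if "x \<in> carr V" "y \<in> carr W" for x y using assms b that by simp
qed

lemma tlift_cong: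
  assumes "is_vspace V" "is_vspace W" "is_vspace Z" "bilin V W Z \<phi>" "bilin V W Z \<psi>"
    and "\<And>x y. x \<in> carr V \<Longrightarrow> y \<in> carr W \<Longrightarrow> \<phi> x y = \<psi> x y" "t \<in> carr (tensor V W)"
  shows "tlift V W Z \<phi> t = tlift V W Z \<psi> t"
  by (rule tensor_eqI[OF assms(1-3) lin_tlift lin_tlift]) (use assms in simp_all)

text \<open>Nested lifts of a map in four variables, linear in each pair separately. The product of
  a tensor algebra, the actions of B \<otimes> B and the interchange law all have this
  shape.\<close>

lemma
  assumes "is_vspace V" "is_vspace W" "is_vspace V'" "is_vspace W'" "is_vspace Z"
    and 1: "\<And>x y. x \<in> carr V \<Longrightarrow> y \<in> carr W \<Longrightarrow> bilin V' W' Z (\<lambda>x' y'. \<beta> x y x' y')"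
    and 2: "\<And>x' y'. x' \<in> carr V' \<Longrightarrow> y' \<in> carr W' \<Longrightarrow> bilin V W Z (\<lambda>x y. \<beta> x y x' y')"
  shows bilin_tlift2: "bilin (tensor V W) (tensor V' W') Z
      (\<lambda>t t'. tlift V W Z (\<lambda>x y. tlift V' W' Z (\<lambda>x' y'. \<beta> x y x' y') t') t)" (is "bilin ?T ?T' Z
        ?F")
    and tlift2_tpure: "x \<in> carr V \<Longrightarrow> y \<in> carr W \<Longrightarrow> x' \<in> carr V' \<Longrightarrow> y' \<in> carr W' \<Longrightarrow>
      tlift V W Z (\<lambda>x y. tlift V' W' Z (\<lambda>x' y'. \<beta> x y x' y') (tpure V' W' x' y')) (tpure V W x y) =
        \<beta> x y x' y'"
proof -
  have 3: "bilin V W Z (\<lambda>x y. tlift V' W' Z (\<lambda>x' y'. \<beta> x y x' y') t')" if "t' \<in> carr ?T'" for t'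
    by (intro bilinI lin_tlift_parameter) (use assms that in \<open>auto simp: bilin_def\<close>)
  show "bilin ?T ?T' Z ?F"
  proof (rule bilinI)
    show "lin ?T Z (\<lambda>t. ?F t t')" if "t' \<in> carr ?T'" for t'
      by (rule lin_tlift) (use assms 3 that in simp_all)
    show "lin ?T' Z (\<lambda>t'. ?F t t')" if "t \<in> carr ?T" for t
      by (rule lin_tlift_parameter) (use assms 3 that in \<open>auto intro: lin_tlift\<close>)
  qed
  show "tlift V W Z (\<lambda>x y. tlift V' W' Z (\<lambda>x' y'. \<beta> x y x' y') (tpure V' W' x' y')) (tpure V W x y)
      =
      \<beta> x y x' y'" if "x \<in> carr V" "y \<in> carr W" "x' \<in> carr V'" "y' \<in> carr W'"
    using that assms by (subst tlift_tpure) (simp_all add: 3)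
qed

lemma
  assumes "is_vspace V" "is_vspace W" "is_vspace V'" "is_vspace W'" "lin V V' f" "lin W W' g"
  shows lin_tmap: "lin (tensor V W) (tensor V' W') (tmap V W V' W' f g)"
    and tmap_tpure [simp]: "x \<in> carr V \<Longrightarrow> y \<in> carr W \<Longrightarrow>
      tmap V W V' W' f g (tpure V W x y) = tpure V' W' (f x) (g y)"
  using assms bilin_lin2[OF bilin_tpure[OF assms(3,4)] assms(5,6)]
    by (simp_all add: tmap_def lin_tlift)

lemma lin_tmap_comp:
  assumes "is_vspace V" "is_vspace W" "is_vspace V'" "is_vspace W'" "lin V V' f" "lin W W' g"
    and "lin U (tensor V W) h"
  shows "lin U (tensor V' W') (\<lambda>u. tmap V W V' W' f g (h u))"
  by (rule lin_comp[OF lin_tmap assms(7)]) (use assms in auto)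

lemma
  assumes "is_vspace V" "is_vspace W"
  shows lin_tflip: "lin (tensor V W) (tensor W V) (tflip V W)"
    and tflip_tpure [simp]: "x \<in> carr V \<Longrightarrow> y \<in> carr W \<Longrightarrow> tflip V W (tpure V W x y) = tpure W V y x"
proof -
  have "bilin V W (tensor W V) (\<lambda>x y. tpure W V y x)" by (auto intro!: lin_intros simp: assms)
  then show "lin (tensor V W) (tensor W V) (tflip V W)"
    "x \<in> carr V \<Longrightarrow> y \<in> carr W \<Longrightarrow> tflip V W (tpure V W x y) = tpure W V y x"
    using assms by (simp_all add: tflip_def lin_tlift)
qed

lemma
  assumes "is_vspace U" "is_vspace V" "is_vspace W"
  shows lin_tassoc: "lin (tensor (tensor U V) W) (tensor U (tensor V W)) (tassoc U V W)"
    and tassoc_tpure [simp]: "x \<in> carr U \<Longrightarrow> y \<in> carr V \<Longrightarrow> z \<in> carr W \<Longrightarrow>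
      tassoc U V W (tpure (tensor U V) W (tpure U V x y) z) = tpure U (tensor V W) x (tpure V W y
        z)"
proof -
  let ?Z = "tensor U (tensor V W)"
  let ?\<phi> = "\<lambda>z x y. tpure U (tensor V W) x (tpure V W y z)"
  have 1: "bilin U V ?Z (?\<phi> z)" if "z \<in> carr W" for z
    using that by (auto intro!: lin_intros simp: assms)
  have 2: "lin W ?Z (\<lambda>z. ?\<phi> z x y)" if "x \<in> carr U" "y \<in> carr V" for x y
    using that by (auto intro!: lin_intros simp: assms)
  \<comment> \<open>The outer lift can only be formed once the inner one is known to be linear in
    its parameter z.\<close>
  have 3: "bilin (tensor U V) W ?Z (\<lambda>t z. tlift U V ?Z (?\<phi> z) t)"
  proof (rule bilinI)
    show "lin W ?Z (\<lambda>z. tlift U V ?Z (?\<phi> z) t)" if "t \<in> carr (tensor U V)" for t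
      by (rule lin_tlift_parameter) (use assms 1 2 that in simp_all)
    show "lin (tensor U V) ?Z (tlift U V ?Z (?\<phi> z))" if "z \<in> carr W" for z
      by (rule lin_tlift) (use assms 1 that in simp_all)
  qed
  show "lin (tensor (tensor U V) W) ?Z (tassoc U V W)"
    using assms 3 by (simp add: tassoc_def lin_tlift)
  show "tassoc U V W (tpure (tensor U V) W (tpure U V x y) z) =
      tpure U (tensor V W) x (tpure V W y z)"
    if "x \<in> carr U" "y \<in> carr V" "z \<in> carr W"
    using assms that 1 3 by (simp add: tassoc_def)
qed

lemma lin_scal_left: "is_vspace V \<Longrightarrow> lin U ground f \<Longrightarrow> x \<in> carr V \<Longrightarrow> lin U V (\<lambda>u. scal V (f u) x)"
  by (simp add: lin_def vs_add_scal vs_scal_scal)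

lemmas lin_tensor_intros = lin_intros lin_scal_left lin_scalar

lemma
  assumes "is_vspace V"
  shows lin_tlunit: "lin (tensor ground V) V (tlunit V)"
    and tlunit_tpure [simp]: "x \<in> carr V \<Longrightarrow> tlunit V (tpure ground V c x) = scal V c x"
    and lin_trunit: "lin (tensor V ground) V (trunit V)"
    and trunit_tpure [simp]: "x \<in> carr V \<Longrightarrow> trunit V (tpure V ground x c) = scal V c x"
proof -
  have "bilin ground V V (\<lambda>c x. scal V c x)" "bilin V ground V (\<lambda>x c. scal V c x)"
    by (auto intro!: lin_tensor_intros simp: assms)
  then show "lin (tensor ground V) V (tlunit V)" "lin (tensor V ground) V (trunit V)"
    "x \<in> carr V \<Longrightarrow> tlunit V (tpure ground V c x) = scal V c x"
    "x \<in> carr V \<Longrightarrow> trunit V (tpure V ground x c) = scal V c x"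
    using assms by (simp_all add: tlunit_def trunit_def lin_tlift)
qed

lemma tmap_id:
  "is_vspace V \<Longrightarrow> is_vspace W \<Longrightarrow> t \<in> carr (tensor V W) \<Longrightarrow> tmap V W V W (id_map V) (id_map W) t = t"
  by (rule tensor_eqI[OF _ _ _ lin_tmap lin_ident]) (simp_all add: lin_id_map)

lemma tmap_tmap:
  assumes "is_vspace V" "is_vspace W" "is_vspace V'" "is_vspace W'" "is_vspace V''" "is_vspace W''"
    "lin V V' f" "lin W W' g" "lin V' V'' f'" "lin W' W'' g'" "t \<in> carr (tensor V W)"
  shows "tmap V' W' V'' W'' f' g' (tmap V W V' W' f g t) =
    tmap V W V'' W'' (\<lambda>x. f' (f x)) (\<lambda>y. g' (g y)) t"
proof (rule tensor_eqI[OF assms(1,2) _ lin_tmap_comp lin_tmap _ assms(11)])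
  show "lin (tensor V W) (tensor V' W') (\<lambda>x. tmap V W V' W' f g x)" using assms
    by (simp add: lin_tmap)
qed (use assms lin_comp[OF assms(9,7)] lin_comp[OF assms(10,8)] in \<open>simp_all add:
  lin_closed[OF assms(7)] lin_closed[OF assms(8)]\<close>)

lemma tmap_cong:
  assumes "is_vspace V" "is_vspace W" "is_vspace V'" "is_vspace W'"
    "lin V V' f" "lin W W' g" "t \<in> carr (tensor V W)"
    "\<And>x. x \<in> carr V \<Longrightarrow> f x = f' x" "\<And>y. y \<in> carr W \<Longrightarrow> g y = g' y"
  shows "tmap V W V' W' f g t = tmap V W V' W' f' g' t"
proof -
  have l: "lin V V' f'" "lin W W' g'"
    using lin_cong[THEN iffD1, OF assms(8,1,5)] lin_cong[THEN iffD1, OF assms(9,2,6)] by simp_all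
  show ?thesis
    by (rule tensor_eqI[OF assms(1,2) _ lin_tmap lin_tmap _ assms(7)])
      (use assms(1-6,8,9) l in simp_all)
qed

section \<open>Constructions depend only on the underlying vector space\<close>

definition same_vspace ::
  "('k::field, 'v, 'r) vspace_scheme \<Rightarrow> ('k, 'v, 's) vspace_scheme \<Rightarrow> bool" where
  "same_vspace V V' \<longleftrightarrow> carr V = carr V' \<and> add V = add V' \<and> zero V = zero V' \<and> scal V = scal V'"

text \<open>Algebras, bimodules and bimonoids are records extending the vector space record, often
  several of them over one and the same space. Instantiated as rewrite rules, these equations strip
  the additional fields, so that for instance \<open>tensor H H\<close> and
  \<open>tensor A A\<close> become the same term.\<close>

lemma same_vspace_simps:
  assumes "same_vspace V V'"
  shows "carr V = carr V'" "add V = add V'" "zero V = zero V'" "scal V = scal V'"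
    "is_vspace V \<longleftrightarrow> is_vspace V'"
    "lin V W f \<longleftrightarrow> lin V' W f" "lin W V g \<longleftrightarrow> lin W V' g"
    "bilin V W Z \<beta> \<longleftrightarrow> bilin V' W Z \<beta>" "bilin W V Z \<gamma> \<longleftrightarrow> bilin W V' Z \<gamma>"
    "bilin W Z V \<delta> \<longleftrightarrow> bilin W Z V' \<delta>"
    "linear_maps V W = linear_maps V' W" "linear_maps W V = linear_maps W V'"
    "tensor V W = tensor V' W" "tensor W V = tensor W V'"
    "tpure V W = tpure V' W" "tpure W V = tpure W V'"
    "tlift V W Z = tlift V' W Z" "tlift W V Z = tlift W V' Z" "tlift W Z V = tlift W Z V'"
    "tmap V W Y Z = tmap V' W Y Z" "tmap W V Y Z = tmap W V' Y Z"
    "tmap W Y V Z = tmap W Y V' Z" "tmap W Y Z V = tmap W Y Z V'"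
    "tflip V W = tflip V' W" "tflip W V = tflip W V'"
    "id_map V = id_map V'"
proof -
  note eqs = assms[unfolded same_vspace_def, THEN conjunct1]
    assms[unfolded same_vspace_def, THEN conjunct2, THEN conjunct1]
    assms[unfolded same_vspace_def, THEN conjunct2, THEN conjunct2, THEN conjunct1]
    assms[unfolded same_vspace_def, THEN conjunct2, THEN conjunct2, THEN conjunct2]
  show "carr V = carr V'" "add V = add V'" "zero V = zero V'" "scal V = scal V'" by (fact eqs)+
  show "is_vspace V \<longleftrightarrow> is_vspace V'" "lin V W f \<longleftrightarrow> lin V' W f" "lin W V g \<longleftrightarrow> lin W V' g"
    "bilin V W Z \<beta> \<longleftrightarrow> bilin V' W Z \<beta>" "bilin W V Z \<gamma> \<longleftrightarrow> bilin W V' Z \<gamma>"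
    "bilin W Z V \<delta> \<longleftrightarrow> bilin W Z V' \<delta>" "id_map V = id_map V'"
    unfolding lin_def is_vspace_def bilin_def id_map_def eqs by (rule refl)+
  show l: "linear_maps V W = linear_maps V' W" "linear_maps W V = linear_maps W V'"
    by (simp_all only: linear_maps_def eqs)
  \<comment> \<open>W has one fixed type in this proof, whereas \<open>induced\<close> refers to
    linear maps out of a quotient space. The equation is therefore repeated for a source of
    arbitrary element type; \<open>n'\<close> below plays the same part for the null
    subspaces.\<close>
  have l': "linear_maps X V = linear_maps X V'" for X :: "('a, 'x) vspace"
    by (simp only: linear_maps_def eqs)
  have n: "tnull V W = tnull V' W" "tnull W V = tnull W V'"
    by (simp_all only: tnull_def bilinearity_relations_def eqs)
  show t: "tensor V W = tensor V' W" "tensor W V = tensor W V'"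
    by (simp_all only: tensor_def n eqs)
  show p: "tpure V W = tpure V' W" "tpure W V = tpure W V'"
    by (simp_all only: tpure_def n fun_eq_iff simp_thms)
  show m: "tlift V W Z = tlift V' W Z" "tlift W V Z = tlift W V' Z" "tlift W Z V = tlift W Z V'"
    by (simp_all only: tlift_def induced_def n l' eqs fun_eq_iff simp_thms)
  show "tmap V W Y Z = tmap V' W Y Z" "tmap W V Y Z = tmap W V' Y Z"
    "tflip V W = tflip V' W" "tflip W V = tflip W V'"
    by (simp_all only: tmap_def tflip_def tlift_def induced_def n t p eqs fun_eq_iff simp_thms)
  have n': "tnull V U = tnull V' U" "tnull U V = tnull U V'" for U :: "('a, 'u, 'v) vspace_scheme"
    by (simp_all only: tnull_def bilinearity_relations_def eqs)
  show "tmap W Y V Z = tmap W Y V' Z" "tmap W Y Z V = tmap W Y Z V'"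
    by (simp_all only: tmap_def tensor_def tpure_def n' eqs fun_eq_iff simp_thms)
qed

lemma same_vspace_extend: "same_vspace (vspace.extend V f) V"
  by (simp add: same_vspace_def vspace.defs)

lemma same_vspace_tensor_algebra: "same_vspace (tensor_algebra A C) (tensor A C)"
  unfolding tensor_algebra_def by (rule same_vspace_extend)

lemmas tensor_algebra_vspace [simp] = same_vspace_simps[OF same_vspace_tensor_algebra]

section \<open>Algebras\<close>

lemma
  assumes "is_algebra A"
  shows vspace_algebra [simp]: "is_vspace A"
    and bilin_mult: "bilin A A A (mult A)"
    and one_closed [simp]: "one A \<in> carr A"
    and mult_closed [simp]: "x \<in> carr A \<Longrightarrow> y \<in> carr A \<Longrightarrow> mult A x y \<in> carr A"
    and mult_assoc: "x \<in> carr A \<Longrightarrow> y \<in> carr A \<Longrightarrow> z \<in> carr A \<Longrightarrow>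
      mult A (mult A x y) z = mult A x (mult A y z)"
    and mult_one_left [simp]: "x \<in> carr A \<Longrightarrow> mult A (one A) x = x"
    and mult_one_right [simp]: "x \<in> carr A \<Longrightarrow> mult A x (one A) = x"
proof -
  show v: "is_vspace A" and b: "bilin A A A (mult A)"
    using assms by (auto simp: is_algebra_def bilinear_maps_iff)
  show "x \<in> carr A \<Longrightarrow> y \<in> carr A \<Longrightarrow> mult A x y \<in> carr A" by (rule bilin_closed[OF b])
qed (use assms in \<open>auto simp: is_algebra_def\<close>)

lemma lin_mult_left: "is_algebra A \<Longrightarrow> lin U A f \<Longrightarrow> y \<in> carr A \<Longrightarrow> lin U A (\<lambda>x. mult A (f x) y)"
  by (intro bilin_left[OF bilin_mult])

lemma lin_mult_right: "is_algebra A \<Longrightarrow> lin U A f \<Longrightarrow> y \<in> carr A \<Longrightarrow> lin U A (\<lambda>x. mult A y (f x))"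
  by (intro bilin_right[OF bilin_mult])

lemma
  assumes "is_algebra A" "x \<in> carr A" "y \<in> carr A"
  shows mult_scal_left: "mult A (scal A c x) y = scal A c (mult A x y)"
    and mult_scal_right: "mult A x (scal A c y) = scal A c (mult A x y)"
  using bilin_mult[OF assms(1)] assms(2,3) by (auto simp: bilin_def lin_def)

lemmas lin_alg = lin_tensor_intros lin_mult_left lin_mult_right

text \<open>One-sided inverses are assumed because the convolution arguments produce a left inverse
  and a right inverse of the same element by separate computations.\<close>

lemma algebra_inverse_unique:
  assumes "is_algebra A" "x \<in> carr A" "y \<in> carr A" "z \<in> carr A"
    and "mult A x y = one A" "mult A y z = one A"
  shows "x = z"
  using assms mult_assoc[OF assms(1-4)] by simp

lemma tensor_bilin_eqI:
  assumes "is_vspace V" "is_vspace W" "is_vspace V'" "is_vspace W'" "is_vspace Z"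
    and f: "bilin (tensor V W) (tensor V' W') Z (\<lambda>t t'. f t t')"
    and g: "bilin (tensor V W) (tensor V' W') Z (\<lambda>t t'. g t t')"
    and "\<And>x y x' y'. x \<in> carr V \<Longrightarrow> y \<in> carr W \<Longrightarrow> x' \<in> carr V' \<Longrightarrow> y' \<in> carr W' \<Longrightarrow>
      f (tpure V W x y) (tpure V' W' x' y') = g (tpure V W x y) (tpure V' W' x' y')"
    and t: "t \<in> carr (tensor V W)" "t' \<in> carr (tensor V' W')"
  shows "f t t' = g t t'"
proof (rule tensor_eqI[of V W Z "\<lambda>t. f t t'" "\<lambda>t. g t t'"])
  fix x y assume "x \<in> carr V" "y \<in> carr W"
  then show "f (tpure V W x y) t' = g (tpure V W x y) t'"
    by - (rule tensor_eqI[of V' W' Z "f (tpure V W x y)" "g (tpure V W x y)"],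
      insert assms, auto simp: bilin_def)
qed (use assms in \<open>auto simp: bilin_def\<close>)

lemma tensor_algebra_one [simp]: "one (tensor_algebra A C) = tpure A C (one A) (one C)"
  by (simp add: tensor_algebra_def vspace.defs algebra.defs)

lemma tensor_algebra_mult:
  "mult (tensor_algebra A C) =
    (\<lambda>t\<in>carr (tensor A C). \<lambda>t'\<in>carr (tensor A C).
       tlift A C (tensor A C) (\<lambda>x y.
         tlift A C (tensor A C) (\<lambda>x' y'. tpure A C (mult A x x') (mult C y y')) t') t)"
  by (simp add: tensor_algebra_def vspace.defs algebra.defs)

lemma
  assumes A: "is_algebra A" and C: "is_algebra C"
  shows bilin_tensor_mult: "bilin (tensor A C) (tensor A C) (tensor A C) (mult (tensor_algebra A
      C))"
    and tensor_mult_tpure [simp]: "x \<in> carr A \<Longrightarrow> y \<in> carr C \<Longrightarrow> x' \<in> carr A \<Longrightarrow> y' \<in> carr C \<Longrightarrow>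
      mult (tensor_algebra A C) (tpure A C x y) (tpure A C x' y') =
        tpure A C (mult A x x') (mult C y y')"
    and algebra_tensor [simp]: "is_algebra (tensor_algebra A C)"
proof -
  let ?T = "tensor A C" and ?m = "mult (tensor_algebra A C)"
  let ?\<beta> = "\<lambda>x y x' y'. tpure A C (mult A x x') (mult C y y')"
  have v [simp]: "is_vspace A" "is_vspace C" using A C by auto
  have 1: "bilin A C ?T (\<lambda>x' y'. ?\<beta> x y x' y')" if "x \<in> carr A" "y \<in> carr C" for x y
    using that by (auto intro!: lin_alg simp: A C)
  have 2: "bilin A C ?T (\<lambda>x y. ?\<beta> x y x' y')" if "x' \<in> carr A" "y' \<in> carr C" for x' y'
    using that by (auto intro!: lin_alg simp: A C)
  have "bilin ?T ?T ?T (\<lambda>t t'. tlift A C ?T (\<lambda>x y. tlift A C ?T (\<lambda>x' y'. ?\<beta> x y x' y') t') t)"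
    by (rule bilin_tlift2) (use 1 2 in simp_all)
  then show b: "bilin ?T ?T ?T ?m"
    by (rule bilin_cong[THEN iffD1, rotated 3]) (simp_all add: tensor_algebra_mult)
  show p: "?m (tpure A C x y) (tpure A C x' y') = ?\<beta> x y x' y'"
    if "x \<in> carr A" "y \<in> carr C" "x' \<in> carr A" "y' \<in> carr C" for x y x' y'
  proof -
    have "?m (tpure A C x y) (tpure A C x' y') =
        tlift A C ?T (\<lambda>x y. tlift A C ?T (\<lambda>x' y'. ?\<beta> x y x' y') (tpure A C x' y')) (tpure A C x y)"
      unfolding tensor_algebra_mult using that by (simp only: restrict_apply' tpure_closed)
    also have "\<dots> = ?\<beta> x y x' y'" by (rule tlift2_tpure) (use 1 2 that in simp_all)
    finally show ?thesis .
  qed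
  have l: "lin ?T ?T (\<lambda>t. ?m (f t) s)" "lin ?T ?T (\<lambda>t. ?m s (f t))"
    if "s \<in> carr ?T" "lin ?T ?T f" for s f
    using that by (auto intro: bilin_left[OF b] bilin_right[OF b])
  \<comment> \<open>A trilinear identity: t and t' are reduced to pure tensors together, and then
    t'' on its own, after which associativity holds in each factor.\<close>
  have assoc: "?m (?m t t') t'' = ?m t (?m t' t'')"
    if t: "t \<in> carr ?T" "t' \<in> carr ?T" "t'' \<in> carr ?T" for t t' t''
  proof (rule tensor_bilin_eqI[of A C A C ?T "\<lambda>t t'. ?m (?m t t') t''" "\<lambda>t t'. ?m t (?m t' t'')"])
    fix x y x' y' assume xy: "x \<in> carr A" "y \<in> carr C" "x' \<in> carr A" "y' \<in> carr C"
    show "?m (?m (tpure A C x y) (tpure A C x' y')) t'' =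
        ?m (tpure A C x y) (?m (tpure A C x' y') t'')"
      by (rule tensor_eqI[of A C ?T "\<lambda>t''. ?m (?m (tpure A C x y) (tpure A C x' y')) t''"])
        (use xy t A C in \<open>auto intro!: l lin_ident simp: p mult_assoc bilin_closed[OF b]\<close>)
  qed (use t in \<open>auto intro!: bilinI l lin_ident simp: bilin_closed[OF b]\<close>)
  have one: "?m (tpure A C (one A) (one C)) t = t" "?m t (tpure A C (one A) (one C)) = t"
    if t: "t \<in> carr ?T" for t
  proof -
    show "?m (tpure A C (one A) (one C)) t = t"
      by (rule tensor_eqI[OF v vspace_tensor[OF v] l(2)[OF _ lin_ident] lin_ident _ t])
        (simp_all add: A C p)
    show "?m t (tpure A C (one A) (one C)) = t"
      by (rule tensor_eqI[OF v vspace_tensor[OF v] l(1)[OF _ lin_ident] lin_ident _ t])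
        (simp_all add: A C p)
  qed
  show "is_algebra (tensor_algebra A C)"
    unfolding is_algebra_def[of "tensor_algebra A C"]
  proof (intro conjI ballI)
    let ?TA = "tensor_algebra A C"
    have "?m \<in> extensional (carr ?T)" "\<And>t. t \<in> carr ?T \<Longrightarrow> ?m t \<in> extensional (carr ?T)"
      unfolding tensor_algebra_mult by (simp_all only: restrict_extensional restrict_apply')
    then show "?m \<in> bilinear_maps ?TA ?TA ?TA" using b by (simp add: bilinear_maps_iff)
  qed (simp_all add: assoc one A C)
qed

definition alg_map ::
  "('k::field, 'a, 'r) algebra_scheme \<Rightarrow> ('k, 'c, 's) algebra_scheme \<Rightarrow> ('a \<Rightarrow> 'c) \<Rightarrow> bool" where
  "alg_map A C f \<longleftrightarrow> lin A C f \<and>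
    (\<forall>x\<in>carr A. \<forall>y\<in>carr A. f (mult A x y) = mult C (f x) (f y)) \<and> f (one A) = one C"

lemma
  assumes "alg_map A C f"
  shows alg_map_lin: "lin A C f"
    and alg_map_closed: "x \<in> carr A \<Longrightarrow> f x \<in> carr C"
    and alg_map_mult: "x \<in> carr A \<Longrightarrow> y \<in> carr A \<Longrightarrow> f (mult A x y) = mult C (f x) (f y)"
    and alg_map_one: "f (one A) = one C"
  using assms by (auto simp: alg_map_def lin_def)

lemma alg_map_tmap:
  assumes A: "is_algebra A" "is_algebra C" "is_algebra A'" "is_algebra C'"
    and f: "alg_map A A' f" and g: "alg_map C C' g"
  shows "alg_map (tensor_algebra A C) (tensor_algebra A' C') (tmap A C A' C' f g)"
proof -
  let ?h = "tmap A C A' C' f g"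
  note lf = alg_map_lin[OF f] alg_map_lin[OF g]
  note cl = alg_map_closed[OF f] alg_map_closed[OF g]
  have h: "lin (tensor A C) (tensor A' C') ?h" using A lf by (simp add: lin_tmap)
  have "?h (mult (tensor_algebra A C) t s) = mult (tensor_algebra A' C') (?h t) (?h s)"
    if "t \<in> carr (tensor A C)" "s \<in> carr (tensor A C)" for t s
  proof (rule tensor_bilin_eqI[of A C A C "tensor A' C'"])
    show "bilin (tensor A C) (tensor A C) (tensor A' C') (\<lambda>t s. ?h (mult (tensor_algebra A C) t s))"
      using bilin_tensor_mult[OF A(1,2)] h by (simp add: bilin_def lin_def)
    show "bilin (tensor A C) (tensor A C) (tensor A' C') (\<lambda>t s. mult (tensor_algebra A' C') (?h t)
        (?h s))"
      by (rule bilin_lin2[OF bilin_tensor_mult[OF A(3,4)] h h])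
  qed (use A lf that cl alg_map_mult[OF f] alg_map_mult[OF g] in simp_all)
  then show ?thesis
    using A h lf by (simp add: alg_map_def alg_map_one[OF f] alg_map_one[OF g])
qed

lemma inverse_of_unique:
  "is_algebra A \<Longrightarrow> x \<in> carr A \<Longrightarrow> inverse_of A x y \<Longrightarrow> inverse_of A x z \<Longrightarrow> y = z"
  using algebra_inverse_unique[of A y x z] by (simp add: inverse_of_def)

lemma alg_inverse_eq: "is_algebra A \<Longrightarrow> x \<in> carr A \<Longrightarrow> inverse_of A x y \<Longrightarrow> alg_inverse A x = y"
  unfolding alg_inverse_def by (rule the_equality) (auto intro: inverse_of_unique)

lemma inverse_of_alg_map:
  "alg_map A C f \<Longrightarrow> x \<in> carr A \<Longrightarrow> inverse_of A x y \<Longrightarrow> inverse_of C (f x) (f y)"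
  by (auto simp: inverse_of_def alg_map_closed alg_map_one simp flip: alg_map_mult)

lemma lin_legs:
  assumes "is_algebra A"
  shows "lin (tensor A A) (tensor A (tensor A A)) (leg12 A)"
    and "lin (tensor A A) (tensor A (tensor A A)) (leg13 A)"
    and "lin (tensor A A) (tensor A (tensor A A)) (leg23 A)"
    and "x \<in> carr A \<Longrightarrow> y \<in> carr A \<Longrightarrow>
      leg12 A (tpure A A x y) = tpure A (tensor A A) x (tpure A A y (one A))"
    and "x \<in> carr A \<Longrightarrow> y \<in> carr A \<Longrightarrow>
      leg13 A (tpure A A x y) = tpure A (tensor A A) x (tpure A A (one A) y)"
    and "leg23 A R = tpure A (tensor A A) (one A) R"
proof -
  have 12: "bilin A A (tensor A (tensor A A)) (\<lambda>r s. tpure A (tensor A A) r (tpure A A s (one A)))"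
    by (auto intro!: lin_alg simp: assms)
  have 13: "bilin A A (tensor A (tensor A A)) (\<lambda>r s. tpure A (tensor A A) r (tpure A A (one A) s))"
    by (auto intro!: lin_alg simp: assms)
  show "lin (tensor A A) (tensor A (tensor A A)) (leg12 A)"
    unfolding leg12_def using 12 assms by (auto intro!: lin_tlift_comp lin_ident)
  show "lin (tensor A A) (tensor A (tensor A A)) (leg13 A)"
    unfolding leg13_def using 13 assms by (auto intro!: lin_tlift_comp lin_ident)
  show "lin (tensor A A) (tensor A (tensor A A)) (leg23 A)"
    unfolding leg23_def using assms by (auto intro!: lin_alg)
  show "leg12 A (tpure A A x y) = tpure A (tensor A A) x (tpure A A y (one A))"
    "leg13 A (tpure A A x y) = tpure A (tensor A A) x (tpure A A (one A) y)"
    if "x \<in> carr A" "y \<in> carr A"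
    using 12 13 assms that by (simp_all add: leg12_def leg13_def)
  show "leg23 A R = tpure A (tensor A A) (one A) R" by (simp add: leg23_def)
qed

text \<open>The empty leg is filled with the unit, which algebra maps preserve. The lemma moves the
  right-hand sides of the hexagon identities along an algebra map.\<close>

lemma legs_natural:
  assumes A: "is_algebra A" and C: "is_algebra C" and f: "alg_map A C f"
    and R: "R \<in> carr (tensor A A)"
  defines "f2 \<equiv> tmap A A C C f f"
  defines "f3 \<equiv> tmap A (tensor A A) C (tensor C C) f f2"
  shows "f3 (leg12 A R) = leg12 C (f2 R)" "f3 (leg13 A R) = leg13 C (f2 R)"
    "f3 (leg23 A R) = leg23 C (f2 R)"
proof -
  note lf = alg_map_lin[OF f] and cl = alg_map_closed[OF f]
  have f2: "lin (tensor A A) (tensor C C) f2" unfolding f2_def using A C lf by (simp add: lin_tmap)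
  have f3: "lin (tensor A (tensor A A)) (tensor C (tensor C C)) f3"
    unfolding f3_def using A C lf f2 by (simp add: lin_tmap)
  have f2p: "f2 (tpure A A x y) = tpure C C (f x) (f y)" if "x \<in> carr A" "y \<in> carr A" for x y
    unfolding f2_def using A C lf that by simp
  have f3p: "f3 (tpure A (tensor A A) x t) = tpure C (tensor C C) (f x) (f2 t)"
    if "x \<in> carr A" "t \<in> carr (tensor A A)" for x t
    unfolding f3_def using A C lf f2 that by simp
  show "f3 (leg12 A R) = leg12 C (f2 R)"
    by (rule tensor_eqI[OF _ _ _ lin_comp[OF f3 lin_legs(1)[OF A]] lin_comp[OF lin_legs(1)[OF C] f2]
      _ R])
      (use A C in \<open>simp_all add: lin_legs f2p f3p cl alg_map_one[OF f]\<close>)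
  show "f3 (leg13 A R) = leg13 C (f2 R)"
    by (rule tensor_eqI[OF _ _ _ lin_comp[OF f3 lin_legs(2)[OF A]] lin_comp[OF lin_legs(2)[OF C] f2]
      _ R])
      (use A C in \<open>simp_all add: lin_legs f2p f3p cl alg_map_one[OF f]\<close>)
  show "f3 (leg23 A R) = leg23 C (f2 R)"
    using A C R by (simp add: lin_legs f3p alg_map_one[OF f])
qed

section \<open>Bialgebras and antipodes\<close>

lemma
  assumes "is_bialgebra A"
  shows algebra_bialgebra [simp]: "is_algebra A"
    and lin_comult: "lin A (tensor A A) (comult A)"
    and lin_counit: "lin A ground (counit A)"
    and comult_closed [simp]: "x \<in> carr A \<Longrightarrow> comult A x \<in> carr (tensor A A)"
    and coassoc: "x \<in> carr A \<Longrightarrow> tassoc A A A (tmap A A (tensor A A) A (comult A) (id_map A) (comult A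
        x)) =
      tmap A A A (tensor A A) (id_map A) (comult A) (comult A x)"
    and counit_left: "x \<in> carr A \<Longrightarrow> tlunit A (tmap A A ground A (counit A) (id_map A) (comult A x)) =
        x"
    and counit_right: "x \<in> carr A \<Longrightarrow> trunit A (tmap A A A ground (id_map A) (counit A) (comult A x))
        = x"
    and comult_mult: "x \<in> carr A \<Longrightarrow> y \<in> carr A \<Longrightarrow>
      comult A (mult A x y) = mult (tensor_algebra A A) (comult A x) (comult A y)"
    and comult_one: "comult A (one A) = tpure A A (one A) (one A)"
    and counit_mult: "x \<in> carr A \<Longrightarrow> y \<in> carr A \<Longrightarrow> counit A (mult A x y) = counit A x * counit A y"
    and counit_one [simp]: "counit A (one A) = 1"
proof -
  show "is_algebra A" "lin A (tensor A A) (comult A)" "lin A ground (counit A)"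
    using assms by (simp_all add: is_bialgebra_def is_coalgebra_def linear_maps_iff)
  then show "x \<in> carr A \<Longrightarrow> comult A x \<in> carr (tensor A A)" by (simp add: lin_closed)
qed (use assms in \<open>simp_all add: is_bialgebra_def is_coalgebra_def\<close>)

lemma lin_comult_comp: "is_bialgebra A \<Longrightarrow> lin U A f \<Longrightarrow> lin U (tensor A A) (\<lambda>x. comult A (f x))"
  by (rule lin_comp[OF lin_comult])

lemma lin_counit_comp: "is_bialgebra A \<Longrightarrow> lin U A f \<Longrightarrow> lin U ground (\<lambda>x. counit A (f x))"
  by (rule lin_comp[OF lin_counit])

lemmas lin_bialg = lin_alg lin_comult_comp lin_counit_comp

lemma tlift_tmap:
  assumes "is_vspace V" "is_vspace W" "is_vspace V'" "is_vspace W'" "is_vspace Z"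
    and f: "lin V V' f" and g: "lin W W' g" and \<phi>: "bilin V' W' Z \<phi>" and t: "t \<in> carr (tensor V W)"
  shows "tlift V' W' Z \<phi> (tmap V W V' W' f g t) = tlift V W Z (\<lambda>x y. \<phi> (f x) (g y)) t"
proof (rule tensor_eqI[OF assms(1,2,5) _ _ _ t])
  have b: "bilin V W Z (\<lambda>x y. \<phi> (f x) (g y))" by (rule bilin_lin2[OF \<phi> f g])
  show "lin (tensor V W) Z (tlift V W Z (\<lambda>x y. \<phi> (f x) (g y)))" by (rule lin_tlift)
    (use assms b in simp_all)
  show "lin (tensor V W) Z (\<lambda>t. tlift V' W' Z \<phi> (tmap V W V' W' f g t))"
    by (rule lin_comp[OF lin_tlift lin_tmap]) (use assms in simp_all)
  show "tlift V' W' Z \<phi> (tmap V W V' W' f g (tpure V W x y)) =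
      tlift V W Z (\<lambda>x y. \<phi> (f x) (g y)) (tpure V W x y)"
    if "x \<in> carr V" "y \<in> carr W" for x y
    using assms b that by (simp add: lin_closed[OF f] lin_closed[OF g])
qed

section \<open>Convolution algebras of linear maps\<close>

definition convolution ::
  "('k::field, 'c, 'r) bialgebra_scheme \<Rightarrow> ('k, 'a, 's) algebra_scheme \<Rightarrow> ('k, 'c \<Rightarrow> 'a) algebra" where
  "convolution C A =
    \<lparr>carr = linear_maps C A,
     add = (\<lambda>f\<in>linear_maps C A. \<lambda>g\<in>linear_maps C A. \<lambda>x\<in>carr C. add A (f x) (g x)),
     zero = (\<lambda>x\<in>carr C. zero A),
     scal = (\<lambda>c. \<lambda>f\<in>linear_maps C A. \<lambda>x\<in>carr C. scal A c (f x)),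
     mult = (\<lambda>f\<in>linear_maps C A. \<lambda>g\<in>linear_maps C A. \<lambda>x\<in>carr C.
       tlift C C A (\<lambda>y z. mult A (f y) (g z)) (comult C x)),
     one = (\<lambda>x\<in>carr C. scal A (counit C x) (one A))\<rparr>"

lemma linear_maps_restrict:
  "is_vspace V \<Longrightarrow> lin V W f \<Longrightarrow> (\<lambda>x\<in>carr V. f x) \<in> linear_maps V W"
  by (simp add: linear_maps_iff lin_cong[of V "restrict f (carr V)" f])

lemma linear_maps_ext:
  "f \<in> linear_maps V W \<Longrightarrow> g \<in> linear_maps V W \<Longrightarrow> (\<And>x. x \<in> carr V \<Longrightarrow> f x = g x) \<Longrightarrow> f = g"
  by (rule extensionalityI[of f "carr V" g]) (simp_all add: linear_maps_iff)

lemma lin_zero_map: "is_vspace W \<Longrightarrow> lin V W (\<lambda>x. zero W)"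
  by (simp add: lin_def)

text \<open>An antipode is a convolution inverse of the identity, so its properties reduce to the
  uniqueness of inverses in an algebra of this kind. The target is an arbitrary algebra, which
  allows the construction to be iterated. Associativity combines coassociativity of C with
  associativity of A; the unit laws are the counit laws.\<close>

lemma
  fixes C :: "('k::field, 'c, 'r) bialgebra_scheme" and A :: "('k, 'a, 's) algebra_scheme"
  assumes C: "is_bialgebra C" and A: "is_algebra A"
  shows convolution_simps:
    "carr (convolution C A) = linear_maps C A"
    "f \<in> linear_maps C A \<Longrightarrow> g \<in> linear_maps C A \<Longrightarrow> x \<in> carr C \<Longrightarrow>
      add (convolution C A) f g x = add A (f x) (g x)"
    "f \<in> linear_maps C A \<Longrightarrow> x \<in> carr C \<Longrightarrow> scal (convolution C A) c f x = scal A c (f x)"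
    "f \<in> linear_maps C A \<Longrightarrow> g \<in> linear_maps C A \<Longrightarrow> x \<in> carr C \<Longrightarrow>
      mult (convolution C A) f g x = tlift C C A (\<lambda>y z. mult A (f y) (g z)) (comult C x)"
    "one (convolution C A) = (\<lambda>x\<in>carr C. scal A (counit C x) (one A))"
    and algebra_convolution: "is_algebra (convolution C A)"
    and lin_convolutionI:
      "(\<And>u. u \<in> carr U \<Longrightarrow> F u \<in> linear_maps C A) \<Longrightarrow> (\<And>x. x \<in> carr C \<Longrightarrow> lin U A (\<lambda>u. F u x)) \<Longrightarrow>
        is_vspace U \<Longrightarrow> lin U (convolution C A) F"
    and bilin_convolution:
      "f \<in> linear_maps C A \<Longrightarrow> g \<in> linear_maps C A \<Longrightarrow> bilin C C A (\<lambda>y z. mult A (f y) (g z))"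
proof -
  let ?V = "convolution C A" and ?L = "linear_maps C A"
  have v [simp]: "is_vspace A" "is_vspace C" using A C by auto
  have L [simp]: "f x \<in> carr A" if "f \<in> ?L" "x \<in> carr C" for f x
    by (rule lin_closed[OF linear_maps_lin[OF that(1)] that(2)])
  have ext: "f x = undefined" if "f \<in> ?L" "x \<notin> carr C" for f x
    using that by (simp add: linear_maps_iff extensional_def)
  show c: "carr ?V = ?L" by (simp add: convolution_def)
  show a: "add ?V f g x = add A (f x) (g x)" if "f \<in> ?L" "g \<in> ?L" "x \<in> carr C" for f g x
    using that by (simp add: convolution_def)
  show s: "scal ?V c f x = scal A c (f x)" if "f \<in> ?L" "x \<in> carr C" for c f x
    using that by (simp add: convolution_def)
  show m: "mult ?V f g x = tlift C C A (\<lambda>y z. mult A (f y) (g z)) (comult C x)"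
    if "f \<in> ?L" "g \<in> ?L" "x \<in> carr C" for f g x
    using that by (simp add: convolution_def)
  show o: "one ?V = (\<lambda>x\<in>carr C. scal A (counit C x) (one A))" by (simp add: convolution_def)
  have z: "zero ?V = (\<lambda>x\<in>carr C. zero A)" by (simp add: convolution_def)
  have ac: "add ?V f g \<in> ?L" if "f \<in> ?L" "g \<in> ?L" for f g
    using that linear_maps_restrict[OF v(2) lin_plus[OF v(1) linear_maps_lin linear_maps_lin]]
    by (simp add: convolution_def)
  have sc: "scal ?V k f \<in> ?L" if "f \<in> ?L" for k f
    using that linear_maps_restrict[OF v(2) lin_scalar[OF v(1) linear_maps_lin]]
    by (simp add: convolution_def)
  have zc: "zero ?V \<in> ?L" unfolding z by (intro linear_maps_restrict lin_zero_map) simp_all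
  have z': "zero ?V x = zero A" if "x \<in> carr C" for x using that by (simp add: z)
  have vs: "is_vspace ?V"
    unfolding is_vspace_def c
  proof (intro conjI ballI allI)
    have "add ?V \<in> extensional ?L" "add ?V f \<in> extensional ?L" if "f \<in> ?L" for f
      using that by (simp_all add: convolution_def)
    then show "add ?V \<in> ?L \<rightarrow>\<^sub>E ?L \<rightarrow>\<^sub>E ?L"
      using ac zc by (auto simp: PiE_iff)
    show "scal ?V \<in> UNIV \<rightarrow> ?L \<rightarrow>\<^sub>E ?L"
      using sc by (simp add: PiE_iff Pi_iff convolution_def)
    show "\<exists>g\<in>?L. add ?V f g = zero ?V" if "f \<in> ?L" for f
    proof (rule bexI[of _ "scal ?V (- 1) f"])
      have "add A (f x) (scal A (- 1) (f x)) = zero A" if "x \<in> carr C" for x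
        using vs_add_scal[OF v(1), of "f x" 1 "- 1"] \<open>f \<in> ?L\<close> that by simp
      then show "add ?V f (scal ?V (- 1) f) = zero ?V"
        using that by (intro linear_maps_ext[OF ac zc]) (simp_all add: a s sc z)
    qed (simp add: sc that)
  qed (rule zc | (rule linear_maps_ext[of _ C A]; simp add: ac sc zc a s z' vs_add_assoc
      vs_add_commute vs_add_left_commute vs_scal_add vs_add_scal vs_scal_scal))+
  \<comment> \<open>Evaluation at a point is linear. Together with \<open>lI\<close> it reduces
    linearity statements about the convolution algebra to statements in A.\<close>
  have ev: "lin ?V A (\<lambda>f. f x)" if "x \<in> carr C" for x
    using that by (intro linI) (simp_all add: c a s)
  show lI: "lin U ?V F" if F: "\<And>u. u \<in> carr U \<Longrightarrow> F u \<in> ?L" "\<And>x. x \<in> carr C \<Longrightarrow> lin U A (\<lambda>u. F u x)"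
    "is_vspace U" for U :: "('k, 'u, 'q) vspace_scheme" and F
  proof (rule linI)
    show "F (add U u u') = add ?V (F u) (F u')" if "u \<in> carr U" "u' \<in> carr U" for u u'
      by (rule linear_maps_ext[of _ C A]) (use that F in \<open>simp_all add: ac a lin_add[OF F(2)]\<close>)
    show "F (scal U k u) = scal ?V k (F u)" if "u \<in> carr U" for k u
      by (rule linear_maps_ext[of _ C A]) (use that F in \<open>simp_all add: sc s lin_scal[OF F(2)]\<close>)
  qed (use F in \<open>simp add: c\<close>)
  show b: "bilin C C A (\<lambda>y z. mult A (f y) (g z))" if "f \<in> ?L" "g \<in> ?L" for f g
    by (rule bilin_lin2[OF bilin_mult[OF A] linear_maps_lin linear_maps_lin]) (fact that)+
  have mc: "mult ?V f g \<in> ?L" if "f \<in> ?L" "g \<in> ?L" for f g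
  proof -
    have "(\<lambda>x\<in>carr C. tlift C C A (\<lambda>y z. mult A (f y) (g z)) (comult C x)) \<in> ?L"
      by (intro linear_maps_restrict lin_comp[OF lin_tlift lin_comult]) (use A C b that in simp_all)
    then show ?thesis using that by (simp add: convolution_def)
  qed
  have oc: "one ?V \<in> ?L" unfolding o
    by (intro linear_maps_restrict lin_scal_left lin_counit) (use A C in simp_all)
  have bm: "bilin ?V ?V ?V (mult ?V)"
  proof (rule bilinI)
    fix f assume f: "f \<in> carr ?V"
    show "lin ?V ?V (\<lambda>g. mult ?V f g)" "lin ?V ?V (\<lambda>g. mult ?V g f)"
    proof (rule_tac [!] lI)
      fix x assume x: "x \<in> carr C"
      have "lin ?V A (\<lambda>g. tlift C C A (\<lambda>y z. mult A (f y) (g z)) (comult C x))"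
        by (rule lin_tlift_parameter)
          (use f x C vs in \<open>auto simp: c A intro!: b lin_mult_right ev\<close>)
      then show "lin ?V A (\<lambda>g. mult ?V f g x)"
        by (rule lin_cong[THEN iffD1, rotated 2]) (use f x vs in \<open>simp_all add: c m\<close>)
      have "lin ?V A (\<lambda>g. tlift C C A (\<lambda>y z. mult A (g y) (f z)) (comult C x))"
        by (rule lin_tlift_parameter)
          (use f x C vs in \<open>auto simp: c A intro!: b lin_mult_left ev\<close>)
      then show "lin ?V A (\<lambda>g. mult ?V g f x)"
        by (rule lin_cong[THEN iffD1, rotated 2]) (use f x vs in \<open>simp_all add: c m\<close>)
    qed (use f vs in \<open>simp_all add: c mc\<close>)
  qed
  have assoc: "mult ?V (mult ?V f g) h = mult ?V f (mult ?V g h)"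
    if fgh: "f \<in> ?L" "g \<in> ?L" "h \<in> ?L" for f g h
  proof (rule linear_maps_ext[of _ C A])
    fix x assume x: "x \<in> carr C"
    let ?\<gamma> = "\<lambda>a s. tlift C C A (\<lambda>y z. mult A (f a) (mult A (g y) (h z))) s"
    \<comment> \<open>T sends a \<otimes> (y \<otimes> z) to f(a) g(y) h(z). Both bracketings of the
      threefold product at x are T applied to an iterated coproduct of x, and coassociativity says
      that the two iterated coproducts agree.\<close>
    define T where "T = tlift C (tensor C C) A ?\<gamma>"
    note lf = linear_maps_lin[OF fgh(1)] linear_maps_lin[OF fgh(2)] linear_maps_lin[OF fgh(3)]
    have b1: "bilin C C A (\<lambda>y z. mult A (f a) (mult A (g y) (h z)))" if "a \<in> carr C" for a
      using that fgh by (auto intro!: lin_alg lf simp: A)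
    have b2: "bilin C (tensor C C) A ?\<gamma>"
    proof (rule bilinI)
      show "lin (tensor C C) A (\<lambda>s. ?\<gamma> a s)" if "a \<in> carr C" for a
        by (rule lin_tlift) (use b1 that in simp_all)
      show "lin C A (\<lambda>a. ?\<gamma> a s)" if "s \<in> carr (tensor C C)" for s
        by (rule lin_tlift_parameter) (use b1 that fgh in \<open>auto intro!: lin_mult_left lf simp: A\<close>)
    qed
    have T: "lin (tensor C (tensor C C)) A T" unfolding T_def by (rule lin_tlift) (simp_all add: b2)
    have Tp: "T (tpure C (tensor C C) a s) = ?\<gamma> a s" if "a \<in> carr C" "s \<in> carr (tensor C C)" for a s
      unfolding T_def by (rule tlift_tpure) (use b2 that in simp_all)
    have left: "mult A (tlift C C A (\<lambda>y z. mult A (f y) (g z)) s) (h z) =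
        T (tassoc C C C (tpure (tensor C C) C s z))" if z: "z \<in> carr C" and s: "s \<in> carr (tensor C
          C)" for s z
    proof (rule tensor_eqI[OF v(2) v(2) v(1) _ _ _ s])
      show "lin (tensor C C) A (\<lambda>s. mult A (tlift C C A (\<lambda>y z. mult A (f y) (g z)) s) (h z))"
        by (intro lin_mult_left lin_tlift b) (use A fgh z in simp_all)
      show "lin (tensor C C) A (\<lambda>s. T (tassoc C C C (tpure (tensor C C) C s z)))"
        by (intro lin_comp[OF T] lin_comp[OF lin_tassoc] lin_tpure_left lin_ident)
          (use z in simp_all)
    qed (use z A fgh in \<open>simp_all add: Tp b b1 mult_assoc\<close>)
    have right: "mult A (f a) (tlift C C A (\<lambda>y z. mult A (g y) (h z)) s) = ?\<gamma> a s"
      if "a \<in> carr C" "s \<in> carr (tensor C C)" for a s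
      by (rule lin_tlift_eq[of C C A A _ "mult A (f a)"])
        (use A fgh that in \<open>simp_all add: b lin_mult_right lin_ident\<close>)
    have "mult ?V (mult ?V f g) h x =
        T (tassoc C C C (tmap C C (tensor C C) C (comult C) (id_map C) (comult C x)))"
    proof (subst m[OF mc fgh(3) x], (rule fgh)+,
        rule tensor_eqI[of C C A, OF v(2) v(2) v(1) _ _ _ comult_closed[OF C x]])
      show "lin (tensor C C) A (tlift C C A (\<lambda>y z. mult A (mult ?V f g y) (h z)))"
        by (intro lin_tlift b mc fgh) simp_all
      show "lin (tensor C C) A (\<lambda>t. T (tassoc C C C (tmap C C (tensor C C) C (comult C) (id_map C)
          t)))"
        by (intro lin_comp[OF T] lin_comp[OF lin_tassoc] lin_tmap lin_comult lin_id_map)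
          (use C in simp_all)
    qed (use C fgh in \<open>simp_all add: b mc m left lin_comult lin_id_map\<close>)
    also have "\<dots> = T (tmap C C C (tensor C C) (id_map C) (comult C) (comult C x))"
      using C x by (simp add: coassoc)
    also have "\<dots> = mult ?V f (mult ?V g h) x"
    proof (subst m[OF fgh(1) mc x], (rule fgh)+, rule sym,
        rule tensor_eqI[of C C A, OF v(2) v(2) v(1) _ _ _ comult_closed[OF C x]])
      show "lin (tensor C C) A (tlift C C A (\<lambda>y z. mult A (f y) (mult ?V g h z)))"
        by (intro lin_tlift b mc fgh) simp_all
      show "lin (tensor C C) A (\<lambda>t. T (tmap C C C (tensor C C) (id_map C) (comult C) t))"
        by (intro lin_comp[OF T] lin_tmap lin_comult lin_id_map) (use C in simp_all)
    qed (use C fgh in \<open>simp_all add: b mc m right Tp lin_comult lin_id_map\<close>)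
    finally show "mult ?V (mult ?V f g) h x = mult ?V f (mult ?V g h) x" .
  qed (simp_all add: mc fgh)
  have oneL: "mult ?V (one ?V) f = f" and oneR: "mult ?V f (one ?V) = f" if f: "f \<in> ?L" for f
  proof -
    have lf: "lin C A f" using f by (rule linear_maps_lin)
    have oa: "one ?V x = scal A (counit C x) (one A)" if "x \<in> carr C" for x using that
      by (simp add: o)
    show "mult ?V (one ?V) f = f"
    proof (rule linear_maps_ext[of _ C A])
      fix x assume x: "x \<in> carr C"
      have "tlift C C A (\<lambda>y z. mult A (one ?V y) (f z)) (comult C x) =
          f (tlunit C (tmap C C ground C (counit C) (id_map C) (comult C x)))"
      proof (rule tensor_eqI[of C C A, OF v(2) v(2) v(1) _ _ _ comult_closed[OF C x]])
        show "lin (tensor C C) A (tlift C C A (\<lambda>y z. mult A (one ?V y) (f z)))"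
          by (intro lin_tlift b oc f) simp_all
        show "lin (tensor C C) A (\<lambda>t. f (tlunit C (tmap C C ground C (counit C) (id_map C) t)))"
          by (intro lin_comp[OF lf] lin_comp[OF lin_tlunit] lin_tmap lin_counit lin_id_map)
            (use C in simp_all)
      qed (use C f A in \<open>simp_all add: b oc oa lin_counit lin_id_map mult_scal_left
        lin_scal[OF lf]\<close>)
      then show "mult ?V (one ?V) f x = f x" using x C f by (simp add: m oc counit_left)
    qed (simp_all add: mc oc f)
    show "mult ?V f (one ?V) = f"
    proof (rule linear_maps_ext[of _ C A])
      fix x assume x: "x \<in> carr C"
      have "tlift C C A (\<lambda>y z. mult A (f y) (one ?V z)) (comult C x) =
          f (trunit C (tmap C C C ground (id_map C) (counit C) (comult C x)))"
      proof (rule tensor_eqI[of C C A, OF v(2) v(2) v(1) _ _ _ comult_closed[OF C x]])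
        show "lin (tensor C C) A (tlift C C A (\<lambda>y z. mult A (f y) (one ?V z)))"
          by (intro lin_tlift b oc f) simp_all
        show "lin (tensor C C) A (\<lambda>t. f (trunit C (tmap C C C ground (id_map C) (counit C) t)))"
          by (intro lin_comp[OF lf] lin_comp[OF lin_trunit] lin_tmap lin_counit lin_id_map)
            (use C in simp_all)
      qed (use C f A in \<open>simp_all add: b oc oa lin_counit lin_id_map mult_scal_right
        lin_scal[OF lf]\<close>)
      then show "mult ?V f (one ?V) x = f x" using x C f by (simp add: m oc counit_right)
    qed (simp_all add: mc oc f)
  qed
  show "is_algebra ?V"
    unfolding is_algebra_def
  proof (intro conjI ballI)
    have "mult ?V \<in> extensional ?L" "\<And>f. f \<in> ?L \<Longrightarrow> mult ?V f \<in> extensional ?L"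
      by (simp_all add: convolution_def)
    then show "mult ?V \<in> bilinear_maps ?V ?V ?V" using bm vs by (simp add: bilinear_maps_iff c)
  qed (simp_all add: vs c oc assoc oneL oneR)
qed

section \<open>Antipodes\<close>

lemma id_map_linear: "is_vspace V \<Longrightarrow> id_map V \<in> linear_maps V V"
  unfolding id_map_def by (rule linear_maps_restrict[OF _ lin_ident])

lemma
  assumes A: "is_bialgebra A" and \<Sigma>: "is_antipode A \<Sigma>"
  shows antipode_linear: "\<Sigma> \<in> linear_maps A A"
    and antipode_left: "x \<in> carr A \<Longrightarrow>
      tlift A A A (\<lambda>y z. mult A (\<Sigma> y) z) (comult A x) = scal A (counit A x) (one A)"
    and antipode_right: "x \<in> carr A \<Longrightarrow>
      tlift A A A (\<lambda>y z. mult A y (\<Sigma> z)) (comult A x) = scal A (counit A x) (one A)"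
    and antipode_closed: "x \<in> carr A \<Longrightarrow> \<Sigma> x \<in> carr A"
    and bilin_antipode_left: "bilin A A A (\<lambda>y z. mult A (\<Sigma> y) z)"
    and bilin_antipode_right: "bilin A A A (\<lambda>y z. mult A y (\<Sigma> z))"
proof -
  show l: "\<Sigma> \<in> linear_maps A A" using \<Sigma> by (simp add: is_antipode_def)
  note l' = linear_maps_lin[OF l]
  show "\<Sigma> x \<in> carr A" if "x \<in> carr A" using lin_closed[OF l' that] .
  show "bilin A A A (\<lambda>y z. mult A (\<Sigma> y) z)" "bilin A A A (\<lambda>y z. mult A y (\<Sigma> z))"
    by (intro bilin_lin2[OF bilin_mult] lin_ident l', simp add: A)+
qed (use \<Sigma> in \<open>simp_all add: is_antipode_def\<close>)

text \<open>Since \<Delta>(1) = 1 \<otimes> 1 and \<epsilon>(1) = 1, the left antipode axiom at 1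
  reads \<Sigma>(1) 1 = 1.\<close>

lemma antipode_one:
  assumes A: "is_bialgebra A" and S: "is_antipode A \<Sigma>"
  shows "\<Sigma> (one A) = one A"
  using antipode_left[OF A S, of "one A"] bilin_antipode_left[OF A S] antipode_closed[OF A S, of
    "one A"] A
  by (simp add: comult_one)

lemma
  assumes "u \<in> bialgebra_maps B A"
  shows bialgebra_map_linear: "u \<in> linear_maps B A"
    and bialgebra_map_lin: "lin B A u"
    and bialgebra_map_alg: "alg_map B A u"
    and bialgebra_map_closed: "x \<in> carr B \<Longrightarrow> u x \<in> carr A"
    and bialgebra_map_mult: "x \<in> carr B \<Longrightarrow> y \<in> carr B \<Longrightarrow> u (mult B x y) = mult A (u x) (u y)"
    and bialgebra_map_one: "u (one B) = one A"
    and bialgebra_map_comult: "x \<in> carr B \<Longrightarrow> comult A (u x) = tmap B B A A u u (comult B x)"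
    and bialgebra_map_counit: "x \<in> carr B \<Longrightarrow> counit A (u x) = counit B x"
  using assms
  by (auto simp: bialgebra_maps_def linear_maps_iff alg_map_def lin_closed)

text \<open>In the convolution algebra of linear maps from B to A, the composite of T followed by u
  is a left inverse of u, because u is multiplicative; u followed by \<Sigma> is a right inverse,
  because u is comultiplicative. Hence they coincide.\<close>

lemma bialgebra_map_antipode:
  assumes A: "is_bialgebra A" "is_antipode A \<Sigma>" and B: "is_bialgebra B" "is_antipode B T"
    and u: "u \<in> bialgebra_maps B A" and x: "x \<in> carr B"
  shows "u (T x) = \<Sigma> (u x)"
proof -
  have alg: "is_algebra A" using A(1) by simp
  let ?V = "convolution B A"
  note V = convolution_simps[OF B(1) alg] and VA = algebra_convolution[OF B(1) alg]
  have vA: "is_vspace A" and vB: "is_vspace B" using A B by simp_all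
  note lu = bialgebra_map_lin[OF u] and cu = bialgebra_map_closed[OF u]
    and lS = linear_maps_lin[OF antipode_linear[OF A]]
      and lT = linear_maps_lin[OF antipode_linear[OF B]]
    and cS = antipode_closed[OF A] and cT = antipode_closed[OF B]
  define f where "f = (\<lambda>x\<in>carr B. u (T x))"
  define g where "g = (\<lambda>x\<in>carr B. \<Sigma> (u x))"
  have f: "f \<in> linear_maps B A" unfolding f_def
    by (intro linear_maps_restrict vB lin_comp[OF lu] lT)
  have g: "g \<in> linear_maps B A" unfolding g_def
    by (intro linear_maps_restrict vB lin_comp[OF lS] lu)
  note u' = bialgebra_map_linear[OF u]
  have "mult ?V f u = one ?V"
  proof (rule linear_maps_ext[of _ B A])
    fix x assume x: "x \<in> carr B"
    have "u (tlift B B B (\<lambda>y z. mult B (T y) z) (comult B x)) =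
        tlift B B A (\<lambda>y z. u (mult B (T y) z)) (comult B x)"
      by (rule lin_tlift_eq) (use vA vB B x lu bilin_antipode_left[OF B] in simp_all)
    also have "\<dots> = tlift B B A (\<lambda>y z. mult A (f y) (u z)) (comult B x)"
    proof (rule tlift_cong[OF vB vB vA _ bilin_convolution[OF B(1) alg f u']])
      show "bilin B B A (\<lambda>y z. u (mult B (T y) z))"
        using bilin_antipode_left[OF B] lu by (simp add: bilin_def lin_def)
    qed (use B x in \<open>simp_all add: f_def cT bialgebra_map_mult[OF u]\<close>)
    finally show "mult ?V f u x = one ?V x"
      using x f u' B by (simp add: V antipode_left[OF B] lin_scal[OF lu] bialgebra_map_one[OF u])
  qed (use mult_closed[OF VA] one_closed[OF VA] f u' in \<open>simp_all add: V(1)\<close>)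
  moreover have "mult ?V u g = one ?V"
  proof (rule linear_maps_ext[of _ B A])
    fix x assume x: "x \<in> carr B"
    have "tlift B B A (\<lambda>y z. mult A (u y) (g z)) (comult B x) =
        tlift B B A (\<lambda>y z. mult A (u y) (\<Sigma> (u z))) (comult B x)"
    proof (rule tlift_cong[OF vB vB vA bilin_convolution[OF B(1) alg u' g]])
      show "bilin B B A (\<lambda>y z. mult A (u y) (\<Sigma> (u z)))"
        by (rule bilin_lin2[OF bilin_antipode_right[OF A] lu lu])
    qed (use B x in \<open>simp_all add: g_def\<close>)
    also have "\<dots> = tlift A A A (\<lambda>y z. mult A y (\<Sigma> z)) (tmap B B A A u u (comult B x))"
      by (rule tlift_tmap[symmetric]) (use vA vB B x lu bilin_antipode_right[OF A] in simp_all)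
    finally show "mult ?V u g x = one ?V x"
      using x g u' by (simp add: V antipode_right[OF A] cu bialgebra_map_counit[OF u]
          flip: bialgebra_map_comult[OF u])
  qed (use mult_closed[OF VA] one_closed[OF VA] g u' in \<open>simp_all add: V(1)\<close>)
  ultimately have "f = g"
    using f g u' by - (rule algebra_inverse_unique[OF VA, of _ u], simp_all add: V(1))
  then have "f x = g x" by simp
  then show ?thesis using x by (simp add: f_def g_def)
qed

lemma bialgebra_maps_id: "is_bialgebra A \<Longrightarrow> id_map A \<in> bialgebra_maps A A"
  by (simp add: bialgebra_maps_def id_map_linear tmap_id)

text \<open>Compatibility with bialgebra maps is applied to the identity, with one antipode chosen
  on the source and the other on the target.\<close>

lemma antipode_unique:
  assumes A: "is_bialgebra A" and S: "is_antipode A \<Sigma>" and S': "is_antipode A \<Sigma>'"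
  shows "\<Sigma> = \<Sigma>'"
proof (rule linear_maps_ext[OF antipode_linear[OF A S] antipode_linear[OF A S']])
  show "\<Sigma> x = \<Sigma>' x" if "x \<in> carr A" for x
    using bialgebra_map_antipode[OF A S' A S bialgebra_maps_id[OF A] that] antipode_closed[OF A S
      that] that
    by simp
qed

lemma antipode_eq: "is_bialgebra A \<Longrightarrow> is_antipode A \<Sigma> \<Longrightarrow> antipode A = \<Sigma>"
  unfolding antipode_def by (rule the_equality) (auto intro: antipode_unique)

lemma is_antipode_antipode: "is_hopf_algebra A \<Longrightarrow> is_antipode A (antipode A)"
  using antipode_eq unfolding is_hopf_algebra_def by metis

text \<open>Both sides of the identity are inverse to the multiplication in the algebra of bilinear maps
  \<open>A \<times> A \<rightarrow> A\<close> under convolution; currying turns that algebra into an iterated convolution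
  algebra, so that the coalgebra \<open>A \<otimes> A\<close> is not needed.\<close>

lemma antipode_mult:
  assumes A: "is_bialgebra A" and S: "is_antipode A \<Sigma>" and xy: "x \<in> carr A" "y \<in> carr A"
  shows "\<Sigma> (mult A x y) = mult A (\<Sigma> y) (\<Sigma> x)"
proof -
  have alg: "is_algebra A" and v: "is_vspace A" using A by simp_all
  let ?V = "convolution A A" and ?L = "linear_maps A A"
  note V = convolution_simps[OF A alg] and VA = algebra_convolution[OF A alg]
  let ?W = "convolution A ?V"
  note W = convolution_simps[OF A VA] and WA = algebra_convolution[OF A VA]
  have vV: "is_vspace ?V" using VA by simp
  note lS = linear_maps_lin[OF antipode_linear[OF A S]] and cS = antipode_closed[OF A S]
  \<comment> \<open>Currying: a bilinear map becomes an element of \<open>?W\<close>, sending x to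
    the linear map \<open>\<beta> x\<close>. The restriction at both levels supplies the
    extensionality demanded at each of them.\<close>
  define c where "c \<beta> = (\<lambda>x\<in>carr A. \<lambda>y\<in>carr A. \<beta> x y)" for \<beta> :: "'b \<Rightarrow> 'b \<Rightarrow> 'b"
  have c_app: "c \<beta> x y = \<beta> x y" if "x \<in> carr A" "y \<in> carr A" for \<beta> x y using that
    by (simp add: c_def)
  have cV: "c \<beta> x \<in> ?L" if "bilin A A A \<beta>" "x \<in> carr A" for \<beta> x
    using that linear_maps_restrict[OF v, of A "\<beta> x"] by (simp add: bilin_def c_def)
  have cW: "c \<beta> \<in> carr ?W" if "bilin A A A \<beta>" for \<beta>
  proof -
    have "lin A ?V (c \<beta>)"
    proof (rule lin_convolutionI[OF A alg])
      show "lin A A (\<lambda>x. c \<beta> x y)" if "y \<in> carr A" for y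
        by (rule lin_cong[THEN iffD2, where g1 = "\<lambda>x. \<beta> x y", OF _ v])
          (use \<open>bilin A A A \<beta>\<close> that in \<open>simp_all add: c_app bilin_def\<close>)
    qed (use cV that v in simp_all)
    then show ?thesis by (simp add: W(1) linear_maps_iff) (simp add: c_def)
  qed
  have ev: "lin ?V A (\<lambda>f. f y)" if "y \<in> carr A" for y
  proof -
    have "f y \<in> carr A" if "f \<in> ?L" for f
      using lin_closed[OF linear_maps_lin[OF that] \<open>y \<in> carr A\<close>] .
    then show ?thesis using that by (intro linI) (simp_all add: V)
  qed
  have bm1: "bilin A A A (\<lambda>y1 y2. mult A (\<beta> x1 y1) (\<gamma> x2 y2))"
    if "bilin A A A \<beta>" "bilin A A A \<gamma>" "x1 \<in> carr A" "x2 \<in> carr A" for \<beta> \<gamma> x1 x2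
    by (rule bilin_lin2[OF bilin_mult[OF alg]]) (use that in \<open>simp_all add: bilin_def\<close>)
  have bm2: "bilin A A A (\<lambda>x1 x2. mult A (\<beta> x1 y1) (\<gamma> x2 y2))"
    if "bilin A A A \<beta>" "bilin A A A \<gamma>" "y1 \<in> carr A" "y2 \<in> carr A" for \<beta> \<gamma> y1 y2
    by (rule bilin_lin2[OF bilin_mult[OF alg]]) (use that in \<open>simp_all add: bilin_def\<close>)
  \<comment> \<open>The product of the iterated algebra is convolution over both variables at once,
    the sum of \<beta>(x_1, y_1) \<gamma>(x_2, y_2).\<close>
  have prod: "mult ?W (c \<beta>) (c \<gamma>) x y =
      tlift A A A (\<lambda>x1 x2. tlift A A A (\<lambda>y1 y2. mult A (\<beta> x1 y1) (\<gamma> x2 y2)) (comult A y)) (comult A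
        x)"
    if \<beta>: "bilin A A A \<beta>" and \<gamma>: "bilin A A A \<gamma>" and x: "x \<in> carr A" and y: "y \<in> carr A" for \<beta> \<gamma> x y
  proof -
    have cm: "c \<beta> \<in> linear_maps A ?V" "c \<gamma> \<in> linear_maps A ?V" using cW \<beta> \<gamma> by (simp_all add: W(1))
    have b: "bilin A A ?V (\<lambda>y z. mult ?V (c \<beta> y) (c \<gamma> z))" by (rule bilin_convolution[OF A VA cm])
    note b' = bm1[OF \<beta> \<gamma>] and b'' = bm2[OF \<beta> \<gamma>]
    have "mult ?W (c \<beta>) (c \<gamma>) x y = tlift A A ?V (\<lambda>y z. mult ?V (c \<beta> y) (c \<gamma> z)) (comult A x) y"
      using cm x by (simp add: W)
    also have "\<dots> = tlift A A A (\<lambda>x1 x2. mult ?V (c \<beta> x1) (c \<gamma> x2) y) (comult A x)"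
      by (rule lin_tlift_eq[of A A ?V A _ "\<lambda>f. f y"]) (use v vV b ev[OF y] A x in simp_all)
    also have "\<dots> = tlift A A A (\<lambda>x1 x2. tlift A A A (\<lambda>y1 y2. mult A (\<beta> x1 y1) (\<gamma> x2 y2)) (comult A
        y))
        (comult A x)"
    proof (rule tlift_cong[OF v v v])
      show "bilin A A A (\<lambda>x1 x2. mult ?V (c \<beta> x1) (c \<gamma> x2) y)"
        using b ev[OF y] by (simp add: bilin_def lin_def)
      show "bilin A A A (\<lambda>x1 x2. tlift A A A (\<lambda>y1 y2. mult A (\<beta> x1 y1) (\<gamma> x2 y2)) (comult A y))"
        by (intro bilinI lin_tlift_parameter) (use v b' b'' A y in \<open>auto simp: bilin_def\<close>)
      show "mult ?V (c \<beta> x1) (c \<gamma> x2) y = tlift A A A (\<lambda>y1 y2. mult A (\<beta> x1 y1) (\<gamma> x2 y2)) (comult A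
          y)"
        if x12: "x1 \<in> carr A" "x2 \<in> carr A" for x1 x2
      proof -
        have "mult ?V (c \<beta> x1) (c \<gamma> x2) y = tlift A A A (\<lambda>y1 y2. mult A (c \<beta> x1 y1) (c \<gamma> x2 y2))
            (comult A y)"
          using x12 cV \<beta> \<gamma> y by (simp add: V)
        also have "\<dots> = tlift A A A (\<lambda>y1 y2. mult A (\<beta> x1 y1) (\<gamma> x2 y2)) (comult A y)"
          by (rule tlift_cong[OF v v v bilin_convolution[OF A alg]])
            (use x12 cV \<beta> \<gamma> b' A y in \<open>simp_all add: c_app\<close>)
        finally show ?thesis .
      qed
    qed (use A x in simp)
    finally show ?thesis .
  qed
  have one: "one ?W x y = scal A (counit A x) (scal A (counit A y) (one A))"
    if "x \<in> carr A" "y \<in> carr A" for x y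
    using that one_closed[OF VA] by (simp add: W V)
  \<comment> \<open>An element of \<open>?W\<close> is a map valued in maps, so extensionality is
    applied twice.\<close>
  have extW: "f = g" if f: "f \<in> carr ?W" and g: "g \<in> carr ?W"
    and "\<And>x y. x \<in> carr A \<Longrightarrow> y \<in> carr A \<Longrightarrow> f x y = g x y" for f g
  proof (rule linear_maps_ext[of f A ?V g])
    have "f x \<in> ?L" "g x \<in> ?L" if "x \<in> carr A" for x
      using lin_closed[OF linear_maps_lin[OF f[unfolded W(1)]] that]
        lin_closed[OF linear_maps_lin[OF g[unfolded W(1)]] that] by (simp_all add: V(1))
    then show "f x = g x" if "x \<in> carr A" for x
      using that \<open>\<And>x y. x \<in> carr A \<Longrightarrow> y \<in> carr A \<Longrightarrow> f x y = g x y\<close>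
        by (intro linear_maps_ext[of _ A A]) simp_all
  qed (use f g in \<open>simp_all add: W(1)\<close>)
  let ?N = "\<lambda>x y. \<Sigma> (mult A x y)" and ?P = "\<lambda>x y. mult A (\<Sigma> y) (\<Sigma> x)"
  have bN: "bilin A A A ?N"
    by (intro bilinI lin_comp[OF lS] lin_mult_left lin_mult_right lin_ident alg)
  have bP: "bilin A A A ?P"
    by (intro bilinI lin_mult_left lin_mult_right lS alg cS)
  have bM: "bilin A A A (mult A)" by (rule bilin_mult[OF alg])
  \<comment> \<open>The sum of \<Sigma>(x_1 y_1) x_2 y_2 is the left antipode axiom at the element x
    y, because \<Delta> is multiplicative.\<close>
  have 1: "mult ?W (c ?N) (c (mult A)) = one ?W"
  proof (rule extW)
    fix x y assume x: "x \<in> carr A" and y: "y \<in> carr A"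
    have "mult ?W (c ?N) (c (mult A)) x y =
        tlift A A A (\<lambda>a b. mult A (\<Sigma> a) b) (mult (tensor_algebra A A) (comult A x) (comult A y))"
      unfolding prod[OF bN bM x y]
    proof (rule tensor_bilin_eqI[where V = A and W = A and V' = A and W' = A and Z = A
        and t = "comult A x" and t' = "comult A y"
        and f = "\<lambda>t s. tlift A A A (\<lambda>x1 x2. tlift A A A (\<lambda>y1 y2. mult A (?N x1 y1) (mult A x2 y2))
            s) t"
        and g = "\<lambda>t s. tlift A A A (\<lambda>a b. mult A (\<Sigma> a) b) (mult (tensor_algebra A A) t s)"])
      note q1 = bm1[OF bN bM] and q2 = bm2[OF bN bM]
      show "bilin (tensor A A) (tensor A A) A
          (\<lambda>t s. tlift A A A (\<lambda>x1 x2. tlift A A A (\<lambda>y1 y2. mult A (?N x1 y1) (mult A x2 y2)) s) t)"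
        by (rule bilin_tlift2) (use v q1 q2 in simp_all)
      fix a b c d assume abcd: "a \<in> carr A" "b \<in> carr A" "c \<in> carr A" "d \<in> carr A"
      have "tlift A A A (\<lambda>x1 x2. tlift A A A (\<lambda>y1 y2. mult A (?N x1 y1) (mult A x2 y2)) (tpure A A c
          d))
          (tpure A A a b) = mult A (?N a c) (mult A b d)"
        by (rule tlift2_tpure) (use v q1 q2 abcd in simp_all)
      also have "\<dots> = tlift A A A (\<lambda>a b. mult A (\<Sigma> a) b) (mult (tensor_algebra A A) (tpure A A a b)
          (tpure A A c d))"
        using abcd alg bilin_antipode_left[OF A S] by simp
      finally show "tlift A A A (\<lambda>x1 x2. tlift A A A (\<lambda>y1 y2. mult A (?N x1 y1) (mult A x2 y2))
          (tpure A A c d))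
          (tpure A A a b) =
        tlift A A A (\<lambda>a b. mult A (\<Sigma> a) b) (mult (tensor_algebra A A) (tpure A A a b) (tpure A A c
          d))" .
    next
      show "bilin (tensor A A) (tensor A A) A
          (\<lambda>t s. tlift A A A (\<lambda>a b. mult A (\<Sigma> a) b) (mult (tensor_algebra A A) t s))"
        using bilin_tensor_mult[OF alg alg] lin_tlift[OF v v v bilin_antipode_left[OF A S]]
        by (simp add: bilin_def lin_def)
    qed (use v A x y in simp_all)
    also have "\<dots> = one ?W x y"
      using x y A by (simp add: one antipode_left[OF A S] counit_mult vs_scal_scal flip:
        comult_mult)
    finally show "mult ?W (c ?N) (c (mult A)) x y = one ?W x y" .
  qed (use mult_closed[OF WA cW[OF bN] cW[OF bM]] one_closed[OF WA] in simp_all)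
  \<comment> \<open>In the sum of x_1 y_1 \<Sigma>(y_2) \<Sigma>(x_2) the right antipode axiom at y
    collapses the inner part to the scalar \<epsilon>(y); what remains is the same axiom at
    x.\<close>
  have 2: "mult ?W (c (mult A)) (c ?P) = one ?W"
  proof (rule extW)
    fix x y assume x: "x \<in> carr A" and y: "y \<in> carr A"
    have inner: "tlift A A A (\<lambda>y1 y2. mult A (mult A a y1) (mult A (\<Sigma> y2) (\<Sigma> b))) (comult A y) =
        scal A (counit A y) (mult A a (\<Sigma> b))" if a: "a \<in> carr A" and b: "b \<in> carr A" for a b
    proof -
      let ?g = "\<lambda>z. mult A a (mult A z (\<Sigma> b))"
      have g: "lin A A ?g" by (intro lin_mult_right lin_mult_left lin_ident alg a cS b)
      have "tlift A A A (\<lambda>y1 y2. mult A (mult A a y1) (mult A (\<Sigma> y2) (\<Sigma> b))) (comult A y) =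
          tlift A A A (\<lambda>y1 y2. ?g (mult A y1 (\<Sigma> y2))) (comult A y)"
      proof (rule tlift_cong[OF v v v])
        show "bilin A A A (\<lambda>y1 y2. mult A (mult A a y1) (mult A (\<Sigma> y2) (\<Sigma> b)))"
          by (auto intro!: lin_alg lS simp: alg a b cS)
        show "bilin A A A (\<lambda>y1 y2. ?g (mult A y1 (\<Sigma> y2)))"
          by (auto intro!: lin_alg lS simp: alg a b cS)
      qed (use a b A y alg in \<open>simp_all add: mult_assoc cS\<close>)
      also have "\<dots> = ?g (tlift A A A (\<lambda>y1 y2. mult A y1 (\<Sigma> y2)) (comult A y))"
        by (rule lin_tlift_eq[symmetric]) (use v g A y bilin_antipode_right[OF A S] in simp_all)
      also have "\<dots> = scal A (counit A y) (mult A a (\<Sigma> b))"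
        using y a b alg by (simp add: antipode_right[OF A S] cS mult_scal_left mult_scal_right)
      finally show ?thesis .
    qed
    let ?s = "\<lambda>z. scal A (counit A y) z"
    have s: "lin A A ?s" by (intro lin_scalar lin_ident v)
    have "mult ?W (c (mult A)) (c ?P) x y = tlift A A A (\<lambda>a b. ?s (mult A a (\<Sigma> b))) (comult A x)"
      unfolding prod[OF bM bP x y]
    proof (rule tlift_cong[OF v v v])
      show "bilin A A A (\<lambda>x1 x2. tlift A A A (\<lambda>y1 y2. mult A (mult A x1 y1) (?P x2 y2)) (comult A
          y))"
        by (intro bilinI lin_tlift_parameter) (use v A y bm1[OF bM bP] bm2[OF bM bP] in \<open>auto simp:
          bilin_def\<close>)
      show "bilin A A A (\<lambda>a b. ?s (mult A a (\<Sigma> b)))"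
        using bilin_antipode_right[OF A S] s by (simp add: bilin_def lin_def)
    qed (use inner A x in simp_all)
    also have "\<dots> = ?s (tlift A A A (\<lambda>a b. mult A a (\<Sigma> b)) (comult A x))"
      by (rule lin_tlift_eq[symmetric]) (use v s A x bilin_antipode_right[OF A S] in simp_all)
    also have "\<dots> = one ?W x y"
      using x y alg by (simp add: one antipode_right[OF A S] vs_scal_scal mult.commute)
    finally show "mult ?W (c (mult A)) (c ?P) x y = one ?W x y" .
  qed (use mult_closed[OF WA cW[OF bM] cW[OF bP]] one_closed[OF WA] in simp_all)
  have "c ?N = c ?P"
    by (rule algebra_inverse_unique[OF WA cW[OF bN] cW[OF bM] cW[OF bP] 1 2])
  then have "c ?N x y = c ?P x y" by simp
  then show ?thesis using xy by (simp add: c_app)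
qed

section \<open>Bimodules\<close>

lemma same_vspace_unitI: "same_vspace (unitI B) B"
  by (simp add: same_vspace_def unitI_def vspace.defs)

lemma same_vspace_unitJ: "same_vspace (unitJ B) ground"
  by (simp add: same_vspace_def unitJ_def vspace.defs)

lemma same_vspace_bullet: "same_vspace (bullet B X Y) (tensor X Y)"
  by (simp add: same_vspace_def bullet_def vspace.defs)

lemma same_vspace_reversion: "same_vspace (reversion B X) X"
  by (simp add: same_vspace_def reversion_def vspace.defs)

lemma same_vspace_circ:
  "same_vspace (circ B X Y) (quotient_space (carr X) (carr Y) (cnull B X Y))"
  by (simp add: same_vspace_def circ_def vspace.defs Let_def)

lemmas bimodule_vspace [simp] = same_vspace_simps[OF same_vspace_unitI]
  same_vspace_simps[OF same_vspace_unitJ] same_vspace_simps[OF same_vspace_bullet]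
  same_vspace_simps[OF same_vspace_reversion]

lemma lact_unitI [simp]: "lact (unitI B) = mult B" and ract_unitI [simp]: "ract (unitI B) = mult B"
  by (simp_all add: unitI_def vspace.defs bimodule.defs)

lemma
  assumes "b \<in> carr B"
  shows lact_unitJ [simp]: "lact (unitJ B) b c = counit B b * c"
    and ract_unitJ [simp]: "ract (unitJ B) c b = c * counit B b"
  using assms by (simp_all add: unitJ_def vspace.defs bimodule.defs)

lemma
  assumes "b \<in> carr B" "t \<in> carr (tensor X Y)"
  shows lact_bullet: "lact (bullet B X Y) b t = lact2 B X Y (comult B b) t"
    and ract_bullet: "ract (bullet B X Y) t b = ract2 B X Y t (comult B b)"
  using assms by (simp_all add: bullet_def vspace.defs bimodule.defs)

lemma
  assumes "b \<in> carr B" "x \<in> carr X"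
  shows lact_reversion: "lact (reversion B X) b x = ract X x (antipode B b)"
    and ract_reversion: "ract (reversion B X) x b = lact X (antipode B b) x"
  using assms by (simp_all add: reversion_def vspace.defs bimodule.defs)

text \<open>Bilinearity of the two actions, the input to the universal property of
  \<open>circ\<close>. Being weaker than \<open>is_bimodule\<close>, it is quickly checked for
  objects such as \<open>bullet B X Y\<close> or \<open>circ B X Y\<close>.\<close>

definition acts :: "('k::field, 'b) bialgebra \<Rightarrow> ('k, 'b, 'x, 'r) bimodule_scheme \<Rightarrow> bool" where
  "acts B X \<longleftrightarrow> is_vspace X \<and> bilin B X X (lact X) \<and> bilin X B X (ract X)"

lemma
  assumes "acts B X"
  shows vspace_acts [simp]: "is_vspace X"
    and lact_closed [simp]: "b \<in> carr B \<Longrightarrow> x \<in> carr X \<Longrightarrow> lact X b x \<in> carr X"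
    and ract_closed [simp]: "b \<in> carr B \<Longrightarrow> x \<in> carr X \<Longrightarrow> ract X x b \<in> carr X"
    and bilin_lact: "bilin B X X (lact X)"
    and bilin_ract: "bilin X B X (ract X)"
  using assms by (simp_all add: acts_def bilin_closed[of B X X] bilin_closed[of X B X])

lemma
  assumes "acts B X"
  shows lin_lact_left: "lin U B f \<Longrightarrow> x \<in> carr X \<Longrightarrow> lin U X (\<lambda>u. lact X (f u) x)"
    and lin_lact_right: "lin U X g \<Longrightarrow> b \<in> carr B \<Longrightarrow> lin U X (\<lambda>u. lact X b (g u))"
    and lin_ract_left: "lin U X g \<Longrightarrow> b \<in> carr B \<Longrightarrow> lin U X (\<lambda>u. ract X (g u) b)"
    and lin_ract_right: "lin U B f \<Longrightarrow> x \<in> carr X \<Longrightarrow> lin U X (\<lambda>u. ract X x (f u))"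
  by (fact bilin_left[OF bilin_lact[OF assms]] bilin_right[OF bilin_lact[OF assms]]
      bilin_left[OF bilin_ract[OF assms]] bilin_right[OF bilin_ract[OF assms]])+

lemma
  assumes "is_bimodule B X" "is_vspace B"
  shows acts_bimodule: "acts B X"
    and lact_one: "x \<in> carr X \<Longrightarrow> lact X (one B) x = x"
    and ract_one: "x \<in> carr X \<Longrightarrow> ract X x (one B) = x"
    and lact_mult: "b \<in> carr B \<Longrightarrow> b' \<in> carr B \<Longrightarrow> x \<in> carr X \<Longrightarrow> lact X (mult B b b') x =
        lact X b (lact X b' x)"
    and ract_mult: "b \<in> carr B \<Longrightarrow> b' \<in> carr B \<Longrightarrow> x \<in> carr X \<Longrightarrow> ract X x (mult B b b') =
        ract X (ract X x b) b'"
    and lact_ract: "b \<in> carr B \<Longrightarrow> b' \<in> carr B \<Longrightarrow> x \<in> carr X \<Longrightarrow> ract X (lact X b x) b' =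
        lact X b (ract X x b')"
proof -
  have "is_vspace X" using assms by (simp add: is_bimodule_def)
  with assms show "acts B X" by (simp add: is_bimodule_def acts_def bilinear_maps_iff)
qed (use assms in \<open>simp_all add: is_bimodule_def\<close>)

lemma acts_unitI: "is_algebra B \<Longrightarrow> acts B (unitI B)"
  by (simp add: acts_def bilin_mult)

lemma acts_unitJ: "is_bialgebra B \<Longrightarrow> acts B (unitJ B)"
  using lin_counit[of B] by (simp add: acts_def bilin_def lin_def algebra_simps)

subsection \<open>The tensor product over \<open>B\<close>\<close>

definition balanced ::
  "('k::field, 'b) bialgebra \<Rightarrow> ('k, 'b, 'x, 'r) bimodule_scheme \<Rightarrow> ('k, 'b, 'y, 's) bimodule_scheme
    \<Rightarrow> ('x \<Rightarrow> 'y \<Rightarrow> 'z) \<Rightarrow> bool" where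
  "balanced B X Y \<phi> \<longleftrightarrow> (\<forall>x\<in>carr X. \<forall>b\<in>carr B. \<forall>y\<in>carr Y. \<phi> (ract X x b) y = \<phi> x (lact Y b y))"

lemma supported_cnull:
  assumes "acts B X" "acts B Y"
  shows "supported_subspace (carr X) (carr Y) (cnull B X Y)"
  unfolding cnull_def
proof (rule supported_subspace_span, elim UnE)
  fix r assume "r \<in> bilinearity_relations X Y"
  then show "Poly_Mapping.keys r \<subseteq> carr X \<times> carr Y"
    using assms by (intro keys_bilinearity_relations) simp_all
next
  fix r assume "r \<in> {gen (ract X x b) y - gen x (lact Y b y) |x b y. x \<in> carr X \<and> b \<in> carr B \<and> y \<in>
      carr Y}"
  then show "Poly_Mapping.keys r \<subseteq> carr X \<times> carr Y"
    using assms
    by (auto simp: in_keys_iff lookup_minus lookup_single when_def split: if_splits)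
qed

lemma
  assumes X: "acts B X" and Y: "acts B Y"
  shows vspace_circ [simp]: "is_vspace (circ B X Y)"
    and cpure_closed [simp]: "x \<in> carr X \<Longrightarrow> y \<in> carr Y \<Longrightarrow> cpure B X Y x y \<in> carr (circ B X Y)"
    and bilin_cpure: "bilin X Y (circ B X Y) (cpure B X Y)"
    and cpure_balanced: "x \<in> carr X \<Longrightarrow> b \<in> carr B \<Longrightarrow> y \<in> carr Y \<Longrightarrow>
      cpure B X Y (ract X x b) y = cpure B X Y x (lact Y b y)"
    and circ_eqI: "is_vspace Z \<Longrightarrow> lin (circ B X Y) Z f \<Longrightarrow> lin (circ B X Y) Z g \<Longrightarrow>
      (\<And>x y. x \<in> carr X \<Longrightarrow> y \<in> carr Y \<Longrightarrow> f (cpure B X Y x y) = g (cpure B X Y x y)) \<Longrightarrow>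
      t \<in> carr (circ B X Y) \<Longrightarrow> f t = g t"
proof -
  note q = same_vspace_simps[OF same_vspace_circ] and N = supported_cnull[OF X Y]
  show "is_vspace (circ B X Y)" by (simp add: q vspace_quotient N)
  show "x \<in> carr X \<Longrightarrow> y \<in> carr Y \<Longrightarrow> cpure B X Y x y \<in> carr (circ B X Y)"
    by (simp add: q cpure_def coset_gen_closed)
  show "bilin X Y (circ B X Y) (cpure B X Y)"
    unfolding q cpure_def cnull_def using X Y by (intro bilin_coset_gen) auto
  have "gen (ract X x b) y - gen x (lact Y b y) \<in> cnull B X Y"
    if "x \<in> carr X" "b \<in> carr B" "y \<in> carr Y"
    using that unfolding cnull_def by (intro fs.span_base UnI2) blast
  moreover have "fs.subspace (cnull B X Y)" unfolding cnull_def by simp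
  ultimately show "cpure B X Y (ract X x b) y = cpure B X Y x (lact Y b y)"
    if "x \<in> carr X" "b \<in> carr B" "y \<in> carr Y"
    using that by (simp add: cpure_def coset_eq_iff)
  show "f t = g t" if "is_vspace Z" "lin (circ B X Y) Z f" "lin (circ B X Y) Z g"
    "\<And>x y. x \<in> carr X \<Longrightarrow> y \<in> carr Y \<Longrightarrow> f (cpure B X Y x y) = g (cpure B X Y x y)"
    "t \<in> carr (circ B X Y)"
    by (rule quotient_lin_eqI[OF N that(5)[unfolded q] that(1) that(2)[unfolded q]
      that(3)[unfolded q]])
      (use that(4) in \<open>simp add: cpure_def\<close>)
qed

lemma
  assumes X: "acts B X" and Y: "acts B Y" and Z: "is_vspace Z"
    and \<phi>: "bilin X Y Z \<phi>" "balanced B X Y \<phi>"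
  shows clift_linear_maps: "clift B X Y Z \<phi> \<in> linear_maps (circ B X Y) Z"
    and clift_cpure [simp]: "x \<in> carr X \<Longrightarrow> y \<in> carr Y \<Longrightarrow> clift B X Y Z \<phi> (cpure B X Y x y) = \<phi> x y"
proof -
  note q = same_vspace_simps[OF same_vspace_circ]
  have "clift B X Y Z \<phi> \<in> linear_maps (circ B X Y) Z \<and>
      (\<forall>x\<in>carr X. \<forall>y\<in>carr Y. clift B X Y Z \<phi> (cpure B X Y x y) = \<phi> x y)"
    unfolding clift_def q cpure_def cnull_def
  proof (rule induced_universal)
    fix \<psi> :: "_ \<Rightarrow> _" assume \<psi>: "\<And>i. \<psi> i \<in> carr Z" "\<And>x y. x \<in> carr X \<Longrightarrow> y \<in> carr Y \<Longrightarrow> \<psi> (x, y) = \<phi> x y"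
    have "lext Z \<psi> r = zero Z" if "r \<in> bilinearity_relations X Y" for r
      by (rule lext_bilinearity_relations[OF _ _ Z \<phi>(1) \<psi> that]) (use X Y in simp_all)
    moreover have "lext Z \<psi> (gen (ract X x b) y - gen x (lact Y b y)) = zero Z"
      if "x \<in> carr X" "b \<in> carr B" "y \<in> carr Y" for x b y
      by (rule lext_diff[where Z = Z and \<phi> = \<psi>, OF Z \<psi>(1)])
        (use that X Y Z \<psi> \<phi>(2) in \<open>simp add: balanced_def bilin_closed[OF \<phi>(1)]\<close>)
    ultimately show "\<forall>r\<in>bilinearity_relations X Y \<union> {gen (ract X x b) y - gen x (lact Y b y) |x b y.
        x \<in> carr X \<and> b \<in> carr B \<and> y \<in> carr Y}. lext Z \<psi> r = zero Z" by blast
  qed (use supported_cnull[OF X Y] Z bilin_closed[OF \<phi>(1)] in \<open>simp_all add: cnull_def\<close>)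
  then show "clift B X Y Z \<phi> \<in> linear_maps (circ B X Y) Z"
    "x \<in> carr X \<Longrightarrow> y \<in> carr Y \<Longrightarrow> clift B X Y Z \<phi> (cpure B X Y x y) = \<phi> x y" by blast+
qed

lemma lin_clift:
  "acts B X \<Longrightarrow> acts B Y \<Longrightarrow> is_vspace Z \<Longrightarrow> bilin X Y Z \<phi> \<Longrightarrow> balanced B X Y \<phi> \<Longrightarrow>
    lin (circ B X Y) Z (clift B X Y Z \<phi>)"
  by (intro linear_maps_lin clift_linear_maps)

lemma clift_same_vspace: "same_vspace Z Z' \<Longrightarrow> clift B X Y Z = clift B X Y Z'"
  unfolding clift_def[abs_def] induced_def by (simp only: same_vspace_simps(12))

lemma lin_clift_parameter:
  assumes "is_vspace U" "acts B X" "acts B Y" "is_vspace Z"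
    and "\<And>u. u \<in> carr U \<Longrightarrow> bilin X Y Z (\<lambda>x y. \<phi> u x y)"
    and "\<And>u. u \<in> carr U \<Longrightarrow> balanced B X Y (\<lambda>x y. \<phi> u x y)"
    and "\<And>x y. x \<in> carr X \<Longrightarrow> y \<in> carr Y \<Longrightarrow> lin U Z (\<lambda>u. \<phi> u x y)"
    and "t \<in> carr (circ B X Y)"
  shows "lin U Z (\<lambda>u. clift B X Y Z (\<lambda>x y. \<phi> u x y) t)"
proof (rule lin_parameter[where T = "circ B X Y" and A = "carr X" and C = "carr Y"
  and p = "cpure B X Y"])
  show "lin U Z (\<lambda>u. clift B X Y Z (\<lambda>x y. \<phi> u x y) (cpure B X Y x y))"
    if "x \<in> carr X" "y \<in> carr Y" for x y
    using assms that by (subst lin_cong[where g = "\<lambda>u. \<phi> u x y"]) auto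
qed (use assms in \<open>auto intro: circ_eqI lin_clift\<close>)

lemma lin_cpure_left:
  "acts B X \<Longrightarrow> acts B Y \<Longrightarrow> lin U X f \<Longrightarrow> y \<in> carr Y \<Longrightarrow> lin U (circ B X Y) (\<lambda>x. cpure B X Y (f x) y)"
  by (intro bilin_left[OF bilin_cpure])

lemma lin_cpure_right:
  "acts B X \<Longrightarrow> acts B Y \<Longrightarrow> lin U Y f \<Longrightarrow> y \<in> carr X \<Longrightarrow> lin U (circ B X Y) (\<lambda>x. cpure B X Y y (f x))"
  by (intro bilin_right[OF bilin_cpure])

lemmas lin_mod = lin_bialg lin_cpure_left lin_cpure_right
  lin_lact_left lin_lact_right lin_ract_left lin_ract_right

text \<open>The left action on the factor X respects the balancing relations because it commutes
  with the right action of X, and symmetrically for the right action on Y. This makes the lifts that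
  define the actions meaningful.\<close>

lemma
  assumes B: "is_bialgebra B" and X: "is_bimodule B X" and Y: "is_bimodule B Y"
  shows lact_circ: "b \<in> carr B \<Longrightarrow> x \<in> carr X \<Longrightarrow> y \<in> carr Y \<Longrightarrow>
      lact (circ B X Y) b (cpure B X Y x y) = cpure B X Y (lact X b x) y"
    and ract_circ: "b \<in> carr B \<Longrightarrow> x \<in> carr X \<Longrightarrow> y \<in> carr Y \<Longrightarrow>
      ract (circ B X Y) (cpure B X Y x y) b = cpure B X Y x (ract Y y b)"
    and acts_circ: "acts B (circ B X Y)"
proof -
  let ?T = "circ B X Y"
  have vB: "is_vspace B" using B by simp
  note aX = acts_bimodule[OF X vB] and aY = acts_bimodule[OF Y vB]
  note T = clift_same_vspace[OF same_vspace_circ]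
  note c = cpure_balanced[OF aX aY]
  have L: "lact ?T b t = clift B X Y ?T (\<lambda>x y. cpure B X Y (lact X b x) y) t"
    and R: "ract ?T t b = clift B X Y ?T (\<lambda>x y. cpure B X Y x (ract Y y b)) t"
    if "b \<in> carr B" "t \<in> carr ?T" for b t
    using that unfolding T same_vspace_simps(1)[OF same_vspace_circ]
    by (simp_all add: circ_def vspace.defs bimodule.defs Let_def)
  have bL: "bilin X Y ?T (\<lambda>x y. cpure B X Y (lact X b x) y)"
    and bR: "bilin X Y ?T (\<lambda>x y. cpure B X Y x (ract Y y b))"
    and cL: "balanced B X Y (\<lambda>x y. cpure B X Y (lact X b x) y)"
    and cR: "balanced B X Y (\<lambda>x y. cpure B X Y x (ract Y y b))"
    if b: "b \<in> carr B" for b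
  proof -
    show "bilin X Y ?T (\<lambda>x y. cpure B X Y (lact X b x) y)"
      "bilin X Y ?T (\<lambda>x y. cpure B X Y x (ract Y y b))"
      using b aX aY by (auto intro!: lin_mod)
    show "balanced B X Y (\<lambda>x y. cpure B X Y (lact X b x) y)"
      using b aX aY by (simp add: balanced_def flip: lact_ract[OF X vB] c)
    show "balanced B X Y (\<lambda>x y. cpure B X Y x (ract Y y b))"
      using b aX aY by (simp add: balanced_def c lact_ract[OF Y vB])
  qed
  show "lact ?T b (cpure B X Y x y) = cpure B X Y (lact X b x) y"
    "ract ?T (cpure B X Y x y) b = cpure B X Y x (ract Y y b)"
    if "b \<in> carr B" "x \<in> carr X" "y \<in> carr Y"
    using that aX aY by (simp_all add: L R bL bR cL cR)
  have "bilin B ?T ?T (\<lambda>b t. clift B X Y ?T (\<lambda>x y. cpure B X Y (lact X b x) y) t)"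
  proof (rule bilinI)
    show "lin ?T ?T (\<lambda>t. clift B X Y ?T (\<lambda>x y. cpure B X Y (lact X b x) y) t)" if "b \<in> carr B" for b
      by (rule lin_clift) (use that aX aY bL cL in simp_all)
    show "lin B ?T (\<lambda>b. clift B X Y ?T (\<lambda>x y. cpure B X Y (lact X b x) y) t)" if "t \<in> carr ?T" for t
      by (rule lin_clift_parameter) (use that vB aX aY bL cL in \<open>auto intro!: lin_mod\<close>)
  qed
  then have 1: "bilin B ?T ?T (lact ?T)"
    by (rule bilin_cong[THEN iffD1, rotated 3]) (simp_all add: L vB aX aY)
  have "bilin ?T B ?T (\<lambda>t b. clift B X Y ?T (\<lambda>x y. cpure B X Y x (ract Y y b)) t)"
  proof (rule bilinI)
    show "lin ?T ?T (\<lambda>t. clift B X Y ?T (\<lambda>x y. cpure B X Y x (ract Y y b)) t)" if "b \<in> carr B" for b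
      by (rule lin_clift) (use that aX aY bR cR in simp_all)
    show "lin B ?T (\<lambda>b. clift B X Y ?T (\<lambda>x y. cpure B X Y x (ract Y y b)) t)" if "t \<in> carr ?T" for t
      by (rule lin_clift_parameter) (use that vB aX aY bR cR in \<open>auto intro!: lin_mod\<close>)
  qed
  then have 2: "bilin ?T B ?T (ract ?T)"
    by (rule bilin_cong[THEN iffD1, rotated 3]) (simp_all add: R vB aX aY)
  show "acts B ?T" using 1 2 aX aY by (simp add: acts_def)
qed

lemma
  assumes "acts B X" "acts B Y" "acts B X'" "acts B Y'" "lin X X' f" "lin Y Y' g"
    and "\<And>b x. b \<in> carr B \<Longrightarrow> x \<in> carr X \<Longrightarrow> f (ract X x b) = ract X' (f x) b"
    and "\<And>b y. b \<in> carr B \<Longrightarrow> y \<in> carr Y \<Longrightarrow> g (lact Y b y) = lact Y' b (g y)"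
  shows lin_cmap: "lin (circ B X Y) (circ B X' Y') (cmap B X Y X' Y' f g)"
    and cmap_cpure: "x \<in> carr X \<Longrightarrow> y \<in> carr Y \<Longrightarrow>
      cmap B X Y X' Y' f g (cpure B X Y x y) = cpure B X' Y' (f x) (g y)"
proof -
  have b: "bilin X Y (circ B X' Y') (\<lambda>x y. cpure B X' Y' (f x) (g y))"
    by (rule bilin_lin2[OF bilin_cpure]) (use assms in simp_all)
  have c: "balanced B X Y (\<lambda>x y. cpure B X' Y' (f x) (g y))"
    using assms(7,8)
      by (simp add: balanced_def cpure_balanced[OF assms(3,4)] lin_closed[OF assms(5)]
        lin_closed[OF assms(6)])
  show "lin (circ B X Y) (circ B X' Y') (cmap B X Y X' Y' f g)"
    unfolding cmap_def by (rule lin_clift) (use assms b c in simp_all)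
  show "cmap B X Y X' Y' f g (cpure B X Y x y) = cpure B X' Y' (f x) (g y)"
    if "x \<in> carr X" "y \<in> carr Y" using that assms b c by (simp add: cmap_def)
qed

lemma
  assumes B: "is_bialgebra B" and X: "is_bimodule B X" and Y: "is_bimodule B Y"
    and Z: "is_bimodule B Z"
  shows lin_cassoc: "lin (circ B (circ B X Y) Z) (circ B X (circ B Y Z)) (cassoc B X Y Z)"
    and cassoc_cpure: "x \<in> carr X \<Longrightarrow> y \<in> carr Y \<Longrightarrow> z \<in> carr Z \<Longrightarrow>
      cassoc B X Y Z (cpure B (circ B X Y) Z (cpure B X Y x y) z) =
        cpure B X (circ B Y Z) x (cpure B Y Z y z)"
proof -
  have vB: "is_vspace B" using B by simp
  note aX = acts_bimodule[OF X vB] and aY = acts_bimodule[OF Y vB] and aZ = acts_bimodule[OF Z vB]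
  note aXY = acts_circ[OF B X Y] and aYZ = acts_circ[OF B Y Z]
  let ?T = "circ B X (circ B Y Z)"
  let ?\<phi> = "\<lambda>z x y. cpure B X (circ B Y Z) x (cpure B Y Z y z)"
  have b: "bilin X Y ?T (\<lambda>x y. ?\<phi> z x y)" if "z \<in> carr Z" for z
    using that aX aY aZ aYZ by (auto intro!: lin_mod)
  have bz: "lin Z ?T (\<lambda>z. ?\<phi> z x y)" if "x \<in> carr X" "y \<in> carr Y" for x y
    using that aX aY aZ aYZ by (auto intro!: lin_mod)
  have c: "balanced B X Y (\<lambda>x y. ?\<phi> z x y)" if "z \<in> carr Z" for z
    using that aX aY aZ by (simp add: balanced_def cpure_balanced[OF aX aYZ] lact_circ[OF B Y Z])
  have val: "clift B X Y ?T (\<lambda>x y. ?\<phi> z x y) (cpure B X Y x y) = ?\<phi> z x y"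
    if "x \<in> carr X" "y \<in> carr Y" "z \<in> carr Z" for x y z
    by (rule clift_cpure) (use that aX aY aYZ b c in simp_all)
  have 1: "lin (circ B X Y) ?T (clift B X Y ?T (\<lambda>x y. ?\<phi> z x y))" if "z \<in> carr Z" for z
    by (rule lin_clift) (use that aX aY aYZ b c in simp_all)
  have b2: "bilin (circ B X Y) Z ?T (\<lambda>t z. clift B X Y ?T (\<lambda>x y. ?\<phi> z x y) t)"
  proof (rule bilinI)
    show "lin Z ?T (\<lambda>z. clift B X Y ?T (\<lambda>x y. ?\<phi> z x y) t)" if "t \<in> carr (circ B X Y)" for t
      by (rule lin_clift_parameter) (use that aX aY aZ aYZ b bz c in simp_all)
  qed (use 1 in simp)
  \<comment> \<open>The right action on t is the action on its Y factor; from there the scalar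
    crosses over to z by the balancing relation between Y and Z.\<close>
  have c2: "balanced B (circ B X Y) Z (\<lambda>t z. clift B X Y ?T (\<lambda>x y. ?\<phi> z x y) t)"
    unfolding balanced_def
  proof (intro ballI)
    fix t r z assume t: "t \<in> carr (circ B X Y)" and r: "r \<in> carr B" and z: "z \<in> carr Z"
    show "clift B X Y ?T (\<lambda>x y. ?\<phi> z x y) (ract (circ B X Y) t r) =
        clift B X Y ?T (\<lambda>x y. ?\<phi> (lact Z r z) x y) t"
    proof (rule circ_eqI[OF aX aY _ _ _ _ t])
      show "lin (circ B X Y) ?T (\<lambda>t. clift B X Y ?T (\<lambda>x y. ?\<phi> z x y) (ract (circ B X Y) t r))"
        by (rule lin_comp[OF 1[OF z] lin_ract_left[OF aXY lin_ident r]])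
      show "lin (circ B X Y) ?T (clift B X Y ?T (\<lambda>x y. ?\<phi> (lact Z r z) x y))" using z r aZ
        by (simp add: 1)
      show "clift B X Y ?T (\<lambda>x y. ?\<phi> z x y) (ract (circ B X Y) (cpure B X Y x y) r) =
          clift B X Y ?T (\<lambda>x y. ?\<phi> (lact Z r z) x y) (cpure B X Y x y)"
        if "x \<in> carr X" "y \<in> carr Y" for x y
        using that z r aX aY aZ by (simp add: val ract_circ[OF B X Y] cpure_balanced[OF aY aZ])
    qed (use aX aYZ in simp)
  qed
  show "lin (circ B (circ B X Y) Z) ?T (cassoc B X Y Z)"
    unfolding cassoc_def by (rule lin_clift) (use aX aXY aYZ aZ b2 c2 in simp_all)
  show "cassoc B X Y Z (cpure B (circ B X Y) Z (cpure B X Y x y) z) = ?\<phi> z x y"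
    if "x \<in> carr X" "y \<in> carr Y" "z \<in> carr Z"
  proof -
    have "cassoc B X Y Z (cpure B (circ B X Y) Z (cpure B X Y x y) z) =
        clift B X Y ?T (\<lambda>x y. ?\<phi> z x y) (cpure B X Y x y)"
      unfolding cassoc_def by (rule clift_cpure) (use that aX aY aXY aYZ aZ b2 c2 in simp_all)
    then show ?thesis using val that by simp
  qed
qed

lemma
  assumes B: "is_bialgebra B" and X: "is_bimodule B X"
  shows lin_clunit: "lin (circ B (unitI B) X) X (clunit B X)"
    and clunit_cpure: "b \<in> carr B \<Longrightarrow> x \<in> carr X \<Longrightarrow> clunit B X (cpure B (unitI B) X b x) = lact X b x"
    and lin_crunit: "lin (circ B X (unitI B)) X (crunit B X)"
    and crunit_cpure: "b \<in> carr B \<Longrightarrow> x \<in> carr X \<Longrightarrow> crunit B X (cpure B X (unitI B) x b) = ract X x b"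
proof -
  have vB: "is_vspace B" using B by simp
  note aX = acts_bimodule[OF X vB] and aI = acts_unitI[OF algebra_bialgebra[OF B]]
  have b: "bilin (unitI B) X X (\<lambda>b x. lact X b x)" "bilin X (unitI B) X (\<lambda>x b. ract X x b)"
    using bilin_lact[OF aX] bilin_ract[OF aX] by simp_all
  have c: "balanced B (unitI B) X (\<lambda>b x. lact X b x)" "balanced B X (unitI B) (\<lambda>x b. ract X x b)"
    by (simp_all add: balanced_def lact_mult[OF X vB] ract_mult[OF X vB])
  show "lin (circ B (unitI B) X) X (clunit B X)" "lin (circ B X (unitI B)) X (crunit B X)"
    unfolding clunit_def crunit_def using aX aI b c by (simp_all add: lin_clift)
  show "clunit B X (cpure B (unitI B) X b x) = lact X b x"
    "crunit B X (cpure B X (unitI B) x b) = ract X x b" if "b \<in> carr B" "x \<in> carr X"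
    unfolding clunit_def crunit_def
    by (rule clift_cpure, use aX aI b c that in simp_all)+
qed

lemma
  assumes B: "is_bialgebra B"
  shows lin_multJ: "lin (circ B (unitJ B) (unitJ B)) ground (multJ B)"
    and multJ_cpure: "multJ B (cpure B (unitJ B) (unitJ B) c c') = c * c'"
proof -
  note aJ = acts_unitJ[OF B]
  have b: "bilin (unitJ B) (unitJ B) (unitJ B) (\<lambda>c c'. c * c')"
    by (simp add: bilin_def lin_def algebra_simps)
  have c: "balanced B (unitJ B) (unitJ B) (\<lambda>c c'. c * c')"
    by (simp add: balanced_def algebra_simps)
  show "lin (circ B (unitJ B) (unitJ B)) ground (multJ B)"
    using lin_clift[OF aJ aJ _ b c] unfolding multJ_def by simp
  show "multJ B (cpure B (unitJ B) (unitJ B) c c') = c * c'"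
    unfolding multJ_def by (rule clift_cpure) (use aJ b c in simp_all)
qed

subsection \<open>The diagonal bimodule structure and the interchange law\<close>

lemma
  assumes B: "is_vspace B" and X: "acts B X" and Y: "acts B Y"
  shows bilin_lact2: "bilin (tensor B B) (tensor X Y) (tensor X Y) (lact2 B X Y)"
    and lact2_tpure: "r \<in> carr B \<Longrightarrow> s \<in> carr B \<Longrightarrow> x \<in> carr X \<Longrightarrow> y \<in> carr Y \<Longrightarrow>
      lact2 B X Y (tpure B B r s) (tpure X Y x y) = tpure X Y (lact X r x) (lact Y s y)"
    and bilin_ract2: "bilin (tensor X Y) (tensor B B) (tensor X Y) (ract2 B X Y)"
    and ract2_tpure: "r \<in> carr B \<Longrightarrow> s \<in> carr B \<Longrightarrow> x \<in> carr X \<Longrightarrow> y \<in> carr Y \<Longrightarrow>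
      ract2 B X Y (tpure X Y x y) (tpure B B r s) = tpure X Y (ract X x r) (ract Y y s)"
proof -
  let ?T = "tensor X Y"
  let ?l = "\<lambda>r s x y. tpure X Y (lact X r x) (lact Y s y)"
  let ?r = "\<lambda>r s x y. tpure X Y (ract X x r) (ract Y y s)"
  have 1: "bilin X Y ?T (\<lambda>x y. ?l r s x y)" "bilin X Y ?T (\<lambda>x y. ?r r s x y)"
    if "r \<in> carr B" "s \<in> carr B" for r s
    using that X Y by (auto intro!: lin_mod)
  have 2: "bilin B B ?T (\<lambda>r s. ?l r s x y)" "bilin B B ?T (\<lambda>r s. ?r r s x y)"
    if "x \<in> carr X" "y \<in> carr Y" for x y
    using that X Y by (auto intro!: lin_mod)
  show "bilin (tensor B B) ?T ?T (lact2 B X Y)"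
    unfolding lact2_def[abs_def] tmap_def by (rule bilin_tlift2) (use B X Y 1 2 in simp_all)
  have "bilin (tensor B B) ?T ?T (\<lambda>R t. ract2 B X Y t R)"
    unfolding ract2_def[abs_def] tmap_def by (rule bilin_tlift2) (use B X Y 1 2 in simp_all)
  then show "bilin ?T (tensor B B) ?T (ract2 B X Y)" by (simp add: bilin_def)
  show "lact2 B X Y (tpure B B r s) (tpure X Y x y) = ?l r s x y"
    "ract2 B X Y (tpure X Y x y) (tpure B B r s) = ?r r s x y"
    if "r \<in> carr B" "s \<in> carr B" "x \<in> carr X" "y \<in> carr Y"
    unfolding lact2_def ract2_def tmap_def
    by (rule tlift2_tpure, use that B X Y 1 2 in simp_all)+
qed

lemma acts_bullet:
  assumes B: "is_bialgebra B" and X: "acts B X" and Y: "acts B Y"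
  shows "acts B (bullet B X Y)"
proof -
  have vB: "is_vspace B" using B by simp
  have "bilin B (tensor X Y) (tensor X Y) (\<lambda>b t. lact2 B X Y (comult B b) t)"
    "bilin (tensor X Y) B (tensor X Y) (\<lambda>t b. ract2 B X Y t (comult B b))"
    by (rule bilin_lin2[OF bilin_lact2[OF vB X Y] lin_comult[OF B] lin_ident]
        bilin_lin2[OF bilin_ract2[OF vB X Y] lin_ident lin_comult[OF B]])+
  note b = this
  have "bilin B (tensor X Y) (tensor X Y) (lact (bullet B X Y))"
    by (rule bilin_cong[THEN iffD1, rotated 3, OF b(1)]) (use X Y in \<open>simp_all add: lact_bullet vB\<close>)
  moreover have "bilin (tensor X Y) B (tensor X Y) (ract (bullet B X Y))"
    by (rule bilin_cong[THEN iffD1, rotated 3, OF b(2)]) (use X Y in \<open>simp_all add: ract_bullet vB\<close>)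
  ultimately
  show ?thesis using X Y by (simp add: acts_def)
qed

lemma
  assumes B: "is_vspace B" and X: "acts B X" "acts B Y" "acts B X'" "acts B Y'"
    and f: "lin X X' f" and g: "lin Y Y' g" and R: "R \<in> carr (tensor B B)"
      and t: "t \<in> carr (tensor X Y)"
  shows tmap_ract2: "(\<And>b x. b \<in> carr B \<Longrightarrow> x \<in> carr X \<Longrightarrow> f (ract X x b) = ract X' (f x) b) \<Longrightarrow>
      (\<And>b y. b \<in> carr B \<Longrightarrow> y \<in> carr Y \<Longrightarrow> g (ract Y y b) = ract Y' (g y) b) \<Longrightarrow>
      tmap X Y X' Y' f g (ract2 B X Y t R) = ract2 B X' Y' (tmap X Y X' Y' f g t) R"
    and tmap_lact2: "(\<And>b x. b \<in> carr B \<Longrightarrow> x \<in> carr X \<Longrightarrow> f (lact X b x) = lact X' b (f x)) \<Longrightarrow>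
      (\<And>b y. b \<in> carr B \<Longrightarrow> y \<in> carr Y \<Longrightarrow> g (lact Y b y) = lact Y' b (g y)) \<Longrightarrow>
      tmap X Y X' Y' f g (lact2 B X Y R t) = lact2 B X' Y' R (tmap X Y X' Y' f g t)"
proof -
  let ?h = "tmap X Y X' Y' f g"
  have h: "lin (tensor X Y) (tensor X' Y') ?h" using X f g by (simp add: lin_tmap)
  show "?h (ract2 B X Y t R) = ract2 B X' Y' (?h t) R"
    if "\<And>b x. b \<in> carr B \<Longrightarrow> x \<in> carr X \<Longrightarrow> f (ract X x b) = ract X' (f x) b"
      "\<And>b y. b \<in> carr B \<Longrightarrow> y \<in> carr Y \<Longrightarrow> g (ract Y y b) = ract Y' (g y) b"
  proof (rule tensor_bilin_eqI[where V = X and W = Y and V' = B and W' = B and Z = "tensor X' Y'"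
        and f = "\<lambda>t R. ?h (ract2 B X Y t R)" and g = "\<lambda>t R. ract2 B X' Y' (?h t) R"])
    show "bilin (tensor X Y) (tensor B B) (tensor X' Y') (\<lambda>t R. ?h (ract2 B X Y t R))"
      using bilin_ract2[OF B X(1,2)] h by (simp add: bilin_def lin_def)
    show "bilin (tensor X Y) (tensor B B) (tensor X' Y') (\<lambda>t R. ract2 B X' Y' (?h t) R)"
      by (rule bilin_lin2[OF bilin_ract2[OF B X(3,4)] h lin_ident])
  qed (use B X f g R t that in \<open>simp_all add: ract2_tpure lin_closed[OF f] lin_closed[OF g]\<close>)
  show "?h (lact2 B X Y R t) = lact2 B X' Y' R (?h t)"
    if "\<And>b x. b \<in> carr B \<Longrightarrow> x \<in> carr X \<Longrightarrow> f (lact X b x) = lact X' b (f x)"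
      "\<And>b y. b \<in> carr B \<Longrightarrow> y \<in> carr Y \<Longrightarrow> g (lact Y b y) = lact Y' b (g y)"
  proof (rule tensor_bilin_eqI[where V = B and W = B and V' = X and W' = Y and Z = "tensor X' Y'"
        and f = "\<lambda>R t. ?h (lact2 B X Y R t)" and g = "\<lambda>R t. lact2 B X' Y' R (?h t)"])
    show "bilin (tensor B B) (tensor X Y) (tensor X' Y') (\<lambda>R t. ?h (lact2 B X Y R t))"
      using bilin_lact2[OF B X(1,2)] h by (simp add: bilin_def lin_def)
    show "bilin (tensor B B) (tensor X Y) (tensor X' Y') (\<lambda>R t. lact2 B X' Y' R (?h t))"
      by (rule bilin_lin2[OF bilin_lact2[OF B X(3,4)] lin_ident h])
  qed (use B X f g R t that in \<open>simp_all add: lact2_tpure lin_closed[OF f] lin_closed[OF g]\<close>)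
qed

lemma
  assumes B: "is_bialgebra B" and X: "acts B X" "acts B Y" "acts B Z" "acts B W"
  shows lin_interchange: "lin (circ B (bullet B X Y) (bullet B Z W)) (tensor (circ B X Z) (circ B Y
      W))
      (interchange B X Y Z W)"
    and interchange_tpure: "x \<in> carr X \<Longrightarrow> y \<in> carr Y \<Longrightarrow> z \<in> carr Z \<Longrightarrow> w \<in> carr W \<Longrightarrow>
      interchange B X Y Z W (cpure B (bullet B X Y) (bullet B Z W) (tpure X Y x y) (tpure Z W z w))
        =
        tpure (circ B X Z) (circ B Y W) (cpure B X Z x z) (cpure B Y W y w)"
proof -
  have vB: "is_vspace B" using B by simp
  let ?T = "tensor (circ B X Z) (circ B Y W)"
  let ?\<beta> = "\<lambda>x y z w. tpure (circ B X Z) (circ B Y W) (cpure B X Z x z) (cpure B Y W y w)"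
  let ?F = "\<lambda>t t'. tlift X Y ?T (\<lambda>x y. tlift Z W ?T (\<lambda>z w. ?\<beta> x y z w) t') t"
  have b1: "bilin Z W ?T (\<lambda>z w. ?\<beta> x y z w)" if "x \<in> carr X" "y \<in> carr Y" for x y
    using that X by (auto intro!: lin_mod)
  have b2: "bilin X Y ?T (\<lambda>x y. ?\<beta> x y z w)" if "z \<in> carr Z" "w \<in> carr W" for z w
    using that X by (auto intro!: lin_mod)
  have b: "bilin (tensor X Y) (tensor Z W) ?T ?F"
    by (rule bilin_tlift2) (use b1 b2 X in simp_all)
  have p: "?F (tpure X Y x y) (tpure Z W z w) = ?\<beta> x y z w"
    if "x \<in> carr X" "y \<in> carr Y" "z \<in> carr Z" "w \<in> carr W" for x y z w
    by (rule tlift2_tpure) (use b1 b2 X that in simp_all)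
  note bl = bilin_lact2[OF vB X(3,4)] and br = bilin_ract2[OF vB X(1,2)]
  \<comment> \<open>The claim is made for every R in B \<otimes> B and not just for R = \<Delta>(r).
    By linearity R may then be taken to be r \<otimes> s, and the claim splits into the balancing
    relations of the two \<open>circ\<close> factors.\<close>
  have bal: "?F (ract2 B X Y t R) t' = ?F t (lact2 B Z W R t')"
    if t: "t \<in> carr (tensor X Y)" "t' \<in> carr (tensor Z W)" "R \<in> carr (tensor B B)" for t t' R
  proof (rule tensor_eqI[where V = B and W = B and Z = ?T and t = R
        and f = "\<lambda>R. ?F (ract2 B X Y t R) t'" and g = "\<lambda>R. ?F t (lact2 B Z W R t')"])
    show "lin (tensor B B) ?T (\<lambda>R. ?F (ract2 B X Y t R) t')"
      by (rule bilin_left[OF b bilin_right[OF br lin_ident t(1)] t(2)])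
    show "lin (tensor B B) ?T (\<lambda>R. ?F t (lact2 B Z W R t'))"
      by (rule bilin_right[OF b bilin_left[OF bl lin_ident t(2)] t(1)])
    fix r s assume r: "r \<in> carr B" and s: "s \<in> carr B"
    then have rs: "tpure B B r s \<in> carr (tensor B B)" by simp
    show "?F (ract2 B X Y t (tpure B B r s)) t' = ?F t (lact2 B Z W (tpure B B r s) t')"
    proof (rule tensor_bilin_eqI[where V = X and W = Y and V' = Z and W' = W and Z = ?T
        and f = "\<lambda>t t'. ?F (ract2 B X Y t (tpure B B r s)) t'"
        and g = "\<lambda>t t'. ?F t (lact2 B Z W (tpure B B r s) t')"])
      show "bilin (tensor X Y) (tensor Z W) ?T (\<lambda>t t'. ?F (ract2 B X Y t (tpure B B r s)) t')"
        by (rule bilin_lin2[OF b bilin_left[OF br lin_ident rs] lin_ident])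
      show "bilin (tensor X Y) (tensor Z W) ?T (\<lambda>t t'. ?F t (lact2 B Z W (tpure B B r s) t'))"
        by (rule bilin_lin2[OF b lin_ident bilin_right[OF bl lin_ident rs]])
      show "?F (ract2 B X Y (tpure X Y x y) (tpure B B r s)) (tpure Z W z w) =
          ?F (tpure X Y x y) (lact2 B Z W (tpure B B r s) (tpure Z W z w))"
        if "x \<in> carr X" "y \<in> carr Y" "z \<in> carr Z" "w \<in> carr W" for x y z w
      proof -
        have "?F (ract2 B X Y (tpure X Y x y) (tpure B B r s)) (tpure Z W z w) =
            ?\<beta> (ract X x r) (ract Y y s) z w"
          unfolding ract2_tpure[OF vB X(1,2) r s that(1,2)] by (rule p) (use that X r s in simp_all)
        also have "\<dots> = ?\<beta> x y (lact Z r z) (lact W s w)"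
          by (simp only: cpure_balanced[OF X(1,3) that(1) r that(3)] cpure_balanced[OF X(2,4)
            that(2) s that(4)])
        also have "\<dots> = ?F (tpure X Y x y) (lact2 B Z W (tpure B B r s) (tpure Z W z w))"
          unfolding lact2_tpure[OF vB X(3,4) r s that(3,4)] by (rule p[symmetric])
            (use that X r s in simp_all)
        finally show ?thesis .
      qed
    qed (use X t in simp_all)
  qed (use X vB t in simp_all)
  have c: "balanced B (bullet B X Y) (bullet B Z W) ?F"
    unfolding balanced_def
  proof (intro ballI)
    fix t r t' assume a: "t \<in> carr (bullet B X Y)" "r \<in> carr B" "t' \<in> carr (bullet B Z W)"
    then have a': "t \<in> carr (tensor X Y)" "t' \<in> carr (tensor Z W)" by simp_all
    show "?F (ract (bullet B X Y) t r) t' = ?F t (lact (bullet B Z W) r t')"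
      unfolding lact_bullet[OF a(2) a'(2)] ract_bullet[OF a(2) a'(1)]
      by (rule bal[OF a'(1,2) comult_closed[OF B a(2)]])
  qed
  note a = acts_bullet[OF B X(1,2)] acts_bullet[OF B X(3,4)]
  have b': "bilin (bullet B X Y) (bullet B Z W) ?T ?F" using b by simp
  have vT: "is_vspace ?T" using X by simp
  \<comment> \<open>The target in the definition is a \<open>bullet\<close>; it is replaced here by
    its underlying vector space, the plain tensor product.\<close>
  have i: "interchange B X Y Z W = clift B (bullet B X Y) (bullet B Z W) ?T ?F"
    by (simp add: interchange_def Let_def clift_same_vspace[OF same_vspace_bullet])
  show "lin (circ B (bullet B X Y) (bullet B Z W)) ?T (interchange B X Y Z W)"
    unfolding i by (rule lin_clift[OF a vT b' c])
  have v: "interchange B X Y Z W (cpure B (bullet B X Y) (bullet B Z W) t t') = ?F t t'"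
    if "t \<in> carr (tensor X Y)" "t' \<in> carr (tensor Z W)" for t t'
    unfolding i by (rule clift_cpure[OF a vT b' c]) (use that in simp_all)
  show "interchange B X Y Z W (cpure B (bullet B X Y) (bullet B Z W) (tpure X Y x y) (tpure Z W z
      w)) = ?\<beta> x y z w"
    if "x \<in> carr X" "y \<in> carr Y" "z \<in> carr Z" "w \<in> carr W"
    using v[of "tpure X Y x y" "tpure Z W z w"] p[OF that] that by (simp only: tpure_closed)
qed

section \<open>Bialgebras under \<open>B\<close> as bimonoids\<close>

text \<open>X is the underlying bimodule. It is formed first because \<open>mmult\<close> is a lift
  from the product of this bimodule with itself and so needs both actions before the bimonoid record
  is complete.\<close>

definition bimonoid_under ::
  "('k::field, 'b) bialgebra \<Rightarrow> ('k, 'a) bialgebra \<Rightarrow> ('b \<Rightarrow> 'a) \<Rightarrow> ('k, 'b, 'a) bimonoid" where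
  "bimonoid_under B A u =
    (let l = (\<lambda>b\<in>carr B. \<lambda>x\<in>carr A. mult A (u b) x); r = (\<lambda>x\<in>carr A. \<lambda>b\<in>carr B. mult A x (u b));
       X = \<lparr>carr = carr A, add = add A, zero = zero A, scal = scal A, lact = l, ract = r\<rparr> in
     \<lparr>carr = carr A, add = add A, zero = zero A, scal = scal A, lact = l, ract = r,
      mmult = clift B X X X (mult A), munit = u, mcomult = comult A, mcounit = counit A\<rparr>)"

text \<open>The product is restricted in both arguments to be extensional, so that the original
  bialgebra can be recovered as a record.\<close>

definition bialgebra_of ::
  "('k::field, 'b) bialgebra \<Rightarrow> ('k, 'b, 'a) bimonoid \<Rightarrow> ('k, 'a) bialgebra" where
  "bialgebra_of B H =
    \<lparr>carr = carr H, add = add H, zero = zero H, scal = scal H,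
     mult = (\<lambda>x\<in>carr H. \<lambda>y\<in>carr H. mmult H (cpure B H H x y)), one = munit H (one B),
     comult = mcomult H, counit = mcounit H\<rparr>"

lemma same_vspace_bimonoid_under: "same_vspace (bimonoid_under B A u) A"
  by (simp add: same_vspace_def bimonoid_under_def Let_def)

lemma same_vspace_bialgebra_of: "same_vspace (bialgebra_of B H) H"
  by (simp add: same_vspace_def bialgebra_of_def)

lemma bimonoid_under_sel [simp]:
  "munit (bimonoid_under B A u) = u" "mcomult (bimonoid_under B A u) = comult A"
  "mcounit (bimonoid_under B A u) = counit A"
  by (simp_all add: bimonoid_under_def Let_def)

text \<open>X and Y may be records of different types. The lemma serves to replace the auxiliary
  bimodule inside \<open>bimonoid_under\<close> by the finished bimonoid, and later that bimonoid by
  a given one with the same actions.\<close>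

lemma clift_cong:
  assumes "carr X = carr Y" "add X = add Y" "scal X = scal Y" "lact X = lact Y" "ract X = ract Y"
  shows "clift B X X X \<phi> = clift B Y Y Y \<phi>"
proof -
  have "cnull B X X = cnull B Y Y" by (simp only: cnull_def bilinearity_relations_def assms)
  then show ?thesis by (simp only: clift_def induced_def linear_maps_def assms)
qed

lemma mmult_bimonoid_under:
  "mmult (bimonoid_under B A u) =
    clift B (bimonoid_under B A u) (bimonoid_under B A u) (bimonoid_under B A u) (mult A)"
proof -
  have "mmult (bimonoid_under B A u) = clift B X X X (mult A)"
    if "X = \<lparr>carr = carr A, add = add A, zero = zero A, scal = scal A,
      lact = lact (bimonoid_under B A u), ract = ract (bimonoid_under B A u)\<rparr>" for X
    unfolding that by (simp add: bimonoid_under_def Let_def)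
  from this[OF refl] show ?thesis
    by (rule trans, intro clift_cong) (simp_all add: bimonoid_under_def Let_def)
qed

lemma is_coalgebra_same_vspace:
  assumes "same_vspace V V'"
  shows "is_coalgebra V \<Delta> \<epsilon> \<longleftrightarrow> is_coalgebra V' \<Delta> \<epsilon>"
  by (simp only: is_coalgebra_def tassoc_def tlunit_def trunit_def same_vspace_simps[OF assms])

lemma bilin_comp: "lin Z Z' f \<Longrightarrow> bilin V W Z \<beta> \<Longrightarrow> bilin V W Z' (\<lambda>x y. f (\<beta> x y))"
  by (simp add: bilin_def lin_def)

text \<open>Translates the compatibility axiom of bimonoids into multiplicativity of \<Delta>: the
  interchange law followed by two multiplications is the product of A \<otimes> A. H and A are kept
  apart, tied by their common vector space and the values of m, so that both directions of the
  correspondence can use it.\<close>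

lemma tmap_mult_interchange:
  fixes B :: "('k::field, 'b) bialgebra" and H :: "('k, 'b, 'a) bimonoid"
    and A :: "('k, 'a) bialgebra"
  assumes B: "is_bialgebra B" and H: "is_bimodule B H" and A: "is_algebra A"
    and same: "same_vspace H A"
    and m: "lin (circ B H H) A m"
    and mp: "\<And>x y. x \<in> carr A \<Longrightarrow> y \<in> carr A \<Longrightarrow> m (cpure B H H x y) = mult A x y"
    and t: "t \<in> carr (tensor A A)" "t' \<in> carr (tensor A A)"
  shows "tmap (circ B H H) (circ B H H) A A m m
      (interchange B H H H H (cpure B (bullet B H H) (bullet B H H) t t')) =
        mult (tensor_algebra A A) t t'"
    (is "?f t t' = _")
proof (rule tensor_bilin_eqI[where V = A and W = A and V' = A and W' = A and Z = "tensor A A"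
  and f = ?f])
  have vB: "is_vspace B" using B by simp
  note aH = acts_bimodule[OF H vB] and aHH = acts_circ[OF B H H]
  note ab = acts_bullet[OF B aH aH]
  have vc: "is_vspace (circ B H H)" using aHH by simp
  have l: "lin (tensor (circ B H H) (circ B H H)) (tensor A A) (tmap (circ B H H) (circ B H H) A A m
      m)"
    by (rule lin_tmap) (use A m vc in simp_all)
  have "bilin (tensor A A) (tensor A A) (circ B (bullet B H H) (bullet B H H))
      (cpure B (bullet B H H) (bullet B H H))"
    using bilin_cpure[OF ab ab] by (simp add: same_vspace_simps[OF same])
  then show "bilin (tensor A A) (tensor A A) (tensor A A) ?f"
    by (rule bilin_comp[OF lin_comp[OF l lin_interchange[OF B aH aH aH aH]]])
  show "bilin (tensor A A) (tensor A A) (tensor A A) (mult (tensor_algebra A A))"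
    by (rule bilin_tensor_mult[OF A A])
  fix x y x' y' assume xy: "x \<in> carr A" "y \<in> carr A" "x' \<in> carr A" "y' \<in> carr A"
  have c: "cpure B H H v w \<in> carr (circ B H H)" if "v \<in> carr A" "w \<in> carr A" for v w
    using cpure_closed[OF aH aH] that by (simp add: same_vspace_simps[OF same])
  have "interchange B H H H H (cpure B (bullet B H H) (bullet B H H) (tpure A A x y) (tpure A A x'
      y')) =
      tpure (circ B H H) (circ B H H) (cpure B H H x x') (cpure B H H y y')"
    using interchange_tpure[OF B aH aH aH aH, of x y x' y'] xy
      by (simp add: same_vspace_simps[OF same])
  then show "?f (tpure A A x y) (tpure A A x' y') =
      mult (tensor_algebra A A) (tpure A A x y) (tpure A A x' y')"
    using A m vc c xy by (simp add: mp)
qed (use A t in simp_all)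

section \<open>From bialgebras under B to bimonoids\<close>

locale bialgebra_under =
  fixes B :: "('k::field, 'b) bialgebra" and A :: "('k, 'a) bialgebra" and u :: "'b \<Rightarrow> 'a"
  assumes B: "is_bialgebra B" and A: "is_bialgebra A" and u: "u \<in> bialgebra_maps B A"
begin

abbreviation H :: "('k, 'b, 'a) bimonoid" where "H \<equiv> bimonoid_under B A u"

lemmas H_vspace [simp] = same_vspace_simps[OF same_vspace_bimonoid_under[of B A u]]

lemma alg [simp]: "is_algebra A" "is_algebra B" and vs [simp]: "is_vspace A" "is_vspace B"
  using A B by auto

lemmas lin_u = bialgebra_map_lin[OF u] and u_closed [simp] = bialgebra_map_closed[OF u]
  and u_mult = bialgebra_map_mult[OF u] and u_one = bialgebra_map_one[OF u]
  and u_comult = bialgebra_map_comult[OF u] and u_counit = bialgebra_map_counit[OF u]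

lemma comult_A_closed [simp]: "x \<in> carr A \<Longrightarrow> comult A x \<in> carr (tensor A A)"
  and comult_B_closed [simp]: "b \<in> carr B \<Longrightarrow> comult B b \<in> carr (tensor B B)"
  using A B by simp_all

lemma lact_H [simp]: "b \<in> carr B \<Longrightarrow> x \<in> carr A \<Longrightarrow> lact H b x = mult A (u b) x"
  and ract_H [simp]: "b \<in> carr B \<Longrightarrow> x \<in> carr A \<Longrightarrow> ract H x b = mult A x (u b)"
  by (simp_all add: bimonoid_under_def Let_def)

lemma bimodule_H: "is_bimodule B H"
proof -
  have ext: "lact H \<in> extensional (carr B)" "ract H \<in> extensional (carr A)"
    "\<And>b. b \<in> carr B \<Longrightarrow> lact H b \<in> extensional (carr A)"
    "\<And>x. x \<in> carr A \<Longrightarrow> ract H x \<in> extensional (carr B)"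
    by (simp_all add: bimonoid_under_def Let_def)
  have "bilin B A A (\<lambda>b x. mult A (u b) x)" "bilin A B A (\<lambda>x b. mult A x (u b))"
    by (intro bilin_lin2[OF bilin_mult[OF alg(1)]] lin_u lin_ident)+
  note b = this
  have "bilin B A A (lact H)"
    by (rule bilin_cong[THEN iffD1, rotated 3, OF b(1)]) simp_all
  moreover have "bilin A B A (ract H)"
    by (rule bilin_cong[THEN iffD1, rotated 3, OF b(2)]) simp_all
  ultimately show ?thesis
    using ext by (simp add: is_bimodule_def bilinear_maps_iff u_one u_mult mult_assoc)
qed

lemma acts_H [simp]: "acts B H"
  by (rule acts_bimodule[OF bimodule_H vs(2)])

lemma acts_HH [simp]: "acts B (circ B H H)" "acts B (bullet B H H)" "acts B (unitI B)"
  "acts B (unitJ B)"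
  using acts_circ[OF B bimodule_H bimodule_H] acts_bullet[OF B acts_H acts_H] acts_unitI[OF alg(2)]
    acts_unitJ[OF B] by simp_all

lemma
  shows mmult_linear_maps: "mmult H \<in> linear_maps (circ B H H) A"
    and lin_mmult: "lin (circ B H H) A (mmult H)"
    and mmult_cpure [simp]: "x \<in> carr A \<Longrightarrow> y \<in> carr A \<Longrightarrow> mmult H (cpure B H H x y) = mult A x y"
proof -
  have b: "bilin H H H (mult A)" using bilin_mult[OF alg(1)] by simp
  have c: "balanced B H H (mult A)" by (simp add: balanced_def mult_assoc)
  have v: "is_vspace H" by simp
  show l: "mmult H \<in> linear_maps (circ B H H) A"
    using clift_linear_maps[OF acts_H acts_H v b c] by (simp add: mmult_bimonoid_under)
  then show "lin (circ B H H) A (mmult H)" by (rule linear_maps_lin)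
  show "mmult H (cpure B H H x y) = mult A x y" if "x \<in> carr A" "y \<in> carr A"
    using clift_cpure[OF acts_H acts_H v b c] that by (simp add: mmult_bimonoid_under)
qed

lemma mmult_closed [simp]: "t \<in> carr (circ B H H) \<Longrightarrow> mmult H t \<in> carr A"
  by (rule lin_closed[OF lin_mmult])

lemma lin_mmult_comp: "lin U (circ B H H) f \<Longrightarrow> lin U A (\<lambda>x. mmult H (f x))"
  by (rule lin_comp[OF lin_mmult])

text \<open>B acts by multiplication with values of u, so on pure tensors both equations are
  associativity in A.\<close>

lemma
  assumes b: "b \<in> carr B" and t: "t \<in> carr (circ B H H)"
  shows mmult_lact: "mmult H (lact (circ B H H) b t) = lact H b (mmult H t)"
    and mmult_ract: "mmult H (ract (circ B H H) t b) = ract H (mmult H t) b"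
proof -
  note l = lin_mmult_comp[OF lin_lact_right[OF acts_HH(1) lin_ident b]]
    lin_mmult_comp[OF lin_ract_left[OF acts_HH(1) lin_ident b]]
    lin_lact_right[OF acts_H _ b, of _ "mmult H"] lin_ract_left[OF acts_H _ b, of _ "mmult H"]
  show "mmult H (lact (circ B H H) b t) = lact H b (mmult H t)"
    by (rule circ_eqI[OF acts_H acts_H vs(1) l(1) _ _ t])
      (use b l(3) lin_mmult in \<open>simp_all add: lact_circ[OF B bimodule_H bimodule_H] mult_assoc\<close>)
  show "mmult H (ract (circ B H H) t b) = ract H (mmult H t) b"
    by (rule circ_eqI[OF acts_H acts_H vs(1) l(2) _ _ t])
      (use b l(4) lin_mmult in \<open>simp_all add: ract_circ[OF B bimodule_H bimodule_H] mult_assoc\<close>)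
qed

lemma u_lact: "b \<in> carr B \<Longrightarrow> x \<in> carr B \<Longrightarrow> u (lact (unitI B) b x) = lact H b (u x)"
  and u_ract: "b \<in> carr B \<Longrightarrow> x \<in> carr B \<Longrightarrow> u (ract (unitI B) x b) = ract H (u x) b"
  by (simp_all add: u_mult)

lemma monoid_H: "is_monoid B H"
  unfolding is_monoid_def
proof (intro conjI ballI)
  note cH = circ_eqI[OF acts_H acts_H]
  have id: "lin H H (id_map H)" using lin_id_map[OF vs(1)] by simp
  have lm: "lin (circ B H H) H (mmult H)" using lin_mmult by simp
  have lu: "lin (unitI B) H u" using lin_u by simp
  show "mmult H \<in> bimodule_maps B (circ B H H) H"
    unfolding bimodule_maps_def using mmult_linear_maps mmult_lact mmult_ract by simp
  show "munit H \<in> bimodule_maps B (unitI B) H"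
    unfolding bimodule_maps_def using bialgebra_map_linear[OF u] by (simp add: u_mult)
  show "mmult H (cmap B (circ B H H) H H H (mmult H) (id_map H) t) =
      mmult H (cmap B H (circ B H H) H H (id_map H) (mmult H) (cassoc B H H H t))"
    if t: "t \<in> carr (circ B (circ B H H) H)" for t
  proof (rule circ_eqI[OF acts_HH(1) acts_H vs(1) _ _ _ t])
    have 1: "lin (circ B (circ B H H) H) (circ B H H) (cmap B (circ B H H) H H H (mmult H) (id_map
        H))"
      by (rule lin_cmap[OF acts_HH(1) acts_H acts_H acts_H lm id]) (simp_all add: mmult_ract)
    have 2: "cmap B (circ B H H) H H H (mmult H) (id_map A) (cpure B (circ B H H) H s z) =
        cpure B H H (mmult H s) z" if "s \<in> carr (circ B H H)" "z \<in> carr A" for s z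
      using cmap_cpure[OF acts_HH(1) acts_H acts_H acts_H lm id, of s z] that
        by (simp add: mmult_ract)
    have 3: "lin (circ B H (circ B H H)) (circ B H H) (cmap B H (circ B H H) H H (id_map H) (mmult
        H))"
      by (rule lin_cmap[OF acts_H acts_HH(1) acts_H acts_H id lm]) (simp_all add: mmult_lact)
    have 4: "cmap B H (circ B H H) H H (id_map A) (mmult H) (cpure B H (circ B H H) x s) =
        cpure B H H x (mmult H s)" if "s \<in> carr (circ B H H)" "x \<in> carr A" for s x
      using cmap_cpure[OF acts_H acts_HH(1) acts_H acts_H id lm, of x s] that
        by (simp add: mmult_lact)
    note as = lin_cassoc[OF B bimodule_H bimodule_H bimodule_H]
    show "lin (circ B (circ B H H) H) A (\<lambda>t. mmult H (cmap B (circ B H H) H H H (mmult H) (id_map H)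
        t))"
      by (rule lin_mmult_comp[OF 1])
    show l: "lin (circ B (circ B H H) H) A
        (\<lambda>t. mmult H (cmap B H (circ B H H) H H (id_map H) (mmult H) (cassoc B H H H t)))"
      by (rule lin_mmult_comp[OF lin_comp[OF 3 as]])
    fix s z assume s: "s \<in> carr (circ B H H)" and z: "z \<in> carr H"
    show "mmult H (cmap B (circ B H H) H H H (mmult H) (id_map H) (cpure B (circ B H H) H s z)) =
        mmult H (cmap B H (circ B H H) H H (id_map H) (mmult H) (cassoc B H H H (cpure B (circ B H
          H) H s z)))"
    proof (rule cH[OF vs(1) _ _ _ s])
      show "lin (circ B H H) A (\<lambda>s. mmult H (cmap B (circ B H H) H H H (mmult H) (id_map H)
          (cpure B (circ B H H) H s z)))"
        by (rule lin_mmult_comp[OF lin_comp[OF 1 lin_cpure_left[OF acts_HH(1) acts_H lin_ident z]]])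
      show "lin (circ B H H) A (\<lambda>s. mmult H (cmap B H (circ B H H) H H (id_map H) (mmult H)
          (cassoc B H H H (cpure B (circ B H H) H s z))))"
        by (rule lin_comp[OF l lin_cpure_left[OF acts_HH(1) acts_H lin_ident z]])
      fix x y assume "x \<in> carr H" "y \<in> carr H"
      then show "mmult H (cmap B (circ B H H) H H H (mmult H) (id_map H)
            (cpure B (circ B H H) H (cpure B H H x y) z)) =
          mmult H (cmap B H (circ B H H) H H (id_map H) (mmult H)
            (cassoc B H H H (cpure B (circ B H H) H (cpure B H H x y) z)))"
        using z cpure_closed[OF acts_H acts_H, of x y] cpure_closed[OF acts_H acts_H, of y z]
        by (simp add: cassoc_cpure[OF B bimodule_H bimodule_H bimodule_H] 2 4 mult_assoc)
    qed
  qed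
  show "mmult H (cmap B (unitI B) H H H (munit H) (id_map H) t) = clunit B H t"
    if t: "t \<in> carr (circ B (unitI B) H)" for t
  proof (rule circ_eqI[OF acts_HH(3) acts_H vs(1) _ _ _ t])
    show "lin (circ B (unitI B) H) A (\<lambda>t. mmult H (cmap B (unitI B) H H H (munit H) (id_map H) t))"
      by (rule lin_mmult_comp[OF lin_cmap[OF acts_HH(3) acts_H acts_H acts_H _ id]])
        (use lu in \<open>simp_all add: u_mult\<close>)
    show "lin (circ B (unitI B) H) A (clunit B H)" using lin_clunit[OF B bimodule_H] by simp
    show "mmult H (cmap B (unitI B) H H H (munit H) (id_map H) (cpure B (unitI B) H b y)) =
        clunit B H (cpure B (unitI B) H b y)" if "b \<in> carr (unitI B)" "y \<in> carr H" for b y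
      using cmap_cpure[OF acts_HH(3) acts_H acts_H acts_H lu id, of b y] that
      by (simp add: u_mult clunit_cpure[OF B bimodule_H])
  qed
  show "mmult H (cmap B H (unitI B) H H (id_map H) (munit H) t) = crunit B H t"
    if t: "t \<in> carr (circ B H (unitI B))" for t
  proof (rule circ_eqI[OF acts_H acts_HH(3) vs(1) _ _ _ t])
    show "lin (circ B H (unitI B)) A (\<lambda>t. mmult H (cmap B H (unitI B) H H (id_map H) (munit H) t))"
      by (rule lin_mmult_comp[OF lin_cmap[OF acts_H acts_HH(3) acts_H acts_H id]])
        (use lu in \<open>simp_all add: u_mult\<close>)
    show "lin (circ B H (unitI B)) A (crunit B H)" using lin_crunit[OF B bimodule_H] by simp
    show "mmult H (cmap B H (unitI B) H H (id_map H) (munit H) (cpure B H (unitI B) y b)) =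
        crunit B H (cpure B H (unitI B) y b)" if "y \<in> carr H" "b \<in> carr (unitI B)" for b y
      using cmap_cpure[OF acts_H acts_HH(3) acts_H acts_H id lu, of y b] that
      by (simp add: u_mult crunit_cpure[OF B bimodule_H])
  qed
qed

lemma lin_uu: "lin (tensor B B) (tensor A A) (tmap B B A A u u)"
  by (rule lin_tmap) (simp_all add: lin_u)

lemma
  assumes R: "R \<in> carr (tensor B B)" and t: "t \<in> carr (tensor A A)"
  shows lact2_H: "lact2 B H H R t = mult (tensor_algebra A A) (tmap B B A A u u R) t"
    and ract2_H: "ract2 B H H t R = mult (tensor_algebra A A) t (tmap B B A A u u R)"
proof -
  note b = bilin_tensor_mult[OF alg(1) alg(1)]
  show "lact2 B H H R t = mult (tensor_algebra A A) (tmap B B A A u u R) t"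
  proof (rule tensor_bilin_eqI[where V = B and W = B and V' = A and W' = A and Z = "tensor A A"
        and f = "\<lambda>R t. lact2 B H H R t"
          and g = "\<lambda>R t. mult (tensor_algebra A A) (tmap B B A A u u R) t"])
    show "bilin (tensor B B) (tensor A A) (tensor A A) (\<lambda>R t. lact2 B H H R t)"
      using bilin_lact2[OF vs(2) acts_H acts_H] by simp
    show "bilin (tensor B B) (tensor A A) (tensor A A) (\<lambda>R t. mult (tensor_algebra A A) (tmap B B A
        A u u R) t)"
      by (rule bilin_lin2[OF b lin_uu lin_ident])
  qed (use R t lact2_tpure[OF vs(2) acts_H acts_H] in \<open>simp_all add: lin_u\<close>)
  show "ract2 B H H t R = mult (tensor_algebra A A) t (tmap B B A A u u R)"
  proof (rule tensor_bilin_eqI[where V = A and W = A and V' = B and W' = B and Z = "tensor A A"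
        and f = "\<lambda>t R. ract2 B H H t R"
          and g = "\<lambda>t R. mult (tensor_algebra A A) t (tmap B B A A u u R)"])
    show "bilin (tensor A A) (tensor B B) (tensor A A) (\<lambda>t R. ract2 B H H t R)"
      using bilin_ract2[OF vs(2) acts_H acts_H] by simp
    show "bilin (tensor A A) (tensor B B) (tensor A A) (\<lambda>t R. mult (tensor_algebra A A) t (tmap B B
        A A u u R))"
      by (rule bilin_lin2[OF b lin_ident lin_uu])
  qed (use R t ract2_tpure[OF vs(2) acts_H acts_H] in \<open>simp_all add: lin_u\<close>)
qed

lemma coalgebra_A: "is_coalgebra A (comult A) (counit A)"
  using A by (simp add: is_bialgebra_def)

text \<open>Multiplicativity of \<Delta> turns the coproduct of u(b) x into a product in A \<otimes>
  A, and its first factor is (u \<otimes> u)(\<Delta>(b)) because u is comultiplicative; this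
  product is the diagonal action of b.\<close>

lemma comult_lact: "b \<in> carr B \<Longrightarrow> x \<in> carr A \<Longrightarrow> comult A (lact H b x) =
    lact (bullet B H H) b (comult A x)"
  and comult_ract: "b \<in> carr B \<Longrightarrow> x \<in> carr A \<Longrightarrow> comult A (ract H x b) =
      ract (bullet B H H) (comult A x) b"
  by (simp_all add: lact_bullet ract_bullet lact2_H ract2_H comult_mult[OF A] u_comult)

lemma counit_lact: "b \<in> carr B \<Longrightarrow> x \<in> carr A \<Longrightarrow> counit A (lact H b x) = lact (unitJ B) b (counit A x)"
  and counit_ract: "b \<in> carr B \<Longrightarrow> x \<in> carr A \<Longrightarrow> counit A (ract H x b) = ract (unitJ B) (counit A x) b"
  by (simp_all add: counit_mult[OF A] u_counit)

lemma comonoid_H: "is_comonoid B H"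
proof -
  have "is_coalgebra H (comult A) (counit A)"
    by (simp only: is_coalgebra_same_vspace[OF same_vspace_bimonoid_under] coalgebra_A)
  moreover have "comult A \<in> linear_maps A (tensor A A)" "counit A \<in> linear_maps A ground"
    using coalgebra_A by (simp_all add: is_coalgebra_def)
  ultimately show ?thesis
    unfolding is_comonoid_def bimodule_maps_def
    using comult_lact comult_ract counit_lact counit_ract by simp
qed

lemma tmap_mmult_interchange:
  "t \<in> carr (tensor A A) \<Longrightarrow> t' \<in> carr (tensor A A) \<Longrightarrow>
    tmap (circ B H H) (circ B H H) H H (mmult H) (mmult H)
      (interchange B H H H H (cpure B (bullet B H H) (bullet B H H) t t')) =
        mult (tensor_algebra A A) t t'"
  using tmap_mult_interchange[OF B bimodule_H alg(1) same_vspace_bimonoid_under lin_mmult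
    mmult_cpure] by simp

lemma bimonoid_H: "is_bimonoid B H"
  unfolding is_bimonoid_def
proof (intro conjI ballI)
  have ld: "lin H (bullet B H H) (mcomult H)" using lin_comult[OF A] by simp
  have le: "lin H (unitJ B) (mcounit H)" using lin_counit[OF A] by simp
  show "mcomult H (mmult H t) = tmap (circ B H H) (circ B H H) H H (mmult H) (mmult H)
      (interchange B H H H H (cmap B H H (bullet B H H) (bullet B H H) (mcomult H) (mcomult H) t))"
    if t: "t \<in> carr (circ B H H)" for t
  proof (rule circ_eqI[OF acts_H acts_H vspace_tensor[OF vs(1) vs(1)] _ _ _ t])
    show "lin (circ B H H) (tensor A A) (\<lambda>t. mcomult H (mmult H t))"
      using lin_comp[OF lin_comult[OF A] lin_mmult] by simp
    have l: "lin (tensor (circ B H H) (circ B H H)) (tensor A A) (tmap (circ B H H) (circ B H H) H H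
        (mmult H) (mmult H))"
      using lin_tmap[of "circ B H H" "circ B H H" A A "mmult H"
        "mmult H"] vspace_acts[OF acts_HH(1)]
      by (simp add: lin_mmult)
    have c: "lin (circ B H H) (circ B (bullet B H H) (bullet B H H))
        (cmap B H H (bullet B H H) (bullet B H H) (mcomult H) (mcomult H))"
      by (rule lin_cmap[OF acts_H acts_H acts_HH(2) acts_HH(2) ld ld])
        (use comult_lact comult_ract in simp_all)
    show "lin (circ B H H) (tensor A A) (\<lambda>t. tmap (circ B H H) (circ B H H) H H (mmult H) (mmult H)
      (interchange B H H H H (cmap B H H (bullet B H H) (bullet B H H) (mcomult H) (mcomult H) t)))"
      by (rule lin_comp[OF l lin_comp[OF lin_interchange[OF B acts_H acts_H acts_H acts_H] c]])
    fix x y assume xy: "x \<in> carr H" "y \<in> carr H"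
    have "cmap B H H (bullet B H H) (bullet B H H) (mcomult H) (mcomult H) (cpure B H H x y) =
        cpure B (bullet B H H) (bullet B H H) (comult A x) (comult A y)"
      using cmap_cpure[OF acts_H acts_H acts_HH(2) acts_HH(2) ld ld _ _ xy] comult_lact comult_ract
        by simp
    then show "mcomult H (mmult H (cpure B H H x y)) =
        tmap (circ B H H) (circ B H H) H H (mmult H) (mmult H)
          (interchange B H H H H (cmap B H H (bullet B H H) (bullet B H H) (mcomult H) (mcomult H)
            (cpure B H H x y)))"
      using xy tmap_mmult_interchange[of "comult A x" "comult A y"] by (simp add: comult_mult[OF A])
  qed
  show "mcounit H (mmult H t) = multJ B (cmap B H H (unitJ B) (unitJ B) (mcounit H) (mcounit H) t)"
    if t: "t \<in> carr (circ B H H)" for t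
  proof (rule circ_eqI[OF acts_H acts_H vspace_ground _ _ _ t])
    show "lin (circ B H H) ground (\<lambda>t. mcounit H (mmult H t))"
      using lin_comp[OF lin_counit[OF A] lin_mmult] by simp
    show "lin (circ B H H) ground (\<lambda>t. multJ B (cmap B H H (unitJ B) (unitJ B) (mcounit H) (mcounit
        H) t))"
      by (rule lin_comp[OF lin_multJ[OF B] lin_cmap[OF acts_H acts_H acts_HH(4) acts_HH(4) le le]])
        (use counit_lact counit_ract in simp_all)
    show "mcounit H (mmult H (cpure B H H x y)) =
        multJ B (cmap B H H (unitJ B) (unitJ B) (mcounit H) (mcounit H) (cpure B H H x y))"
      if xy: "x \<in> carr H" "y \<in> carr H" for x y
    proof -
      have "cmap B H H (unitJ B) (unitJ B) (mcounit H) (mcounit H) (cpure B H H x y) =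
          cpure B (unitJ B) (unitJ B) (counit A x) (counit A y)"
        using cmap_cpure[OF acts_H acts_H acts_HH(4) acts_HH(4) le le _ _ xy] counit_lact
          counit_ract by simp
      then show ?thesis using xy by (simp add: multJ_cpure[OF B] counit_mult[OF A])
    qed
  qed
qed (simp_all add: bimodule_H monoid_H comonoid_H u_comult u_counit)

text \<open>These are the values off the carrier, which the equality of records in
  \<open>bialgebra_of_H\<close> has to match as well.\<close>

lemma mult_extensional: "x \<notin> carr A \<Longrightarrow> mult A x = undefined"
  "x \<in> carr A \<Longrightarrow> y \<notin> carr A \<Longrightarrow> mult A x y = undefined"
proof -
  have "mult A \<in> bilinear_maps A A A" using alg(1) unfolding is_algebra_def by blast
  then have "mult A \<in> carr A \<rightarrow>\<^sub>E carr A \<rightarrow>\<^sub>E carr A" unfolding bilinear_maps_def by blast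
  then show "x \<notin> carr A \<Longrightarrow> mult A x = undefined"
    "x \<in> carr A \<Longrightarrow> y \<notin> carr A \<Longrightarrow> mult A x y = undefined"
    by (blast intro: PiE_arb dest: PiE_mem)+
qed

lemma bialgebra_of_H: "bialgebra_of B H = A"
proof -
  have "(\<lambda>y\<in>carr A. mmult H (cpure B H H x y)) = mult A x" if "x \<in> carr A" for x
  proof
    show "(\<lambda>y\<in>carr A. mmult H (cpure B H H x y)) y = mult A x y" for y
      using that mult_extensional(2)[OF that, of y] by (cases "y \<in> carr A") simp_all
  qed
  then have "(\<lambda>x\<in>carr A. \<lambda>y\<in>carr A. mmult H (cpure B H H x y)) x = mult A x" for x
    using mult_extensional(1)[of x] by (cases "x \<in> carr A") simp_all
  then have m: "(\<lambda>x\<in>carr A. \<lambda>y\<in>carr A. mmult H (cpure B H H x y)) = mult A"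
    by (rule ext)
  show ?thesis
    unfolding bialgebra_of_def bimonoid_under_sel H_vspace m u_one by simp
qed

end

section \<open>From bimonoids to bialgebras under B\<close>

lemma same_vspace_sym: "same_vspace V W \<Longrightarrow> same_vspace W V"
  by (simp add: same_vspace_def)

text \<open>The unit laws force b x = u(b) x and x b = x u(b), so both actions can be recovered from
  the product and u. This is why passing to the bialgebra and back returns H itself. The algebra and
  bialgebra axioms are those of H evaluated at pure tensors.\<close>

lemma
  fixes H :: "('k::field, 'b, 'a) bimonoid"
  assumes B: "is_bialgebra B" and H: "is_bimonoid B H"
  shows bialgebra_under_bialgebra_of: "bialgebra_under B (bialgebra_of B H) (munit H)"
    and bimonoid_under_bialgebra_of: "bimonoid_under B (bialgebra_of B H) (munit H) = H"
proof -
  let ?A = "bialgebra_of B H" and ?u = "munit H" and ?m = "mmult H" and ?T = "circ B H H"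
  note A [simp] = same_vspace_simps[OF same_vspace_bialgebra_of[of B H]]
  have vB [simp]: "is_vspace B" and aB: "is_algebra B" using B by simp_all
  have bm: "is_bimodule B H" and mon: "is_monoid B H" and com: "is_comonoid B H"
    using H by (simp_all add: is_bimonoid_def)
  note aH = acts_bimodule[OF bm vB]
  have vH [simp]: "is_vspace H" using aH by simp
  note aT = acts_circ[OF B bm bm] and aI = acts_unitI[OF aB] and aJ = acts_unitJ[OF B]
    and ab = acts_bullet[OF B aH aH]
  have id: "lin H H (id_map H)" by (rule lin_id_map[OF vH])
  have m: "?m \<in> linear_maps ?T H" "lin ?T H ?m"
    and m_lact: "b \<in> carr B \<Longrightarrow> t \<in> carr ?T \<Longrightarrow> ?m (lact ?T b t) = lact H b (?m t)"
    and m_ract: "b \<in> carr B \<Longrightarrow> t \<in> carr ?T \<Longrightarrow> ?m (ract ?T t b) = ract H (?m t) b" for b t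
    using mon by (simp_all add: is_monoid_def bimodule_maps_def linear_maps_lin)
  have u: "?u \<in> linear_maps B H" "lin B H ?u"
    and u_lact: "b \<in> carr B \<Longrightarrow> x \<in> carr B \<Longrightarrow> ?u (mult B b x) = lact H b (?u x)"
    and u_ract: "b \<in> carr B \<Longrightarrow> x \<in> carr B \<Longrightarrow> ?u (mult B x b) = ract H (?u x) b" for b x
    using mon unfolding is_monoid_def bimodule_maps_def bimodule_vspace lact_unitI ract_unitI
    by (blast intro: linear_maps_lin)+
  have d: "mcomult H \<in> linear_maps H (tensor H H)" "lin H (tensor H H) (mcomult H)"
    and d_lact: "b \<in> carr B \<Longrightarrow> x \<in> carr H \<Longrightarrow> mcomult H (lact H b x) =
        lact (bullet B H H) b (mcomult H x)"
    and d_ract: "b \<in> carr B \<Longrightarrow> x \<in> carr H \<Longrightarrow> mcomult H (ract H x b) =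
        ract (bullet B H H) (mcomult H x) b"
    and e: "mcounit H \<in> linear_maps H ground" "lin H ground (mcounit H)"
    and e_lact: "b \<in> carr B \<Longrightarrow> x \<in> carr H \<Longrightarrow> mcounit H (lact H b x) = lact (unitJ B) b (mcounit H x)"
    and e_ract: "b \<in> carr B \<Longrightarrow> x \<in> carr H \<Longrightarrow> mcounit H (ract H x b) = ract (unitJ B) (mcounit H x) b"
    and coalg: "is_coalgebra H (mcomult H) (mcounit H)" for b x
    using com by (simp_all add: is_comonoid_def bimodule_maps_def linear_maps_lin)
  note mc [simp] = lin_closed[OF m(2)] and uc [simp] = lin_closed[OF u(2)]
    and dc [simp] = lin_closed[OF d(2)]
  have pc [simp]: "cpure B H H x y \<in> carr ?T" if "x \<in> carr H" "y \<in> carr H" for x y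
    using cpure_closed[OF aH aH that] .
  have mult: "mult ?A x y = ?m (cpure B H H x y)" if "x \<in> carr H" "y \<in> carr H" for x y
    using that by (simp add: bialgebra_of_def)
  have one: "one ?A = ?u (one B)" and sel: "comult ?A = mcomult H" "counit ?A = mcounit H"
    by (simp_all add: bialgebra_of_def)
  have unitL: "?m (cpure B H H (?u b) x) = lact H b x" if b: "b \<in> carr B" and x: "x \<in> carr H"
    for b x
  proof -
    have "cmap B (unitI B) H H H ?u (id_map H) (cpure B (unitI B) H b x) = cpure B H H (?u b) x"
      using cmap_cpure[OF aI aH aH aH _ id, of ?u b x] b x u aH by (simp add: u_ract)
    moreover have "cpure B (unitI B) H b x \<in> carr (circ B (unitI B) H)"
      using cpure_closed[OF aI aH] b x by simp
    ultimately show ?thesis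
      using mon clunit_cpure[OF B bm b x] unfolding is_monoid_def by metis
  qed
  have unitR: "?m (cpure B H H x (?u b)) = ract H x b" if b: "b \<in> carr B" and x: "x \<in> carr H"
    for b x
  proof -
    have "cmap B H (unitI B) H H (id_map H) ?u (cpure B H (unitI B) x b) = cpure B H H x (?u b)"
      using cmap_cpure[OF aH aI aH aH id, of ?u x b] b x u aH by (simp add: u_lact)
    moreover have "cpure B H (unitI B) x b \<in> carr (circ B H (unitI B))"
      using cpure_closed[OF aH aI] b x by simp
    ultimately show ?thesis
      using mon crunit_cpure[OF B bm b x] unfolding is_monoid_def by metis
  qed
  have assoc: "?m (cpure B H H (?m (cpure B H H x y)) z) =
      ?m (cpure B H H x (?m (cpure B H H y z)))"
    if xyz: "x \<in> carr H" "y \<in> carr H" "z \<in> carr H" for x y z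
  proof -
    let ?t = "cpure B ?T H (cpure B H H x y) z"
    have "?t \<in> carr (circ B ?T H)" using cpure_closed[OF aT aH pc] xyz by simp
    then have "?m (cmap B ?T H H H ?m (id_map H) ?t) =
        ?m (cmap B H ?T H H (id_map H) ?m (cassoc B H H H ?t))"
      using mon unfolding is_monoid_def by blast
    also have "cmap B ?T H H H ?m (id_map H) ?t = cpure B H H (?m (cpure B H H x y)) z"
      using cmap_cpure[OF aT aH aH aH m(2) id, of "cpure B H H x y" z] xyz aH by (simp add: m_ract)
    also have "cassoc B H H H ?t = cpure B H ?T x (cpure B H H y z)"
      by (rule cassoc_cpure[OF B bm bm bm xyz])
    also have "cmap B H ?T H H (id_map H) ?m \<dots> = cpure B H H x (?m (cpure B H H y z))"
      using cmap_cpure[OF aH aT aH aH id m(2), of x "cpure B H H y z"] xyz aH by (simp add: m_lact)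
    finally show ?thesis .
  qed
  have one_closed: "?u (one B) \<in> carr H" using aB by simp
  have algA: "is_algebra ?A"
    unfolding is_algebra_def A one
  proof (intro conjI ballI)
    have "bilin H H H (\<lambda>x y. ?m (cpure B H H x y))"
      by (rule bilin_comp[OF m(2) bilin_cpure[OF aH aH]])
    then have "bilin H H H (mult ?A)" by (rule bilin_cong[THEN iffD1, rotated 3])
      (simp_all add: mult)
    moreover have "mult ?A \<in> extensional (carr H)" "\<forall>x\<in>carr H. mult ?A x \<in> extensional (carr H)"
      by (simp_all add: bialgebra_of_def)
    ultimately show "mult ?A \<in> bilinear_maps ?A ?A ?A" by (simp add: bilinear_maps_iff)
  qed (use one_closed aB in \<open>simp_all add: mult assoc unitL unitR lact_one[OF bm vB]
    ract_one[OF bm vB]\<close>)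
  have biA: "is_bialgebra ?A"
    unfolding is_bialgebra_def A one sel
  proof (intro conjI ballI)
    show "is_coalgebra ?A (mcomult H) (mcounit H)"
      by (simp only: is_coalgebra_same_vspace[OF same_vspace_bialgebra_of] coalg)
    show "mcomult H (mult ?A x y) = mult (tensor_algebra ?A ?A) (mcomult H x) (mcomult H y)"
      if xy: "x \<in> carr H" "y \<in> carr H" for x y
    proof -
      have "cmap B H H (bullet B H H) (bullet B H H) (mcomult H) (mcomult H) (cpure B H H x y) =
          cpure B (bullet B H H) (bullet B H H) (mcomult H x) (mcomult H y)"
        using cmap_cpure[OF aH aH ab ab, of "mcomult H" "mcomult H" x y] d_lact d_ract d xy by simp
      then have "mcomult H (?m (cpure B H H x y)) = tmap ?T ?T H H ?m ?m
          (interchange B H H H H (cpure B (bullet B H H) (bullet B H H) (mcomult H x) (mcomult H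
            y)))"
        using H pc[OF xy] unfolding is_bimonoid_def by metis
      also have "\<dots> = mult (tensor_algebra ?A ?A) (mcomult H x) (mcomult H y)"
        using tmap_mult_interchange[OF B bm algA same_vspace_sym[OF same_vspace_bialgebra_of], of ?m
            "mcomult H x" "mcomult H y"] m(2) xy by (simp add: mult)
      finally show ?thesis using xy by (simp add: mult)
    qed
    show "mcomult H (?u (one B)) = one (tensor_algebra ?A ?A)"
    proof -
      have "mcomult H (?u (one B)) = tmap (unitI B) (unitI B) H H ?u ?u (comult B (one B))"
        using H aB unfolding is_bimonoid_def by simp
      also have "\<dots> = tpure H H (?u (one B)) (?u (one B))"
        using aB u by (simp add: comult_one[OF B])
      finally show ?thesis by (simp add: one)
    qed
    show "mcounit H (mult ?A x y) = mcounit H x * mcounit H y" if xy: "x \<in> carr H" "y \<in> carr H"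
      for x y
    proof -
      have "cmap B H H (unitJ B) (unitJ B) (mcounit H) (mcounit H) (cpure B H H x y) =
          cpure B (unitJ B) (unitJ B) (mcounit H x) (mcounit H y)"
        using cmap_cpure[OF aH aH aJ aJ, of "mcounit H" "mcounit H" x y] e_lact e_ract e xy by simp
      then have "mcounit H (?m (cpure B H H x y)) =
          multJ B (cpure B (unitJ B) (unitJ B) (mcounit H x) (mcounit H y))"
        using H pc[OF xy] unfolding is_bimonoid_def by metis
      then show ?thesis using xy by (simp add: mult multJ_cpure[OF B])
    qed
    show "mcounit H (?u (one B)) = 1"
      using H aB B unfolding is_bimonoid_def by simp
  qed (rule algA)
  \<comment> \<open>Left B-linearity of u and the left unit law make u multiplicative: u(b b') = b
    u(b') = u(b) u(b').\<close>
  have "?u \<in> bialgebra_maps B ?A"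
    unfolding bialgebra_maps_def A one sel
    using u H unfolding is_bimonoid_def by (simp add: mult unitL u_lact)
  with B biA show "bialgebra_under B ?A ?u" by unfold_locales
  let ?G = "bimonoid_under B ?A ?u"
  have "lact H \<in> carr B \<rightarrow>\<^sub>E carr H \<rightarrow>\<^sub>E carr H" "ract H \<in> carr H \<rightarrow>\<^sub>E carr B \<rightarrow>\<^sub>E carr H"
    using bm by (simp_all add: is_bimodule_def bilinear_maps_def)
  note acts = this
  \<comment> \<open>On the carriers this is the left unit law; off them both sides are
    \<open>undefined\<close>.\<close>
  have lactG: "lact ?G = lact H"
  proof (intro ext)
    fix b x
    show "lact ?G b x = lact H b x"
      using PiE_arb[OF acts(1), of b] PiE_arb[OF PiE_mem[OF acts(1)], of b x]
      by (cases "b \<in> carr B"; cases "x \<in> carr H") (simp_all add: bimonoid_under_def Let_def mult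
        unitL)
  qed
  have ractG: "ract ?G = ract H"
  proof (intro ext)
    fix x b
    show "ract ?G x b = ract H x b"
      using PiE_arb[OF acts(2), of x] PiE_arb[OF PiE_mem[OF acts(2)], of x b]
      by (cases "b \<in> carr B"; cases "x \<in> carr H") (simp_all add: bimonoid_under_def Let_def mult
        unitR)
  qed
  note G = same_vspace_simps(1-4)[OF same_vspace_bimonoid_under[of B ?A ?u]]
  have bl: "bilin H H H (mult ?A)" using bilin_mult[OF algA] by simp
  have bal: "balanced B H H (mult ?A)"
    using aH by (simp add: balanced_def mult cpure_balanced[OF aH aH])
  have "mmult ?G = clift B H H H (mult ?A)"
    unfolding mmult_bimonoid_under by (rule clift_cong) (simp_all add: G lactG ractG)
  also have "\<dots> = ?m"
  proof (rule linear_maps_ext[of _ ?T H])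
    show l: "clift B H H H (mult ?A) \<in> linear_maps ?T H"
      by (rule clift_linear_maps[OF aH aH vH bl bal])
    show "clift B H H H (mult ?A) t = ?m t" if t: "t \<in> carr ?T" for t
      by (rule circ_eqI[OF aH aH vH linear_maps_lin[OF l] m(2) _ t])
        (simp add: clift_cpure[OF aH aH vH bl bal] mult)
  qed (rule m(1))
  finally show "?G = H"
    by - (rule bimonoid.equality, simp_all add: G lactG ractG sel)
qed

subsection \<open>Hopf monoids\<close>

context bialgebra_under
begin

text \<open>The retractions are (x \<bullet> b) \<circ> c \<mapsto> c x u(S b) and c \<circ> (b
  \<bullet> x) \<mapsto> c u(S b) x, where S is the antipode of B. At b = c = 1 they return x,
  because S(1) = 1 and u(1) = 1.\<close>

lemma
  assumes "is_hopf_algebra B"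
  shows hopf_right_injective:
    "x \<in> carr A \<Longrightarrow> y \<in> carr A \<Longrightarrow>
      cpure B (bullet B H (unitI B)) (unitJ B) (tpure A B x (one B)) 1 =
        cpure B (bullet B H (unitI B)) (unitJ B) (tpure A B y (one B)) 1 \<Longrightarrow> x = y"
    and hopf_left_injective:
    "x \<in> carr A \<Longrightarrow> y \<in> carr A \<Longrightarrow>
      cpure B (unitJ B) (bullet B (unitI B) H) 1 (tpure B A (one B) x) =
        cpure B (unitJ B) (bullet B (unitI B) H) 1 (tpure B A (one B) y) \<Longrightarrow> x = y"
proof -
  let ?S = "antipode B"
  note S = is_antipode_antipode[OF assms]
  note lS = linear_maps_lin[OF antipode_linear[OF B S]] and Sc [simp] = antipode_closed[OF B S]
  have uS: "lin B A (\<lambda>b. u (?S b))" by (rule lin_comp[OF lin_u lS])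
  have aHI: "acts B (bullet B H (unitI B))" "acts B (bullet B (unitI B) H)"
    using acts_bullet[OF B acts_H acts_HH(3)] acts_bullet[OF B acts_HH(3) acts_H] .
  note br = bilin_ract2[OF vs(2) acts_H acts_HH(3)] and bl = bilin_lact2[OF vs(2) acts_HH(3) acts_H]
  let ?\<rho> = "tlift A B A (\<lambda>h b. mult A h (u (?S b)))"
  have b\<rho>: "bilin A B A (\<lambda>h b. mult A h (u (?S b)))"
    by (rule bilin_lin2[OF bilin_mult[OF alg(1)] lin_ident uS])
  have l\<rho>: "lin (tensor A B) A ?\<rho>" by (rule lin_tlift) (simp_all add: b\<rho>)
  have \<rho>p: "?\<rho> (tpure A B h b) = mult A h (u (?S b))" if "h \<in> carr A" "b \<in> carr B" for h b
    using that b\<rho> by simp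
  \<comment> \<open>Stated for arbitrary R so that linearity leaves only R = r \<otimes> s, where it
    says x u(r) u(S(b s)) = x u(r S(s)) u(S b). At R = \<Delta>(r) the lift on the right becomes the
    antipode axiom of B.\<close>
  have \<rho>1: "?\<rho> (ract2 B H (unitI B) (tpure A B h b) R) =
      mult A h (mult A (u (tlift B B B (\<lambda>r s. mult B r (?S s)) R)) (u (?S b)))"
    if h: "h \<in> carr A" and b: "b \<in> carr B" and R: "R \<in> carr (tensor B B)" for h b R
  proof (rule tensor_eqI[OF vs(2) vs(2) vs(1) _ _ _ R])
    have "lin (tensor B B) (tensor A B) (\<lambda>R. ract2 B H (unitI B) (tpure A B h b) R)"
      using bilin_right[OF br lin_ident, of "tpure A B h b"] h b by simp
    then show "lin (tensor B B) A (\<lambda>R. ?\<rho> (ract2 B H (unitI B) (tpure A B h b) R))"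
      by (rule lin_comp[OF l\<rho>])
    show "lin (tensor B B) A (\<lambda>R. mult A h (mult A (u (tlift B B B (\<lambda>r s. mult B r (?S s)) R)) (u
        (?S b))))"
      by (intro lin_mult_right lin_mult_left lin_comp[OF lin_u] lin_tlift bilin_antipode_right[OF B
        S])
        (use h b in simp_all)
    show "?\<rho> (ract2 B H (unitI B) (tpure A B h b) (tpure B B r s)) =
        mult A h (mult A (u (tlift B B B (\<lambda>r s. mult B r (?S s)) (tpure B B r s))) (u (?S b)))"
      if "r \<in> carr B" "s \<in> carr B" for r s
      using that h b ract2_tpure[OF vs(2) acts_H acts_HH(3) that, of h b]
      by (simp add: \<rho>p bilin_antipode_right[OF B S] u_mult mult_assoc antipode_mult[OF B S])
  qed
  have \<rho>2: "?\<rho> (ract2 B H (unitI B) t (comult B r)) = scal A (counit B r) (?\<rho> t)"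
    if t: "t \<in> carr (tensor A B)" and r: "r \<in> carr B" for t r
  proof (rule tensor_eqI[OF vs(1) vs(2) vs(1) _ _ _ t])
    have "lin (tensor A B) (tensor A B) (\<lambda>t. ract2 B H (unitI B) t (comult B r))"
      using bilin_left[OF br lin_ident, of "comult B r"] r by simp
    then show "lin (tensor A B) A (\<lambda>t. ?\<rho> (ract2 B H (unitI B) t (comult B r)))"
      by (rule lin_comp[OF l\<rho>])
    show "lin (tensor A B) A (\<lambda>t. scal A (counit B r) (?\<rho> t))" by (rule lin_scalar[OF vs(1) l\<rho>])
  qed (use r in \<open>simp_all add: \<rho>1 \<rho>p antipode_right[OF B S] lin_scal[OF lin_u] u_one mult_scal_left
    mult_scal_right\<close>)
  \<comment> \<open>B acts on J through \<epsilon>, so moving r across the tensor sign multiplies by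
    \<epsilon>(r); balancedness is thus exactly \<open>\<rho>2\<close>.\<close>
  have R: "bilin (bullet B H (unitI B)) (unitJ B) A (\<lambda>t c. scal A c (?\<rho> t))"
    "balanced B (bullet B H (unitI B)) (unitJ B) (\<lambda>t c. scal A c (?\<rho> t))"
    using l\<rho> lin_closed[OF l\<rho>]
    by (auto intro!: bilinI lin_scal_left lin_scalar lin_ident
        simp: balanced_def ract_bullet \<rho>2 vs_scal_scal mult.commute)
  show "x = y" if x: "x \<in> carr A" and y: "y \<in> carr A"
    and eq: "cpure B (bullet B H (unitI B)) (unitJ B) (tpure A B x (one B)) 1 =
        cpure B (bullet B H (unitI B)) (unitJ B) (tpure A B y (one B)) 1"
  proof -
    have "clift B (bullet B H (unitI B)) (unitJ B) A (\<lambda>t c. scal A c (?\<rho> t))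
        (cpure B (bullet B H (unitI B)) (unitJ B) (tpure A B z (one B)) 1) =
          z" if "z \<in> carr A" for z
      using clift_cpure[OF aHI(1) acts_HH(4) vs(1) R, of "tpure A B z (one B)" 1] that
      by (simp add: \<rho>p antipode_one[OF B S] u_one)
    from this[OF x] this[OF y] show "x = y" unfolding eq by simp
  qed
  \<comment> \<open>The mirror image: here u(S(r b)) u(s) x = u(S b) u(S(r) s) x, and the left
    antipode axiom of B applies.\<close>
  let ?q = "tlift B A A (\<lambda>b h. mult A (u (?S b)) h)"
  have bq: "bilin B A A (\<lambda>b h. mult A (u (?S b)) h)"
    by (rule bilin_lin2[OF bilin_mult[OF alg(1)] uS lin_ident])
  have lq: "lin (tensor B A) A ?q" by (rule lin_tlift) (simp_all add: bq)
  have qp: "?q (tpure B A b h) = mult A (u (?S b)) h" if "h \<in> carr A" "b \<in> carr B" for h b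
    using that bq by simp
  have q1: "?q (lact2 B (unitI B) H R (tpure B A b h)) =
      mult A (u (?S b)) (mult A (u (tlift B B B (\<lambda>r s. mult B (?S r) s) R)) h)"
    if h: "h \<in> carr A" and b: "b \<in> carr B" and R: "R \<in> carr (tensor B B)" for h b R
  proof (rule tensor_eqI[OF vs(2) vs(2) vs(1) _ _ _ R])
    have "lin (tensor B B) (tensor B A) (\<lambda>R. lact2 B (unitI B) H R (tpure B A b h))"
      using bilin_left[OF bl lin_ident, of "tpure B A b h"] h b by simp
    then show "lin (tensor B B) A (\<lambda>R. ?q (lact2 B (unitI B) H R (tpure B A b h)))"
      by (rule lin_comp[OF lq])
    show "lin (tensor B B) A (\<lambda>R. mult A (u (?S b)) (mult A (u (tlift B B B (\<lambda>r s. mult B (?S r) s)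
        R)) h))"
      by (intro lin_mult_right lin_mult_left lin_comp[OF lin_u] lin_tlift bilin_antipode_left[OF B
        S])
        (use h b in simp_all)
    show "?q (lact2 B (unitI B) H (tpure B B r s) (tpure B A b h)) =
        mult A (u (?S b)) (mult A (u (tlift B B B (\<lambda>r s. mult B (?S r) s) (tpure B B r s))) h)"
      if "r \<in> carr B" "s \<in> carr B" for r s
      using that h b lact2_tpure[OF vs(2) acts_HH(3) acts_H that, of b h]
      by (simp add: qp bilin_antipode_left[OF B S] u_mult mult_assoc antipode_mult[OF B S])
  qed
  have q2: "?q (lact2 B (unitI B) H (comult B r) t) = scal A (counit B r) (?q t)"
    if t: "t \<in> carr (tensor B A)" and r: "r \<in> carr B" for t r
  proof (rule tensor_eqI[OF vs(2) vs(1) vs(1) _ _ _ t])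
    have "lin (tensor B A) (tensor B A) (\<lambda>t. lact2 B (unitI B) H (comult B r) t)"
      using bilin_right[OF bl lin_ident, of "comult B r"] r by simp
    then show "lin (tensor B A) A (\<lambda>t. ?q (lact2 B (unitI B) H (comult B r) t))"
      by (rule lin_comp[OF lq])
    show "lin (tensor B A) A (\<lambda>t. scal A (counit B r) (?q t))" by (rule lin_scalar[OF vs(1) lq])
  qed (use r in \<open>simp_all add: q1 qp antipode_left[OF B S] lin_scal[OF lin_u] u_one mult_scal_left
    mult_scal_right\<close>)
  have L: "bilin (unitJ B) (bullet B (unitI B) H) A (\<lambda>c t. scal A c (?q t))"
    "balanced B (unitJ B) (bullet B (unitI B) H) (\<lambda>c t. scal A c (?q t))"
    using lq lin_closed[OF lq]
    by (auto intro!: bilinI lin_scal_left lin_scalar lin_ident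
        simp: balanced_def lact_bullet q2 vs_scal_scal mult.commute)
  show "x = y" if x: "x \<in> carr A" and y: "y \<in> carr A"
    and eq: "cpure B (unitJ B) (bullet B (unitI B) H) 1 (tpure B A (one B) x) =
        cpure B (unitJ B) (bullet B (unitI B) H) 1 (tpure B A (one B) y)"
  proof -
    have "clift B (unitJ B) (bullet B (unitI B) H) A (\<lambda>c t. scal A c (?q t))
        (cpure B (unitJ B) (bullet B (unitI B) H) 1 (tpure B A (one B) z)) =
          z" if "z \<in> carr A" for z
      using clift_cpure[OF acts_HH(4) aHI(2) vs(1) L, of 1 "tpure B A (one B) z"] that
      by (simp add: qp antipode_one[OF B S] u_one)
    from this[OF x] this[OF y] show "x = y" unfolding eq by simp
  qed
qed

end

context bialgebra_under
begin

lemma bilin_mult_map: "lin A A f \<Longrightarrow> lin A A g \<Longrightarrow> bilin A A A (\<lambda>y z. mult A (f y) (g z))"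
  by (rule bilin_lin2[OF bilin_mult[OF alg(1)]])

text \<open>On x \<otimes> y the composite yields the image of x \<Sigma>(y). The formula holds for
  every linear \<Sigma>, so it evaluates the axiom for a candidate before anything else is known
  about it.\<close>

lemma hopf_right_value:
  assumes \<Sigma>: "lin A A \<Sigma>" and t: "t \<in> carr (tensor A A)"
  shows "cmap B (bullet B (circ B H H) (unitI B)) (unitJ B) (bullet B H (unitI B)) (unitJ B)
      (tmap (circ B H H) (unitI B) H (unitI B) (mmult H) (id_map (unitI B))) (id_map (unitJ B))
      (rev_phi B H H (tmap H H H (reversion B H) (id_map H) \<Sigma> t)) =
    cpure B (bullet B H (unitI B)) (unitJ B)
      (tpure H (unitI B) (tlift A A A (\<lambda>y z. mult A y (\<Sigma> z)) t) (one B)) 1"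
proof -
  let ?X = "bullet B (circ B H H) (unitI B)" and ?Y = "bullet B H (unitI B)" and ?J = "unitJ B"
  let ?g = "tmap (circ B H H) B A B (mmult H) (id_map B)"
  have vc [simp]: "is_vspace (circ B H H)" using acts_HH(1) by simp
  have aX: "acts B ?X" and aY: "acts B ?Y"
    using acts_bullet[OF B acts_HH(1) acts_HH(3)] acts_bullet[OF B acts_H acts_HH(3)] .
  have g: "lin ?X ?Y ?g" using lin_tmap[OF vc vs(2) vs(1) vs(2) lin_mmult lin_id_map[OF vs(2)]]
    by simp
  have lm: "lin (circ B H H) H (mmult H)" "lin (unitI B) (unitI B) (id_map B)"
    using lin_mmult lin_id_map[OF vs(2)] by simp_all
  have gr: "?g (ract ?X s b) = ract ?Y (?g s) b" if "b \<in> carr B" "s \<in> carr ?X" for b s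
    using tmap_ract2[OF vs(2) acts_HH(1) acts_HH(3) acts_H acts_HH(3) lm, of "comult B b" s] that
      lin_closed[OF g, of s]
    by (simp add: mmult_ract ract_bullet)
  have lJ: "lin ?J ?J (id_map ground)" using lin_id_map[OF vspace_ground] by simp
  let ?c = "cmap B ?X ?J ?Y ?J ?g (id_map ground)"
  have c: "lin (circ B ?X ?J) (circ B ?Y ?J) ?c"
    by (rule lin_cmap[OF aX acts_HH(4) aY acts_HH(4) g lJ]) (simp_all add: gr)
  have cp: "?c (cpure B ?X ?J s k) = cpure B ?Y ?J (?g s) k" if "s \<in> carr ?X" for s k
    using cmap_cpure[OF aX acts_HH(4) aY acts_HH(4) g lJ gr, of s k] that by simp
  let ?\<phi> = "\<lambda>x y. cpure B ?X ?J (tpure (circ B H H) B (cpure B H H x y) (one B)) 1"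
  have vX: "is_vspace (circ B ?X ?J)" by (rule vspace_circ[OF aX acts_HH(4)])
  have vY: "is_vspace (circ B ?Y ?J)" by (rule vspace_circ[OF aY acts_HH(4)])
  have one: "(1 :: 'k) \<in> carr ?J" by simp
  have lin1: "lin (circ B H H) (circ B ?X ?J) (\<lambda>s. cpure B ?X ?J (tpure (circ B H H) B s (one B))
      1)"
    using lin_comp[OF lin_cpure_left[OF aX acts_HH(4) lin_ident one],
        of "circ B H H" "\<lambda>s. tpure (circ B H H) B s (one B)"]
    by (simp add: lin_tpure_left lin_ident)
  have bc: "bilin A A (circ B H H) (cpure B H H)" using bilin_cpure[OF acts_H acts_H] by simp
  have b\<phi>: "bilin A A (circ B ?X ?J) ?\<phi>" by (rule bilin_comp[OF lin1 bc])
  have phi: "rev_phi B H H = tlift A A (circ B ?X ?J) ?\<phi>" by (simp add: rev_phi_def)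
  have lphi: "lin (tensor A A) (circ B ?X ?J) (rev_phi B H H)"
    unfolding phi by (rule lin_tlift[OF vs(1) vs(1) vX b\<phi>])
  have phip: "rev_phi B H H (tpure A A x y) = ?\<phi> x y" if "x \<in> carr A" "y \<in> carr A" for x y
    unfolding phi by (rule tlift_tpure[OF vs(1) vs(1) vX b\<phi> that])
  have id: "lin A A (id_map A)" by (rule lin_id_map[OF vs(1)])
  have bm: "bilin A A A (\<lambda>y z. mult A y (\<Sigma> z))" by (rule bilin_mult_map[OF lin_ident \<Sigma>])
  have "?c (rev_phi B H H (tmap A A A A (id_map A) \<Sigma> t)) =
      cpure B ?Y ?J (tpure A B (tlift A A A (\<lambda>y z. mult A y (\<Sigma> z)) t) (one B)) 1"
  proof (rule tensor_eqI[OF vs(1) vs(1) vY _ _ _ t])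
    show "lin (tensor A A) (circ B ?Y ?J) (\<lambda>t. ?c (rev_phi B H H (tmap A A A A (id_map A) \<Sigma> t)))"
      by (rule lin_comp[OF c lin_comp[OF lphi lin_tmap[OF vs(1) vs(1) vs(1) vs(1) id \<Sigma>]]])
    have "lin (tensor A A) ?Y (\<lambda>t. tpure A B (tlift A A A (\<lambda>y z. mult A y (\<Sigma> z)) t) (one B))"
      using lin_tpure_left[OF vs(1) vs(2) lin_tlift[OF vs(1) vs(1) vs(1) bm], of "one B"] by simp
    then show "lin (tensor A A) (circ B ?Y ?J)
        (\<lambda>t. cpure B ?Y ?J (tpure A B (tlift A A A (\<lambda>y z. mult A y (\<Sigma> z)) t) (one B)) 1)"
      by (rule lin_cpure_left[OF aY acts_HH(4) _ one])
    fix x y assume xy: "x \<in> carr A" "y \<in> carr A"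
    note sy = lin_closed[OF \<Sigma> xy(2)]
    have pc: "cpure B H H x (\<Sigma> y) \<in> carr (circ B H H)" using cpure_closed[OF acts_H acts_H, of x
      "\<Sigma> y"] xy sy by simp
    show "?c (rev_phi B H H (tmap A A A A (id_map A) \<Sigma> (tpure A A x y))) =
        cpure B ?Y ?J (tpure A B (tlift A A A (\<lambda>y z. mult A y (\<Sigma> z)) (tpure A A x y)) (one B)) 1"
      using xy sy pc by (simp add: id \<Sigma> phip cp bm lin_mmult lin_id_map)
  qed
  then show ?thesis by simp
qed

lemma hopf_left_value:
  assumes \<Sigma>: "lin A A \<Sigma>" and t: "t \<in> carr (tensor A A)"
  shows "cmap B (unitJ B) (bullet B (unitI B) (circ B H H)) (unitJ B) (bullet B (unitI B) H)
      (id_map (unitJ B)) (tmap (unitI B) (circ B H H) (unitI B) H (id_map (unitI B)) (mmult H))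
      (rev_psi B H H (tmap H H (reversion B H) H \<Sigma> (id_map H) t)) =
    cpure B (unitJ B) (bullet B (unitI B) H) 1
      (tpure (unitI B) H (one B) (tlift A A A (\<lambda>y z. mult A (\<Sigma> y) z) t))"
proof -
  let ?X = "bullet B (unitI B) (circ B H H)" and ?Y = "bullet B (unitI B) H" and ?J = "unitJ B"
  let ?g = "tmap B (circ B H H) B A (id_map B) (mmult H)"
  have vc [simp]: "is_vspace (circ B H H)" using acts_HH(1) by simp
  have aX: "acts B ?X" and aY: "acts B ?Y"
    using acts_bullet[OF B acts_HH(3) acts_HH(1)] acts_bullet[OF B acts_HH(3) acts_H] .
  have g: "lin ?X ?Y ?g" using lin_tmap[OF vs(2) vc vs(2) vs(1) lin_id_map[OF vs(2)] lin_mmult]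
    by simp
  have lm: "lin (unitI B) (unitI B) (id_map B)" "lin (circ B H H) H (mmult H)"
    using lin_mmult lin_id_map[OF vs(2)] by simp_all
  have gl: "?g (lact ?X b s) = lact ?Y b (?g s)" if "b \<in> carr B" "s \<in> carr ?X" for b s
    using tmap_lact2[OF vs(2) acts_HH(3) acts_HH(1) acts_HH(3) acts_H lm, of "comult B b" s] that
      lin_closed[OF g, of s]
    by (simp add: mmult_lact lact_bullet)
  have lJ: "lin ?J ?J (id_map ground)" using lin_id_map[OF vspace_ground] by simp
  let ?c = "cmap B ?J ?X ?J ?Y (id_map ground) ?g"
  have c: "lin (circ B ?J ?X) (circ B ?J ?Y) ?c"
    by (rule lin_cmap[OF acts_HH(4) aX acts_HH(4) aY lJ g]) (simp_all add: gl)
  have cp: "?c (cpure B ?J ?X k s) = cpure B ?J ?Y k (?g s)" if "s \<in> carr ?X" for s k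
    using cmap_cpure[OF acts_HH(4) aX acts_HH(4) aY lJ g _ gl, of k s] that by simp
  let ?\<phi> = "\<lambda>x y. cpure B ?J ?X 1 (tpure B (circ B H H) (one B) (cpure B H H x y))"
  have vX: "is_vspace (circ B ?J ?X)" by (rule vspace_circ[OF acts_HH(4) aX])
  have vY: "is_vspace (circ B ?J ?Y)" by (rule vspace_circ[OF acts_HH(4) aY])
  have one: "(1 :: 'k) \<in> carr ?J" by simp
  have lin1: "lin (circ B H H) (circ B ?J ?X) (\<lambda>s. cpure B ?J ?X 1 (tpure B (circ B H H) (one B)
      s))"
    using lin_comp[OF lin_cpure_right[OF acts_HH(4) aX lin_ident one],
        of "circ B H H" "\<lambda>s. tpure B (circ B H H) (one B) s"]
    by (simp add: lin_tpure_right lin_ident)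
  have bc: "bilin A A (circ B H H) (cpure B H H)" using bilin_cpure[OF acts_H acts_H] by simp
  have b\<phi>: "bilin A A (circ B ?J ?X) ?\<phi>" by (rule bilin_comp[OF lin1 bc])
  have psi: "rev_psi B H H = tlift A A (circ B ?J ?X) ?\<phi>" by (simp add: rev_psi_def)
  have lpsi: "lin (tensor A A) (circ B ?J ?X) (rev_psi B H H)"
    unfolding psi by (rule lin_tlift[OF vs(1) vs(1) vX b\<phi>])
  have psip: "rev_psi B H H (tpure A A x y) = ?\<phi> x y" if "x \<in> carr A" "y \<in> carr A" for x y
    unfolding psi by (rule tlift_tpure[OF vs(1) vs(1) vX b\<phi> that])
  have id: "lin A A (id_map A)" by (rule lin_id_map[OF vs(1)])
  have bm: "bilin A A A (\<lambda>y z. mult A (\<Sigma> y) z)" by (rule bilin_mult_map[OF \<Sigma> lin_ident])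
  have "?c (rev_psi B H H (tmap A A A A \<Sigma> (id_map A) t)) =
      cpure B ?J ?Y 1 (tpure B A (one B) (tlift A A A (\<lambda>y z. mult A (\<Sigma> y) z) t))"
  proof (rule tensor_eqI[OF vs(1) vs(1) vY _ _ _ t])
    show "lin (tensor A A) (circ B ?J ?Y) (\<lambda>t. ?c (rev_psi B H H (tmap A A A A \<Sigma> (id_map A) t)))"
      by (rule lin_comp[OF c lin_comp[OF lpsi lin_tmap[OF vs(1) vs(1) vs(1) vs(1) \<Sigma> id]]])
    have "lin (tensor A A) ?Y (\<lambda>t. tpure B A (one B) (tlift A A A (\<lambda>y z. mult A (\<Sigma> y) z) t))"
      using lin_tpure_right[OF vs(2) vs(1) lin_tlift[OF vs(1) vs(1) vs(1) bm], of "one B"] by simp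
    then show "lin (tensor A A) (circ B ?J ?Y)
        (\<lambda>t. cpure B ?J ?Y 1 (tpure B A (one B) (tlift A A A (\<lambda>y z. mult A (\<Sigma> y) z) t)))"
      by (rule lin_cpure_right[OF acts_HH(4) aY _ one])
    fix x y assume xy: "x \<in> carr A" "y \<in> carr A"
    note sx = lin_closed[OF \<Sigma> xy(1)]
    have pc: "cpure B H H (\<Sigma> x) y \<in> carr (circ B H H)" using cpure_closed[OF acts_H acts_H, of
      "\<Sigma> x" y] xy sx by simp
    show "?c (rev_psi B H H (tmap A A A A \<Sigma> (id_map A) (tpure A A x y))) =
        cpure B ?J ?Y 1 (tpure B A (one B) (tlift A A A (\<lambda>y z. mult A (\<Sigma> y) z) (tpure A A x y)))"
      using xy sx pc by (simp add: id \<Sigma> psip cp bm lin_mmult lin_id_map)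
  qed
  then show ?thesis by simp
qed

lemma hopf_monoid_iff:
  assumes hB: "is_hopf_algebra B"
  shows "is_hopf_monoid B H \<longleftrightarrow> is_hopf_algebra A"
proof -
  let ?Y = "bullet B H (unitI B)" and ?Y' = "bullet B (unitI B) H" and ?J = "unitJ B"
  have aY: "acts B ?Y" and aY': "acts B ?Y'"
    using acts_bullet[OF B acts_H acts_HH(3)] acts_bullet[OF B acts_HH(3) acts_H] .
  have one: "(1 :: 'k) \<in> carr ?J" by simp
  \<comment> \<open>Linearity of the two embeddings moves the scalar \<epsilon>(h) onto the element
    of A, so the right-hand sides of the Hopf monoid axioms are also images of elements of
    A.\<close>
  have r: "lin A (circ B ?Y ?J) (\<lambda>x. cpure B ?Y ?J (tpure A B x (one B)) 1)"
    by (rule lin_cpure_left[OF aY acts_HH(4) _ one]) (simp add: lin_tpure_left lin_ident)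
  have l: "lin A (circ B ?J ?Y') (\<lambda>x. cpure B ?J ?Y' 1 (tpure B A (one B) x))"
    by (rule lin_cpure_right[OF acts_HH(4) aY' _ one]) (simp add: lin_tpure_right lin_ident)
  have iff: "(\<forall>h\<in>carr H.
         cmap B (bullet B (circ B H H) (unitI B)) (unitJ B) (bullet B H (unitI B)) (unitJ B)
           (tmap (circ B H H) (unitI B) H (unitI B) (mmult H) (id_map (unitI B)))
           (id_map (unitJ B))
           (rev_phi B H H (tmap H H H (reversion B H) (id_map H) \<Sigma> (mcomult H h)))
         = scal (circ B (bullet B H (unitI B)) (unitJ B)) (mcounit H h)
             (cpure B (bullet B H (unitI B)) (unitJ B)
               (tpure H (unitI B) (munit H (one B)) (one B)) 1)) \<and>
      (\<forall>h\<in>carr H.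
         cmap B (unitJ B) (bullet B (unitI B) (circ B H H)) (unitJ B) (bullet B (unitI B) H)
           (id_map (unitJ B))
           (tmap (unitI B) (circ B H H) (unitI B) H (id_map (unitI B)) (mmult H))
           (rev_psi B H H (tmap H H (reversion B H) H \<Sigma> (id_map H) (mcomult H h)))
         = scal (circ B (unitJ B) (bullet B (unitI B) H)) (mcounit H h)
             (cpure B (unitJ B) (bullet B (unitI B) H) 1
               (tpure (unitI B) H (one B) (munit H (one B))))) \<longleftrightarrow> is_antipode A \<Sigma>"
    (is "(\<forall>h\<in>_. ?P1 h = ?P2 h) \<and> (\<forall>h\<in>_. ?Q1 h = ?Q2 h) \<longleftrightarrow> _")
    if S: "\<Sigma> \<in> linear_maps A A" for \<Sigma>
  proof -
    note lS = linear_maps_lin[OF S]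
    let ?a = "\<lambda>h. tlift A A A (\<lambda>y z. mult A y (\<Sigma> z)) (comult A h)"
    let ?b = "\<lambda>h. tlift A A A (\<lambda>y z. mult A (\<Sigma> y) z) (comult A h)"
    let ?e = "\<lambda>h. scal A (counit A h) (one A)"
    have a: "?a h \<in> carr A" and b: "?b h \<in> carr A" if "h \<in> carr A" for h
      using lin_closed[OF lin_tlift[OF vs(1) vs(1) vs(1) bilin_mult_map[OF lin_ident lS]], of
        "comult A h"]
        lin_closed[OF lin_tlift[OF vs(1) vs(1) vs(1) bilin_mult_map[OF lS lin_ident]], of
          "comult A h"] that
      by simp_all
    have P1: "?P1 h = cpure B ?Y ?J (tpure A B (?a h) (one B)) 1" if "h \<in> carr A" for h
      using hopf_right_value[OF lS, of "comult A h"] that by simp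
    have P2: "?P2 h = cpure B ?Y ?J (tpure A B (?e h) (one B)) 1" for h
      using lin_scal[OF r one_closed[OF alg(1)], of "counit A h"] by (simp add: u_one)
    have Q1: "?Q1 h = cpure B ?J ?Y' 1 (tpure B A (one B) (?b h))" if "h \<in> carr A" for h
      using hopf_left_value[OF lS, of "comult A h"] that by simp
    have Q2: "?Q2 h = cpure B ?J ?Y' 1 (tpure B A (one B) (?e h))" for h
      using lin_scal[OF l one_closed[OF alg(1)], of "counit A h"] by (simp add: u_one)
    have e: "?e h \<in> carr A" for h by simp
    \<comment> \<open>Both sides lie in the image of one injective map, which can be cancelled to
      leave an antipode axiom at h.\<close>
    have "?P1 h = ?P2 h \<longleftrightarrow> ?a h = ?e h" if "h \<in> carr A" for h
      unfolding P1[OF that] P2 using hopf_right_injective[OF hB a[OF that] e] by metis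
    moreover have "?Q1 h = ?Q2 h \<longleftrightarrow> ?b h = ?e h" if "h \<in> carr A" for h
      unfolding Q1[OF that] Q2 using hopf_left_injective[OF hB b[OF that] e] by metis
    ultimately show ?thesis
      unfolding is_antipode_def H_vspace using S by blast
  qed
  \<comment> \<open>For the left action, \<Sigma>(u(b) x) = \<Sigma>(x) \<Sigma>(u(b)) = \<Sigma>(x)
    u(S b), which is the action of b on the reversion; the right action is analogous.\<close>
  have anti: "\<Sigma> \<in> bimodule_maps B H (reversion B H)" if S: "is_antipode A \<Sigma>" for \<Sigma>
  proof -
    note SB = is_antipode_antipode[OF hB] and Sc = antipode_closed[OF A S]
    have "\<Sigma> (lact H b x) = lact (reversion B H) b (\<Sigma> x)" "\<Sigma> (ract H x b) =
        ract (reversion B H) (\<Sigma> x) b"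
      if "b \<in> carr B" "x \<in> carr A" for b x
      using that Sc antipode_closed[OF B SB]
      by (simp_all add: lact_reversion ract_reversion antipode_mult[OF A S]
          bialgebra_map_antipode[OF A S B SB u])
    then show ?thesis using antipode_linear[OF A S]
      by (simp add: bimodule_maps_def del: lact_H ract_H)
  qed
  have lin: "\<Sigma> \<in> linear_maps A A" if "\<Sigma> \<in> bimodule_maps B H (reversion B H)" for \<Sigma>
    using that by (simp add: bimodule_maps_def)
  show ?thesis
    unfolding is_hopf_monoid_def is_hopf_algebra_def using bimonoid_H A iff anti lin by blast
qed

subsection \<open>Cocommutativity and quasitriangular structures\<close>

lemma alg_map_uu: "alg_map (tensor_algebra B B) (tensor_algebra A A) (tmap B B A A u u)"
  by (rule alg_map_tmap) (simp_all add: bialgebra_map_alg[OF u])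

lemma uu_closed [simp]: "R \<in> carr (tensor B B) \<Longrightarrow> tmap B B A A u u R \<in> carr (tensor A A)"
  by (rule lin_closed[OF lin_uu])

text \<open>The braiding of \<Delta>(x) is the flipped coproduct conjugated by R, with the inverse
  of R on the left. Multiplying by R and its inverse on the outer sides solves the cocommutativity
  equation for the flipped coproduct. The algebra map u \<otimes> u carries the inverse of S to the
  inverse of R.\<close>

lemma cocommutative_iff:
  assumes S: "S \<in> carr (tensor B B)" and S': "inverse_of (algebra2 B) S S'"
  defines "R \<equiv> tmap B B A A u u S"
  shows "is_cocommutative B S H \<longleftrightarrow> (\<forall>x\<in>carr A. tflip A A (comult A x) =
    mult (algebra2 A) (mult (algebra2 A) R (comult A x)) (alg_inverse (algebra2 A) R))"
proof -
  let ?m = "mult (algebra2 A)" and ?R' = "tmap B B A A u u S'"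
    and ?one = "tpure A A (one A) (one A)"
  have A2: "is_algebra (algebra2 A)" and B2: "is_algebra (algebra2 B)" by simp_all
  have S'c: "S' \<in> carr (tensor B B)" using S' by (simp add: inverse_of_def)
  have Rc: "R \<in> carr (tensor A A)" "?R' \<in> carr (tensor A A)" using S S'c by (simp_all add: R_def)
  have inv: "inverse_of (algebra2 A) R ?R'"
    unfolding R_def by (rule inverse_of_alg_map[OF alg_map_uu]) (use S S' in simp_all)
  have ai: "alg_inverse (algebra2 A) R = ?R'" "alg_inverse (algebra2 B) S = S'"
    using alg_inverse_eq[OF A2 _ inv] alg_inverse_eq[OF B2 _ S'] S Rc by simp_all
  have RR: "?m R ?R' = ?one" "?m ?R' R = ?one" using inv by (simp_all add: inverse_of_def)
  note mc = mult_closed[OF A2, simplified] and as = mult_assoc[OF A2, simplified]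
    and ml = mult_one_left[OF A2, simplified] and mr = mult_one_right[OF A2, simplified]
  have "braiding B S H H (comult A x) = comult A x \<longleftrightarrow> tflip A A (comult A x) =
      ?m (?m R (comult A x)) ?R'"
    if x: "x \<in> carr A" for x
  proof -
    let ?d = "comult A x" and ?f = "tflip A A (comult A x)"
    have d: "?d \<in> carr (tensor A A)" and f: "?f \<in> carr (tensor A A)"
      using x lin_closed[OF lin_tflip[OF vs(1) vs(1)]] by simp_all
    have "lact2 B H H S' ?f = ?m ?R' ?f" by (rule lact2_H[OF S'c f])
    then have br: "braiding B S H H ?d = ?m (?m ?R' ?f) R"
      using d by (simp add: braiding_def ai ract2_H[OF S] mc[OF Rc(2) f] R_def)
    show ?thesis
    proof
      assume "braiding B S H H ?d = ?d"
      then have "?m (?m R ?d) ?R' = ?m (?m R (?m (?m ?R' ?f) R)) ?R'" using br by simp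
      also have "\<dots> = ?m (?m (?m R ?R') ?f) (?m R ?R')" using Rc d f by (simp add: as mc)
      also have "\<dots> = ?f" using f by (simp add: RR ml mr)
      finally show "?f = ?m (?m R ?d) ?R'" by simp
    next
      assume "?f = ?m (?m R ?d) ?R'"
      then have "braiding B S H H ?d = ?m (?m ?R' (?m (?m R ?d) ?R')) R" using br by simp
      also have "\<dots> = ?m (?m (?m ?R' R) ?d) (?m ?R' R)" using Rc d f by (simp add: as mc)
      also have "\<dots> = ?d" using d by (simp add: RR ml mr)
      finally show "braiding B S H H ?d = ?d" .
    qed
  qed
  then show ?thesis unfolding is_cocommutative_def ai by simp
qed

lemma quasitriangular_iff:
  assumes S: "is_quasitriangular B S"
  shows "is_hopf_monoid B H \<and> is_cocommutative B S H \<longleftrightarrow> is_quasitriangular A (tmap B B A A u u S)"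
proof -
  let ?uu = "tmap B B A A u u"
  let ?B2 = "tensor B B" and ?A2 = "tensor A A"
  let ?f3 = "tmap B ?B2 A ?A2 u ?uu"
  have hB: "is_hopf_algebra B" and Sc: "S \<in> carr ?B2"
    and S1: "tmap B B B ?B2 (id_map B) (comult B) S = mult (algebra3 B) (leg13 B S) (leg12 B S)"
    and S2: "tassoc B B B (tmap B B ?B2 B (comult B) (id_map B) S) =
        mult (algebra3 B) (leg13 B S) (leg23 B S)"
    using S by (simp_all add: is_quasitriangular_def)
  obtain S' where S': "inverse_of (algebra2 B) S S'" using S unfolding is_quasitriangular_def
    by blast
  have "inverse_of (algebra2 A) (?uu S) (?uu S')"
    by (rule inverse_of_alg_map[OF alg_map_uu]) (use Sc S' in simp_all)
  then have inv: "\<exists>R'. inverse_of (algebra2 A) (?uu S) R'" by blast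
  have f3: "alg_map (algebra3 B) (algebra3 A) ?f3"
    using alg_map_tmap[of B "algebra2 B" A "algebra2 A" u ?uu] bialgebra_map_alg[OF u] alg_map_uu
      by simp
  have lf3: "lin (tensor B ?B2) (tensor A ?A2) ?f3" using alg_map_lin[OF f3] by simp
  have f3p: "?f3 (tpure B ?B2 x t) = tpure A ?A2 (u x) (?uu t)" if "x \<in> carr B" "t \<in> carr ?B2"
    for x t
    by (rule tmap_tpure) (use that in \<open>simp_all add: lin_u lin_uu\<close>)
  note legs = legs_natural[OF alg(2) alg(1) bialgebra_map_alg[OF u] Sc]
  have lc: "leg12 B S \<in> carr (tensor B ?B2)" "leg13 B S \<in> carr (tensor B ?B2)"
    "leg23 B S \<in> carr (tensor B ?B2)"
    using lin_closed[OF lin_legs(1)[OF alg(2)] Sc] lin_closed[OF lin_legs(2)[OF alg(2)] Sc]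
      lin_closed[OF lin_legs(3)[OF alg(2)] Sc] by simp_all
  have idA: "lin A A (id_map A)" and idB: "lin B B (id_map B)" by (simp_all add: lin_id_map)
  note dA = lin_comult[OF A] and dB = lin_comult[OF B]
  \<comment> \<open>As u is comultiplicative, applying \<Delta> to the second leg commutes with u.
    The left-hand side is therefore the image under u \<otimes> u \<otimes> u of the corresponding
    identity in B, and \<open>legs\<close> identifies the image of the right-hand side.\<close>
  have 1: "tmap A A A ?A2 (id_map A) (comult A) (?uu S) =
      mult (algebra3 A) (leg13 A (?uu S)) (leg12 A (?uu S))"
  proof -
    have "tmap A A A ?A2 (id_map A) (comult A) (?uu S) =
        ?f3 (tmap B B B ?B2 (id_map B) (comult B) S)"
    proof (rule tensor_eqI[where V = B and W = B and Z = "tensor A ?A2" and t = S])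
      show "lin ?B2 (tensor A ?A2) (\<lambda>S. tmap A A A ?A2 (id_map A) (comult A) (?uu S))"
        by (rule lin_comp[OF lin_tmap lin_uu]) (use idA dA in simp_all)
      show "lin ?B2 (tensor A ?A2) (\<lambda>S. ?f3 (tmap B B B ?B2 (id_map B) (comult B) S))"
        by (rule lin_comp[OF lf3 lin_tmap]) (use idB dB in simp_all)
    qed (use Sc in \<open>simp_all add: lin_u idA idB dA dB f3p u_comult\<close>)
    also have "\<dots> = mult (algebra3 A) (leg13 A (?uu S)) (leg12 A (?uu S))"
      unfolding S1 using alg_map_mult[OF f3, of "leg13 B S" "leg12 B S"] lc by (simp add: legs)
    finally show ?thesis .
  qed
  \<comment> \<open>Naturality of the associator, with w arbitrary because it will be a coproduct in
    B rather than a pure tensor.\<close>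
  have as: "tassoc A A A (tpure ?A2 A (?uu w) (u s)) = ?f3 (tassoc B B B (tpure ?B2 B w s))"
    if s: "s \<in> carr B" and w: "w \<in> carr ?B2" for w s
  proof (rule tensor_eqI[where V = B and W = B and Z = "tensor A ?A2" and t = w])
    show "lin ?B2 (tensor A ?A2) (\<lambda>w. tassoc A A A (tpure ?A2 A (?uu w) (u s)))"
      by (rule lin_comp[OF lin_tassoc lin_tpure_left[OF _ _ lin_uu]]) (use s in simp_all)
    show "lin ?B2 (tensor A ?A2) (\<lambda>w. ?f3 (tassoc B B B (tpure ?B2 B w s)))"
      by (rule lin_comp[OF lf3 lin_comp[OF lin_tassoc lin_tpure_left[OF _ _ lin_ident]]])
        (use s in simp_all)
  qed (use s w in \<open>simp_all add: lin_u f3p\<close>)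
  have 2: "tassoc A A A (tmap A A ?A2 A (comult A) (id_map A) (?uu S)) =
      mult (algebra3 A) (leg13 A (?uu S)) (leg23 A (?uu S))"
  proof -
    have "tassoc A A A (tmap A A ?A2 A (comult A) (id_map A) (?uu S)) =
        ?f3 (tassoc B B B (tmap B B ?B2 B (comult B) (id_map B) S))"
    proof (rule tensor_eqI[where V = B and W = B and Z = "tensor A ?A2" and t = S])
      show "lin ?B2 (tensor A ?A2) (\<lambda>S. tassoc A A A (tmap A A ?A2 A (comult A) (id_map A) (?uu
          S)))"
        by (rule lin_comp[OF lin_tassoc lin_comp[OF lin_tmap lin_uu]]) (use idA dA in simp_all)
      show "lin ?B2 (tensor A ?A2) (\<lambda>S. ?f3 (tassoc B B B (tmap B B ?B2 B (comult B) (id_map B)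
          S)))"
        by (rule lin_comp[OF lf3 lin_comp[OF lin_tassoc lin_tmap]]) (use idB dB in simp_all)
    qed (use Sc in \<open>simp_all add: lin_u idA idB dA dB u_comult as\<close>)
    also have "\<dots> = mult (algebra3 A) (leg13 A (?uu S)) (leg23 A (?uu S))"
      unfolding S2 using alg_map_mult[OF f3, of "leg13 B S" "leg23 B S"] lc by (simp add: legs)
    finally show ?thesis .
  qed
  show ?thesis
    unfolding hopf_monoid_iff[OF hB] cocommutative_iff[OF Sc S'] is_quasitriangular_def
    using inv 1 2 Sc by simp
qed

end

subsection \<open>Morphisms of bimonoids\<close>

text \<open>Both actions are multiplications by values of u or u', so a multiplicative map under B
  is automatically B-linear. Conversely, compatibility with \<open>mmult\<close> gives
  multiplicativity at pure tensors. The hom-sets are therefore equal as sets of functions.\<close>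

lemma bimonoid_maps_under:
  assumes "bialgebra_under B A u" "bialgebra_under B A' u'"
  shows "bimonoid_maps B (bimonoid_under B A u) (bimonoid_under B A' u') =
    {f \<in> bialgebra_maps A A'. compose (carr B) f u = u'}"
proof (rule set_eqI)
  interpret X: bialgebra_under B A u by fact
  interpret Y: bialgebra_under B A' u' by fact
  fix f
  have u': "u' \<in> extensional (carr B)"
    using bialgebra_map_linear[OF Y.u] by (simp add: linear_maps_iff)
  have c: "compose (carr B) f u = u' \<longleftrightarrow> (\<forall>b\<in>carr B. f (u b) = u' b)"
    using u' by (auto simp: compose_def fun_eq_iff extensional_def)
  show "f \<in> bimonoid_maps B X.H Y.H \<longleftrightarrow> f \<in> {f \<in> bialgebra_maps A A'. compose (carr B) f u = u'}"
  \<comment> \<open>Each side forces f to be linear and to commute with the maps from B. Settling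
    this first makes f available for evaluation on tensors in both directions.\<close>
  proof (cases "f \<in> linear_maps A A' \<and> (\<forall>b\<in>carr B. f (u b) = u' b)")
    case False
    then show ?thesis
      unfolding mem_Collect_eq c unfolding bimonoid_maps_def bimodule_maps_def bialgebra_maps_def
        by auto
  next
    case True
    then have f: "f \<in> linear_maps A A'" and fu: "f (u b) = u' b" if "b \<in> carr B" for b using that
      by auto
    have lf: "lin A A' f" using True by (simp add: linear_maps_lin)
    note fc [simp] = lin_closed[OF lf]
    have lfH: "lin X.H Y.H f" using lf by simp
    have one: "f (one A) = one A'" using fu[of "one B"] by (simp add: X.u_one Y.u_one)
    have m: "f (mmult X.H t) = mmult Y.H (cmap B X.H X.H Y.H Y.H f f t)"
      if mult: "\<And>x y. x \<in> carr A \<Longrightarrow> y \<in> carr A \<Longrightarrow> f (mult A x y) = mult A' (f x) (f y)"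
        and t: "t \<in> carr (circ B X.H X.H)" for t
    proof (rule circ_eqI[OF X.acts_H X.acts_H Y.vs(1) _ _ _ t])
      \<comment> \<open>B-linearity is needed already to evaluate \<open>cmap\<close>, whose lift is
        meaningful only for maps respecting the balancing relations.\<close>
      have r: "f (ract X.H x b) = ract Y.H (f x) b" "f (lact X.H b x) = lact Y.H b (f x)"
        if "b \<in> carr B" "x \<in> carr X.H" for b x using that by (simp_all add: mult fu)
      show "lin (circ B X.H X.H) A' (\<lambda>t. f (mmult X.H t))" by (rule lin_comp[OF lf X.lin_mmult])
      show "lin (circ B X.H X.H) A' (\<lambda>t. mmult Y.H (cmap B X.H X.H Y.H Y.H f f t))"
        by (rule Y.lin_mmult_comp[OF lin_cmap[OF X.acts_H X.acts_H Y.acts_H Y.acts_H lfH lfH r]])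
      show "f (mmult X.H (cpure B X.H X.H x y)) = mmult Y.H (cmap B X.H X.H Y.H Y.H f f (cpure B X.H
          X.H x y))"
        if "x \<in> carr X.H" "y \<in> carr X.H" for x y
        using that cmap_cpure[OF X.acts_H X.acts_H Y.acts_H Y.acts_H lfH lfH r that]
          by (simp add: mult)
    qed
    have mult: "f (mult A x y) = mult A' (f x) (f y)"
      if bm: "f \<in> bimonoid_maps B X.H Y.H" and xy: "x \<in> carr A" "y \<in> carr A" for x y
    proof -
      have r: "f (ract X.H x b) = ract Y.H (f x) b" "f (lact X.H b x) = lact Y.H b (f x)"
        if "b \<in> carr B" "x \<in> carr X.H" for b x
        using bm that unfolding bimonoid_maps_def bimodule_maps_def by blast+
      have "cpure B X.H X.H x y \<in> carr (circ B X.H X.H)" using cpure_closed[OF X.acts_H X.acts_H] xy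
        by simp
      then have "f (mmult X.H (cpure B X.H X.H x y)) =
          mmult Y.H (cmap B X.H X.H Y.H Y.H f f (cpure B X.H X.H x y))"
        using bm unfolding bimonoid_maps_def by blast
      also have "cmap B X.H X.H Y.H Y.H f f (cpure B X.H X.H x y) = cpure B Y.H Y.H (f x) (f y)"
        using cmap_cpure[OF X.acts_H X.acts_H Y.acts_H Y.acts_H lfH lfH r, of x y] xy by simp
      finally show ?thesis using xy by simp
    qed
    show ?thesis
    proof
      assume bm: "f \<in> bimonoid_maps B X.H Y.H"
      then show "f \<in> {f \<in> bialgebra_maps A A'. compose (carr B) f u = u'}"
        unfolding mem_Collect_eq c bialgebra_maps_def
        using mult[OF bm] one True by (simp add: bimonoid_maps_def)
    next
      assume "f \<in> {f \<in> bialgebra_maps A A'. compose (carr B) f u = u'}"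
      then have bf: "f \<in> bialgebra_maps A A'" by simp
      note mu = bialgebra_map_mult[OF bf]
      show "f \<in> bimonoid_maps B X.H Y.H"
        unfolding bimonoid_maps_def bimodule_maps_def
        using m[OF mu] True
          by (simp add: mu bialgebra_map_comult[OF bf] bialgebra_map_counit[OF bf])
    qed
  qed
qed

section \<open>The isomorphism of categories\<close>

lemma is_category_coslice:
  assumes C: "is_category C" and A: "A \<in> obj C"
  shows "is_category (coslice C A)"
proof -
  have id: "ident C X \<in> hom C X X" if "X \<in> obj C" for X
    using C that unfolding is_category_def by blast
  have comp: "comp C X Y Z g f \<in> hom C X Z"
    if "X \<in> obj C" "Y \<in> obj C" "Z \<in> obj C" "f \<in> hom C X Y" "g \<in> hom C Y Z" for X Y Z f g
    using C that unfolding is_category_def by blast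
  have unit: "comp C X X Y f (ident C X) = f" "comp C X Y Y (ident C Y) f = f"
    if "X \<in> obj C" "Y \<in> obj C" "f \<in> hom C X Y" for X Y f
    using C that unfolding is_category_def by blast+
  have assoc: "comp C W X Z (comp C X Y Z h g) f = comp C W Y Z h (comp C W X Y g f)"
    if "W \<in> obj C" "X \<in> obj C" "Y \<in> obj C" "Z \<in> obj C" "f \<in> hom C W X" "g \<in> hom C X Y"
      "h \<in> hom C Y Z"
    for W X Y Z f g h
    using C that unfolding is_category_def by blast
  show ?thesis
    unfolding is_category_def
  proof (intro conjI ballI)
    fix X assume "X \<in> obj (coslice C A)"
    then show "ident (coslice C A) X \<in> hom (coslice C A) X X"
      using A id unit by (auto simp: coslice_def)
  next
    fix X Y Z f g
    assume "X \<in> obj (coslice C A)" "Y \<in> obj (coslice C A)" "Z \<in> obj (coslice C A)"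
      "f \<in> hom (coslice C A) X Y" "g \<in> hom (coslice C A) Y Z"
    then show "comp (coslice C A) X Y Z g f \<in> hom (coslice C A) X Z"
      using A comp assoc by (auto simp: coslice_def)
  next
    fix X Y f assume "X \<in> obj (coslice C A)" "Y \<in> obj (coslice C A)" "f \<in> hom (coslice C A) X Y"
    then show "comp (coslice C A) X X Y f (ident (coslice C A) X) = f"
      "comp (coslice C A) X Y Y (ident (coslice C A) Y) f = f"
      using unit by (auto simp: coslice_def)
  next
    fix W X Y Z f g h
    assume "W \<in> obj (coslice C A)" "X \<in> obj (coslice C A)" "Y \<in> obj (coslice C A)"
      "Z \<in> obj (coslice C A)"
      "f \<in> hom (coslice C A) W X" "g \<in> hom (coslice C A) X Y" "h \<in> hom (coslice C A) Y Z"
    then show "comp (coslice C A) W X Z (comp (coslice C A) X Y Z h g) f =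
        comp (coslice C A) W Y Z h (comp (coslice C A) W X Y g f)"
      using assoc by (auto simp: coslice_def)
  qed
qed

text \<open>A criterion for functors that leave the underlying function of every morphism untouched.
  With equal hom-sets, identities and composition, the category axioms of C are inherited from
  D.\<close>

lemma isomorphic_categoriesI:
  fixes C :: "('o, 'm) category" and D :: "('p, 'm) category"
  assumes D: "is_category D"
    and F: "\<And>X. X \<in> obj C \<Longrightarrow> F X \<in> obj D" and G: "\<And>U. U \<in> obj D \<Longrightarrow> G U \<in> obj C"
    and GF: "\<And>X. X \<in> obj C \<Longrightarrow> G (F X) = X" and FG: "\<And>U. U \<in> obj D \<Longrightarrow> F (G U) = U"
    and hom: "\<And>X Y. X \<in> obj C \<Longrightarrow> Y \<in> obj C \<Longrightarrow> hom C X Y = hom D (F X) (F Y)"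
    and ident: "\<And>X. X \<in> obj C \<Longrightarrow> ident C X = ident D (F X)"
    and comp: "\<And>X Y Z. X \<in> obj C \<Longrightarrow> Y \<in> obj C \<Longrightarrow> Z \<in> obj C \<Longrightarrow> comp C X Y Z = comp D (F X) (F Y) (F Z)"
  shows "isomorphic_categories C D"
proof -
  have C: "is_category C"
    using D unfolding is_category_def by (simp add: F hom ident comp)
  have "is_functor C D F (\<lambda>X Y f. f)"
    by (simp add: is_functor_def F hom ident comp)
  moreover have "is_functor D C G (\<lambda>X Y f. f)"
    by (simp add: is_functor_def G FG hom ident comp)
  ultimately show ?thesis
    unfolding isomorphic_categories_def using C D GF FG
    by (intro conjI exI[of _ F] exI[of _ G] exI[of _ "\<lambda>X Y f. f"]) auto
qed

section \<open>The category of quasitriangular Hopf algebras\<close>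

lemma quasitriangular_bialgebra: "is_quasitriangular A R \<Longrightarrow> is_bialgebra A"
  by (simp add: is_quasitriangular_def is_hopf_algebra_def)

lemma quasitriangular_carr: "is_quasitriangular A R \<Longrightarrow> R \<in> carr (tensor A A)"
  by (simp add: is_quasitriangular_def)

lemma linear_maps_compose:
  "is_vspace V \<Longrightarrow> f \<in> linear_maps V W \<Longrightarrow> g \<in> linear_maps W Z \<Longrightarrow> compose (carr V) g f \<in> linear_maps V Z"
  unfolding compose_def
  by (intro linear_maps_restrict lin_comp[of W Z g V f] linear_maps_lin)

lemma tmap_compose:
  assumes "is_vspace V" "is_vspace W" "is_vspace Z" "f \<in> linear_maps V W" "g \<in> linear_maps W Z"
    and t: "t \<in> carr (tensor V V)"
  shows "tmap V V Z Z (compose (carr V) g f) (compose (carr V) g f) t =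
    tmap W W Z Z g g (tmap V V W W f f t)"
proof -
  note l = linear_maps_lin[OF assms(4)] linear_maps_lin[OF assms(5)]
  have "tmap V V Z Z (compose (carr V) g f) (compose (carr V) g f) t =
      tmap V V Z Z (\<lambda>x. g (f x)) (\<lambda>x. g (f x)) t"
    using linear_maps_lin[OF linear_maps_compose[OF assms(1,4,5)]] assms t
    by (intro tmap_cong) (simp_all add: compose_def)
  also have "\<dots> = tmap W W Z Z g g (tmap V V W W f f t)"
    by (rule tmap_tmap[symmetric]) (use assms l in simp_all)
  finally show ?thesis .
qed

lemma bialgebra_maps_compose:
  assumes "is_bialgebra A" "is_bialgebra C" "is_bialgebra E"
    and f: "f \<in> bialgebra_maps A C" and g: "g \<in> bialgebra_maps C E"
  shows "compose (carr A) g f \<in> bialgebra_maps A E"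
  unfolding bialgebra_maps_def
  using assms(1-3) bialgebra_map_linear[OF f] bialgebra_map_linear[OF g]
    linear_maps_compose[OF _ bialgebra_map_linear[OF f] bialgebra_map_linear[OF g]]
  by (simp add: compose_def[of "carr A" g f, THEN fun_cong] tmap_compose
      bialgebra_map_mult[OF f] bialgebra_map_mult[OF g] bialgebra_map_one[OF f] bialgebra_map_one[OF
        g]
      bialgebra_map_comult[OF f] bialgebra_map_comult[OF g] bialgebra_map_counit[OF f]
      bialgebra_map_counit[OF g] bialgebra_map_closed[OF f])

lemma is_category_qtr_hopf: "is_category (qtr_hopf :: (('k::field, 'u) bialgebra \<times> ('k, 'u, 'u)
    tens, 'u \<Rightarrow> 'u) category)"
  unfolding is_category_def
proof (intro conjI ballI)
  fix X :: "('k, 'u) bialgebra \<times> ('k, 'u, 'u) tens" assume "X \<in> obj qtr_hopf"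
  then show "ident qtr_hopf X \<in> hom qtr_hopf X X"
    by (auto simp: qtr_hopf_def bialgebra_maps_id quasitriangular_bialgebra quasitriangular_carr
      tmap_id)
next
  fix X Y Z :: "('k, 'u) bialgebra \<times> ('k, 'u, 'u) tens" and f g
  assume o: "X \<in> obj qtr_hopf" "Y \<in> obj qtr_hopf" "Z \<in> obj qtr_hopf"
    and h: "f \<in> hom qtr_hopf X Y" "g \<in> hom qtr_hopf Y Z"
  obtain A R C S E T where XYZ: "X = (A, R)" "Y = (C, S)" "Z = (E, T)"
    by (cases X, cases Y, cases Z)
  have b: "is_bialgebra A" "is_bialgebra C" "is_bialgebra E" and R: "R \<in> carr (tensor A A)"
    using o by (auto simp: XYZ qtr_hopf_def quasitriangular_bialgebra quasitriangular_carr)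
  have f: "f \<in> bialgebra_maps A C" "tmap A A C C f f R = S"
    and g: "g \<in> bialgebra_maps C E" "tmap C C E E g g S = T"
    using h by (auto simp: XYZ qtr_hopf_def)
  show "comp qtr_hopf X Y Z g f \<in> hom qtr_hopf X Z"
    using bialgebra_maps_compose[OF b f(1) g(1)] b f(2) g(2)
      tmap_compose[OF _ _ _ bialgebra_map_linear[OF f(1)] bialgebra_map_linear[OF g(1)] R]
    by (simp add: XYZ qtr_hopf_def)
next
  fix X Y :: "('k, 'u) bialgebra \<times> ('k, 'u, 'u) tens" and f
  assume o: "X \<in> obj qtr_hopf" "Y \<in> obj qtr_hopf" and h: "f \<in> hom qtr_hopf X Y"
  obtain A R C S where XY: "X = (A, R)" "Y = (C, S)" by (cases X, cases Y)
  have f: "f \<in> bialgebra_maps A C" using h by (auto simp: XY qtr_hopf_def)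
  \<comment> \<open>Composition restricts to the source of f; extensionality ensures that
    restricting f changes nothing.\<close>
  have e: "f \<in> extensional (carr A)" using bialgebra_map_linear[OF f] by (simp add: linear_maps_iff)
  show "comp qtr_hopf X X Y f (ident qtr_hopf X) = f" "comp qtr_hopf X Y Y (ident qtr_hopf Y) f = f"
    using e bialgebra_map_closed[OF f]
    by (auto simp: XY qtr_hopf_def compose_def fun_eq_iff extensional_def)
next
  fix W X Y Z :: "('k, 'u) bialgebra \<times> ('k, 'u, 'u) tens" and f g h
  assume o: "W \<in> obj qtr_hopf" "X \<in> obj qtr_hopf" and h: "f \<in> hom qtr_hopf W X"
  obtain A R C S where WX: "W = (A, R)" "X = (C, S)" by (cases W, cases X)
  have f: "f \<in> bialgebra_maps A C" using h by (auto simp: WX qtr_hopf_def)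
  show "comp qtr_hopf W X Z (comp qtr_hopf X Y Z h g) f =
      comp qtr_hopf W Y Z h (comp qtr_hopf W X Y g f)"
    using bialgebra_map_closed[OF f]
    by (auto simp: WX qtr_hopf_def compose_def fun_eq_iff split: prod.splits)
qed

theorem corollary4p16:
  fixes B :: "('k::field, 'u) bialgebra" and S :: "('k, 'u, 'u) tens"
  assumes "is_quasitriangular B S"
  shows "isomorphic_categories
           (hopf_coc B S :: (('k, 'u, 'u) bimonoid, 'u \<Rightarrow> 'u) category)
           (coslice qtr_hopf (B, S))"
proof -
  note B = quasitriangular_bialgebra[OF assms] and Sc = quasitriangular_carr[OF assms]
  let ?C = "hopf_coc B S :: (('k, 'u, 'u) bimonoid, 'u \<Rightarrow> 'u) category"
  let ?D = "coslice qtr_hopf (B, S)"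
  \<comment> \<open>The R-matrix is not a choice: a morphism u from (B, S) in the coslice forces it
    to be the image of S under u \<otimes> u. For this reason G may discard it and F can restore
    it.\<close>
  define F where "F H = ((bialgebra_of B H,
    tmap B B (bialgebra_of B H) (bialgebra_of B H) (munit H) (munit H) S), munit H)" for H :: "('k,
      'u, 'u) bimonoid"
  define G where "G = (\<lambda>((A, R :: ('k, 'u, 'u) tens), u). bimonoid_under B A u :: ('k, 'u, 'u)
      bimonoid)"
  have objC: "H \<in> obj ?C \<longleftrightarrow> is_bimonoid B H \<and> is_hopf_monoid B H \<and> is_cocommutative B S H" for H
    by (simp add: hopf_coc_def full_subcategory_def bimonoids_def)
  have objD: "((A, R), u) \<in> obj ?D \<longleftrightarrow> is_quasitriangular A R \<and> u \<in> bialgebra_maps B A \<and> tmap B B A A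
      u u S = R"
    for A R u by (simp add: coslice_def qtr_hopf_def)
  have under: "bialgebra_under B (bialgebra_of B H) (munit H)" if "H \<in> obj ?C" for H
    using that by (intro bialgebra_under_bialgebra_of B) (simp add: objC)
  have GF: "G (F H) = H" if "H \<in> obj ?C" for H
    using that bimonoid_under_bialgebra_of[OF B, of H] by (simp add: objC F_def G_def)
  have F: "F H \<in> obj ?D" if H: "H \<in> obj ?C" for H
  proof -
    interpret bialgebra_under B "bialgebra_of B H" "munit H" by (rule under[OF H])
    have "bimonoid_under B (bialgebra_of B H) (munit H) = H" using GF[OF H]
      by (simp add: F_def G_def)
    then show ?thesis
      using quasitriangular_iff[OF assms] H u by (simp add: objC F_def objD)
  qed
  have under': "bialgebra_under B A u" if "((A, R), u) \<in> obj ?D" for A R u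
    using that B by unfold_locales (auto simp: objD quasitriangular_bialgebra)
  have G: "G U \<in> obj ?C" if "U \<in> obj ?D" for U
  proof -
    obtain A R u where U: "U = ((A, R), u)" by (metis prod.exhaust)
    interpret bialgebra_under B A u by (rule under'[OF that[unfolded U]])
    show ?thesis using that quasitriangular_iff[OF assms] bimonoid_H
      by (auto simp: U G_def objC objD)
  qed
  have FG: "F (G U) = U" if "U \<in> obj ?D" for U
  proof -
    obtain A R u where U: "U = ((A, R), u)" by (metis prod.exhaust)
    interpret bialgebra_under B A u by (rule under'[OF that[unfolded U]])
    show ?thesis using that bialgebra_of_H by (simp add: U F_def G_def objD)
  qed
  show ?thesis
  proof (rule isomorphic_categoriesI[where F = F and G = G])
    show "is_category ?D"
      by (rule is_category_coslice[OF is_category_qtr_hopf]) (simp add: qtr_hopf_def assms)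
    fix X Y assume X: "X \<in> obj ?C" and Y: "Y \<in> obj ?C"
    interpret X: bialgebra_under B "bialgebra_of B X" "munit X" by (rule under[OF X])
    interpret Y: bialgebra_under B "bialgebra_of B Y" "munit Y" by (rule under[OF Y])
    have eq: "bimonoid_under B (bialgebra_of B X) (munit X) = X"
      "bimonoid_under B (bialgebra_of B Y) (munit Y) = Y"
      using GF[OF X] GF[OF Y] by (simp_all add: F_def G_def)
    \<comment> \<open>Both R-matrices are images of S, so every bialgebra map under B transports one
      to the other. The morphism condition on R-matrices is thus automatic in the coslice.\<close>
    have R: "tmap (bialgebra_of B X) (bialgebra_of B X) (bialgebra_of B Y) (bialgebra_of B Y) f f
        (tmap B B (bialgebra_of B X) (bialgebra_of B X) (munit X) (munit X) S) =
      tmap B B (bialgebra_of B Y) (bialgebra_of B Y) (munit Y) (munit Y) S"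
      if "f \<in> bialgebra_maps (bialgebra_of B X) (bialgebra_of B Y)" "compose (carr B) f (munit X) =
          munit Y" for f
      using tmap_compose[OF X.vs(2) X.vs(1) Y.vs(1) bialgebra_map_linear[OF X.u]
        bialgebra_map_linear[OF that(1)] Sc]
      by (simp only: that(2))
    have "hom ?C X Y = bimonoid_maps B X Y"
      by (simp add: hopf_coc_def full_subcategory_def bimonoids_def)
    also have "\<dots> = {f \<in> bialgebra_maps (bialgebra_of B X) (bialgebra_of B Y). compose (carr B) f
        (munit X) = munit Y}"
      using bimonoid_maps_under[OF under[OF X] under[OF Y]] by (simp only: eq)
    also have "\<dots> = hom ?D (F X) (F Y)"
      using R by (auto simp: coslice_def qtr_hopf_def F_def)
    finally show "hom ?C X Y = hom ?D (F X) (F Y)" .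
  next
    show "ident ?C X = ident ?D (F X)" for X
      by (simp add: hopf_coc_def full_subcategory_def bimonoids_def coslice_def qtr_hopf_def F_def
          same_vspace_simps[OF same_vspace_bialgebra_of])
    show "comp ?C X Y Z = comp ?D (F X) (F Y) (F Z)" for X Y Z
      by (simp add: hopf_coc_def full_subcategory_def bimonoids_def coslice_def qtr_hopf_def F_def
          same_vspace_simps[OF same_vspace_bialgebra_of])
  qed (use F G GF FG in simp_all)
qed

end
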